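(* Let $g\ge 1$ and let $\mathcal{M}^g$ be the set of maps of genus $g$ all of whose faces have even degree. For $\varepsilon\in\{+,-\}$, define $\Psi^{\varepsilon}\colon\mathcal{M}^g\to\mathcal{M}^g$ by letting $\Psi^{\varepsilon}(\mathbf{m})$ be the first coordinate of $\Phi(\mathbf{m},\boldsymbol{\lambda}_\mathbf{m},\varepsilon)$. Then $\Psi^{+}$ and $\Psi^{-}$ are inverse bijections of each other. Furthermore, they preserve the number of edges of the map, and they preserve the type of the map when the faces are labeled.
   Context: A map is a cellular embedding of a finite connected graph (multiple edges and loops allowed) into a compact orientable surface, up to homeomorphism, with a distinguished corner (the root); its incident vertex is the root vertex. The type of a map with faces labeled $f_1,\dots,f_r$ is $(\deg f_1,\dots,\deg f_r)$. A half-edge is an oriented edge, from tail $e^-$ to head $e^+$. A path is a sequence $(e_1,\dots,e_k)$ of half-edges with $e_i^+=e_{i+1}^-$; it is simple if the vertices it visits are pairwise distinct. Concatenation is denoted $\bullet$. A loop is a path with $e_k^+=e_1^-$; it is simple if $(e_1,\dots,e_{k-1})$ is simple; it is noncontractible if its traced closed curve is not null-homotopic on the surface. Rotation $\Phi$: given $\mathbf{m}$, a noncontractible simple loop $\boldsymbol{\gamma}=(\gamma_1,\dots,\gamma_k)$ and $\varepsilon\in\{+,-\}$, cut the surface along $\boldsymbol{\gamma}$, obtaining a left copy $(\gamma^\ell_i)_i$ and a right copy $(\gamma^r_i)_i$ on two boundary components; glue $\gamma^r_i$ to $\gamma^\ell_{i+1}$ if $\varepsilon=+$, resp. $\gamma^\ell_{i-1}$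 if $\varepsilon=-$ (indices mod $k$); the resulting map $\tilde{\mathbf{m}}$ inherits root and face labels; $\tilde{\boldsymbol{\gamma}}$ is the image loop formed by the glued half-edges, and $\tilde\varepsilon=-\varepsilon$. $\Phi(\mathbf{m},\boldsymbol{\gamma},\varepsilon):=(\tilde{\mathbf{m}},\tilde{\boldsymbol{\gamma}},\tilde\varepsilon)$. Rightmost noncontractible simple loop $\boldsymbol{\lambda}_\mathbf{m}$: let $\mathcal{S}$ be the set of paths $\mathbf{p}\bullet\boldsymbol{\gamma}$ with $\mathbf{p}$ a simple path starting at the root vertex and $\boldsymbol{\gamma}$ a noncontractible simple loop intersecting $\mathbf{p}$ only at the origin of $\boldsymbol{\gamma}$ (the end of $\mathbf{p}$). Build $\boldsymbol{\wp}$ iteratively: $\wp_1$ is the first half-edge, turning counterclockwise around the root vertex starting from the root corner, that is the first half-edge of some element of $\mathcal{S}$; given $(\wp_1,\dots,\wp_i)$, if it belongs to $\mathcal{S}$ stop, otherwise let $\wp_{i+1}$ be the first half-edge after $\wp_i$ counterclockwise around $\wp_i^+$ such that some element of $\mathcal{S}$ has prefix $(\wp_1,\dots,\wp_{i+1})$. Writing the final path as $\boldsymbol{\wp}=\mathbf{p}\bullet\boldsymbol{\gamma}\in\mathcal{S}$, set $\boldsymbol{\lambda}_\mathbf{m}:=\boldsymbol{\gamma}$. *)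

theory Defs
  imports "HOL-Analysis.Analysis" "HOL-Combinatorics.Orbits"
begin

section \<open>Maps as gluings of polygons\<close>

text \<open>
  A rooted map on an oriented surface is presented by its faces, which are polygons with oriented
  sides, and by the way these sides are glued in pairs.  The polygon lies to the left of each of its
  sides, so a side is the same thing as a half-edge (the half-edge whose left face is that polygon).
  The permutation \<open>nxt\<close> sends a side to the following side of its polygon, counterclockwise, and
  \<open>rev\<close> sends a side to the side it is glued to, i.e. a half-edge to its reverse.  A corner is named
  by the half-edge which starts there and has the corner on its left; \<open>root\<close> names the root corner.
\<close>

record 'a rmap =
  darts :: "'a set"
  rev :: "'a \<Rightarrow> 'a"
  nxt :: "'a \<Rightarrow> 'a"
  root :: 'a

hide_const (open) List.rev

text \<open>
  The half-edge following \<open>d\<close> counterclockwise around the tail of \<open>d\<close>: cross the corner on the left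
  of \<open>d\<close>; the side that ends at this corner is the reverse of the half-edge looked for.
\<close>

definition rot :: "'a rmap \<Rightarrow> 'a \<Rightarrow> 'a" where
  "rot m d = rev m (inv (nxt m) d)"

definition tail :: "'a rmap \<Rightarrow> 'a \<Rightarrow> 'a set" where
  "tail m d = orbit (rot m) d"

definition head :: "'a rmap \<Rightarrow> 'a \<Rightarrow> 'a set" where
  "head m d = tail m (rev m d)"

definition vertices :: "'a rmap \<Rightarrow> 'a set set" where
  "vertices m = tail m ` darts m"

definition edges :: "'a rmap \<Rightarrow> 'a set set" where
  "edges m = (\<lambda>d. {d, rev m d}) ` darts m"

definition faces :: "'a rmap \<Rightarrow> 'a set set" where
  "faces m = orbit (nxt m) ` darts m"

definition face_degree :: "'a set \<Rightarrow> nat" where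
  "face_degree f = card f"

definition connected_darts :: "'a rmap \<Rightarrow> bool" where
  "connected_darts m \<longleftrightarrow> (\<forall>x\<in>darts m. \<forall>y\<in>darts m.
     (x, y) \<in> ({(d, rev m d) |d. d \<in> darts m} \<union> {(d, rot m d) |d. d \<in> darts m})\<^sup>*)"

definition is_map :: "'a rmap \<Rightarrow> bool" where
  "is_map m \<longleftrightarrow> finite (darts m) \<and> root m \<in> darts m \<and>
     nxt m permutes darts m \<and> rev m permutes darts m \<and>
     (\<forall>d\<in>darts m. rev m d \<noteq> d \<and> rev m (rev m d) = d) \<and>
     connected_darts m"

definition has_genus :: "'a rmap \<Rightarrow> nat \<Rightarrow> bool" where
  "has_genus m g \<longleftrightarrow>
     int (card (vertices m)) - int (card (edges m)) + int (card (faces m)) = 2 - 2 * int g"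


section \<open>The surface of a map\<close>

text \<open>
  The triple \<open>(d, s, t)\<close> is a point of the polygon containing the side \<open>d\<close>, seen as the cone over
  its boundary: \<open>t\<close> is the position along \<open>d\<close>, from tail to head, and \<open>s\<close> is the radial coordinate,
  with \<open>s = 0\<close> at the centre of the polygon and \<open>s = 1\<close> on its boundary.  Each side thus contributes
  one triangular sector.  The first two identifications below assemble the sectors into polygons, the
  third one glues the sides.
\<close>

type_synonym 'a point = "'a \<times> real \<times> real"

definition sectors :: "'a rmap \<Rightarrow> 'a point topology" where
  "sectors m = prod_topology (discrete_topology (darts m))
     (prod_topology (top_of_set {0..1}) (top_of_set {0..1}))"

inductive glue :: "'a rmap \<Rightarrow> 'a point \<Rightarrow> 'a point \<Rightarrow> bool" for m where
  centre: "d \<in> darts m \<Longrightarrow> t \<in> {0..1} \<Longrightarrow> t' \<in> {0..1} \<Longrightarrow> glue m (d, 0, t) (d, 0, t')"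
| sector: "d \<in> darts m \<Longrightarrow> s \<in> {0..1} \<Longrightarrow> glue m (d, s, 1) (nxt m d, s, 0)"
| side: "d \<in> darts m \<Longrightarrow> t \<in> {0..1} \<Longrightarrow> glue m (d, 1, t) (rev m d, 1, 1 - t)"

definition glue_rel :: "'a rmap \<Rightarrow> ('a point \<times> 'a point) set" where
  "glue_rel m = {(x, y). x \<in> topspace (sectors m) \<and> y \<in> topspace (sectors m) \<and>
                         equivclp (glue m) x y}"

definition surface :: "'a rmap \<Rightarrow> 'a point set topology" where
  "surface m = topology (\<lambda>U. U \<subseteq> topspace (sectors m) // glue_rel m \<and> openin (sectors m) (\<Union>U))"

lemma equiv_glue_rel: "equiv (topspace (sectors m)) (glue_rel m)"
proof (rule equivI)
  show "refl_on (topspace (sectors m)) (glue_rel m)"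
    by (auto simp: refl_on_def glue_rel_def)
  show "sym (glue_rel m)"
    by (auto simp: sym_def glue_rel_def intro: equivclp_sym)
  show "trans (glue_rel m)"
    unfolding trans_def glue_rel_def by (auto intro: equivclp_trans)
qed (auto simp: glue_rel_def)

lemma openin_surface:
  "openin (surface m) U \<longleftrightarrow>
     U \<subseteq> topspace (sectors m) // glue_rel m \<and> openin (sectors m) (\<Union>U)"
proof -
  let ?Q = "topspace (sectors m) // glue_rel m"
  have "istopology (\<lambda>U. U \<subseteq> ?Q \<and> openin (sectors m) (\<Union>U))"
    unfolding istopology_def
  proof (intro conjI allI impI)
    fix S T assume S: "S \<subseteq> ?Q \<and> openin (sectors m) (\<Union>S)" and T: "T \<subseteq> ?Q \<and> openin (sectors m) (\<Union>T)"
    then show "S \<inter> T \<subseteq> ?Q" by auto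
    have "\<Union>(S \<inter> T) = \<Union>S \<inter> \<Union>T"
    proof
      show "\<Union>S \<inter> \<Union>T \<subseteq> \<Union>(S \<inter> T)"
      proof
        fix x assume "x \<in> \<Union>S \<inter> \<Union>T"
        then obtain A B where AB: "A \<in> S" "B \<in> T" "x \<in> A" "x \<in> B" by auto
        then have "A = B"
          using S T quotient_disj[OF equiv_glue_rel, of A m B] by blast
        with AB show "x \<in> \<Union>(S \<inter> T)" by auto
      qed
    qed auto
    with S T show "openin (sectors m) (\<Union>(S \<inter> T))" by auto
  next
    fix \<K> assume K: "\<forall>K\<in>\<K>. K \<subseteq> ?Q \<and> openin (sectors m) (\<Union>K)"
    then show "\<Union>\<K> \<subseteq> ?Q" by auto
    have "\<Union>(\<Union>\<K>) = \<Union>(Union ` \<K>)" by auto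
    with K show "openin (sectors m) (\<Union>(\<Union>\<K>))" by (metis imageE openin_Union)
  qed
  then show ?thesis by (simp add: surface_def topology_inverse')
qed

text \<open>
  The closed curve traced by a nonempty sequence of \<open>k\<close> half-edges: for \<open>x\<close> in
  \<open>[i / k, (i + 1) / k]\<close> it runs along the \<open>i\<close>-th half-edge, counted from 0.
\<close>

definition trace :: "'a rmap \<Rightarrow> 'a list \<Rightarrow> real \<Rightarrow> 'a point set" where
  "trace m p x =
     (let k = length p; i = min (nat \<lfloor>real k * x\<rfloor>) (k - 1)
      in glue_rel m `` {(p ! i, 1, real k * x - real i)})"

text \<open>
  This is free homotopy of closed curves, as in \<open>homotopic_loops\<close>, which is restricted to
  subsets of a type in class \<open>topological_space\<close>.
\<close>

definition null_homotopic :: "'a rmap \<Rightarrow> (real \<Rightarrow> 'a point set) \<Rightarrow> bool" where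
  "null_homotopic m c \<longleftrightarrow>
     (\<exists>a. homotopic_with (\<lambda>h. h 0 = h 1) (top_of_set {0..1}) (surface m) c (\<lambda>_. a))"


section \<open>Paths and loops\<close>

fun path_from :: "'a rmap \<Rightarrow> 'a set \<Rightarrow> 'a list \<Rightarrow> bool" where
  "path_from m v [] \<longleftrightarrow> True"
| "path_from m v (e # es) \<longleftrightarrow> e \<in> darts m \<and> tail m e = v \<and> path_from m (head m e) es"

text \<open>The starting vertex is explicit because the empty path also visits a vertex.\<close>

definition visited :: "'a rmap \<Rightarrow> 'a set \<Rightarrow> 'a list \<Rightarrow> 'a set list" where
  "visited m v p = v # map (head m) p"

definition simple_path :: "'a rmap \<Rightarrow> 'a set \<Rightarrow> 'a list \<Rightarrow> bool" where
  "simple_path m v p \<longleftrightarrow> path_from m v p \<and> distinct (visited m v p)"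

definition origin :: "'a rmap \<Rightarrow> 'a list \<Rightarrow> 'a set" where
  "origin m \<gamma> = tail m (hd \<gamma>)"

definition is_loop :: "'a rmap \<Rightarrow> 'a list \<Rightarrow> bool" where
  "is_loop m \<gamma> \<longleftrightarrow> \<gamma> \<noteq> [] \<and> path_from m (origin m \<gamma>) \<gamma> \<and> head m (last \<gamma>) = origin m \<gamma>"

definition simple_loop :: "'a rmap \<Rightarrow> 'a list \<Rightarrow> bool" where
  "simple_loop m \<gamma> \<longleftrightarrow> is_loop m \<gamma> \<and> simple_path m (origin m \<gamma>) (butlast \<gamma>)"

definition noncontractible :: "'a rmap \<Rightarrow> 'a list \<Rightarrow> bool" where
  "noncontractible m \<gamma> \<longleftrightarrow> \<not> null_homotopic m (trace m \<gamma>)"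


section \<open>The rightmost noncontractible simple loop\<close>

definition root_vertex :: "'a rmap \<Rightarrow> 'a set" where
  "root_vertex m = tail m (root m)"

definition lasso :: "'a rmap \<Rightarrow> 'a list \<Rightarrow> 'a list \<Rightarrow> bool" where
  "lasso m p \<gamma> \<longleftrightarrow>
     simple_path m (root_vertex m) p \<and> simple_loop m \<gamma> \<and> noncontractible m \<gamma> \<and>
     last (visited m (root_vertex m) p) = origin m \<gamma> \<and>
     set (visited m (root_vertex m) p) \<inter> set (visited m (origin m \<gamma>) \<gamma>) = {origin m \<gamma>}"

definition lassos :: "'a rmap \<Rightarrow> 'a list set" where
  "lassos m = {p @ \<gamma> |p \<gamma>. lasso m p \<gamma>}"

text \<open>
  The half-edges around a vertex are read counterclockwise.  From the root corner, which follows the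
  half-edge \<open>root m\<close>, one meets \<open>rot m (root m)\<close> first and \<open>root m\<close> last; after arriving by \<open>e\<close>, one
  meets \<open>rot m (rev m e)\<close> first and \<open>rev m e\<close> last.
\<close>

definition sweep_start :: "'a rmap \<Rightarrow> 'a list \<Rightarrow> 'a" where
  "sweep_start m p = (if p = [] then root m else rev m (last p))"

definition extendable :: "'a rmap \<Rightarrow> 'a list \<Rightarrow> bool" where
  "extendable m p \<longleftrightarrow> (\<exists>q. p @ q \<in> lassos m)"

definition next_dart :: "'a rmap \<Rightarrow> 'a list \<Rightarrow> 'a" where
  "next_dart m p =
     (let turn = (\<lambda>n. (rot m ^^ Suc n) (sweep_start m p))
      in turn (LEAST n. extendable m (p @ [turn n])))"

fun rightmost_prefix :: "'a rmap \<Rightarrow> nat \<Rightarrow> 'a list" where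
  "rightmost_prefix m 0 = []"
| "rightmost_prefix m (Suc i) = rightmost_prefix m i @ [next_dart m (rightmost_prefix m i)]"

definition rightmost_lasso :: "'a rmap \<Rightarrow> 'a list" where
  "rightmost_lasso m = rightmost_prefix m (LEAST i. rightmost_prefix m i \<in> lassos m)"

definition rightmost_loop :: "'a rmap \<Rightarrow> 'a list" where
  "rightmost_loop m = (THE \<gamma>. \<exists>p. rightmost_lasso m = p @ \<gamma> \<and> lasso m p \<gamma>)"


section \<open>Rotation along a loop\<close>

datatype sign = Plus | Minus

fun opposite :: "sign \<Rightarrow> sign" where
  "opposite Plus = Minus"
| "opposite Minus = Plus"

text \<open>The list whose \<open>i\<close>-th entry is \<open>\<gamma>\<close> at \<open>i + 1\<close>, resp. at \<open>i - 1\<close>, cyclically.\<close>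

fun shift :: "sign \<Rightarrow> 'a list \<Rightarrow> 'a list" where
  "shift Plus \<gamma> = rotate 1 \<gamma>"
| "shift Minus \<gamma> = rotate (length \<gamma> - 1) \<gamma>"

text \<open>
  Cutting along \<open>\<gamma>\<close> leaves the polygons intact and undoes the gluing of each side \<open>\<gamma> ! i\<close>, which is
  the left copy of this half-edge, with the side \<open>rev m (\<gamma> ! i)\<close>, which is the right copy (traversed
  backwards).  Right copies are then glued to shifted left copies.  Half-edges of the new map being
  sides, the glued half-edges are named after the left copies; corners, in particular the
  root, and faces are those of the uncut polygons.
\<close>

definition reglue :: "'a rmap \<Rightarrow> 'a list \<Rightarrow> sign \<Rightarrow> 'a \<Rightarrow> 'a" where
  "reglue m \<gamma> \<epsilon> d =
     (let right = map (rev m) \<gamma>; left = shift \<epsilon> \<gamma>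
      in case map_of (zip right left @ zip left right) d of Some d' \<Rightarrow> d' | None \<Rightarrow> rev m d)"

definition rotation :: "'a rmap \<times> 'a list \<times> sign \<Rightarrow> 'a rmap \<times> 'a list \<times> sign" where
  "rotation = (\<lambda>(m, \<gamma>, \<epsilon>). (m\<lparr>rev := reglue m \<gamma> \<epsilon>\<rparr>, \<gamma>, opposite \<epsilon>))"

definition psi :: "sign \<Rightarrow> 'a rmap \<Rightarrow> 'a rmap" where
  "psi \<epsilon> m = fst (rotation (m, rightmost_loop m, \<epsilon>))"


section \<open>Maps up to homeomorphism\<close>

definition iso_via :: "('a \<Rightarrow> 'b) \<Rightarrow> 'a rmap \<Rightarrow> 'b rmap \<Rightarrow> bool" where
  "iso_via h m m' \<longleftrightarrow> bij_betw h (darts m) (darts m') \<and>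
     (\<forall>d\<in>darts m. h (rev m d) = rev m' (h d) \<and> h (nxt m d) = nxt m' (h d)) \<and>
     h (root m) = root m'"

definition iso_rel :: "('a rmap \<times> 'a rmap) set" where
  "iso_rel = {(m, m'). is_map m \<and> is_map m' \<and> (\<exists>h. iso_via h m m')}"

text \<open>Every finite map has a representative whose half-edges are natural numbers.\<close>

definition even_maps :: "nat \<Rightarrow> nat rmap set" where
  "even_maps g = {m. is_map m \<and> has_genus m g \<and> (\<forall>f\<in>faces m. even (face_degree f))}"

definition Maps :: "nat \<Rightarrow> nat rmap set set" where
  "Maps g = even_maps g // iso_rel"

definition Psi :: "sign \<Rightarrow> nat rmap set \<Rightarrow> nat rmap set" where
  "Psi \<epsilon> C = (\<Union>m\<in>C. iso_rel `` {psi \<epsilon> m})"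

text \<open>
  A map with labeled faces comes with the list \<open>f\<^sub>1, \<dots>, f\<^sub>r\<close> of its faces.  Faces being sets of sides,
  the face of the new map that inherits the label of \<open>f\<close> is the set \<open>f\<close> itself.
\<close>

type_synonym 'a labeled_map = "'a rmap \<times> 'a set list"

definition is_labeling :: "'a rmap \<Rightarrow> 'a set list \<Rightarrow> bool" where
  "is_labeling m fs \<longleftrightarrow> distinct fs \<and> set fs = faces m"

definition type_of :: "'a labeled_map \<Rightarrow> nat list" where
  "type_of = (\<lambda>(m, fs). map face_degree fs)"

definition labeled_iso_rel :: "('a labeled_map \<times> 'a labeled_map) set" where
  "labeled_iso_rel = {((m, fs), (m', fs')).
     is_map m \<and> is_labeling m fs \<and> is_map m' \<and> is_labeling m' fs' \<and>
     (\<exists>h. iso_via h m m' \<and> map ((`) h) fs = fs')}"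

definition Labeled_Maps :: "nat \<Rightarrow> nat labeled_map set set" where
  "Labeled_Maps g = {(m, fs). m \<in> even_maps g \<and> is_labeling m fs} // labeled_iso_rel"

definition labeled_psi :: "sign \<Rightarrow> 'a labeled_map \<Rightarrow> 'a labeled_map" where
  "labeled_psi \<epsilon> = (\<lambda>(m, fs). (psi \<epsilon> m, fs))"

definition Labeled_Psi :: "sign \<Rightarrow> nat labeled_map set \<Rightarrow> nat labeled_map set" where
  "Labeled_Psi \<epsilon> L = (\<Union>x\<in>L. labeled_iso_rel `` {labeled_psi \<epsilon> x})"

end

theory Submission
  imports Defs "HOL-Library.Z2"
begin

text \<open>
  Label the corners of a map by elements of a group \<open>G\<close> so that the increments along the two sides of
  every edge are opposite.  Such a labeling \<open>\<phi>\<close> amounts to a homomorphism from the fundamental group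
  to \<open>G\<close>, together with a gauge, and a loop is noncontractible iff its holonomy is nonzero for some
  \<open>\<phi>\<close>.  Labelings of \<open>m\<close> and of the map \<open>m'\<close> rotated along \<open>\<gamma>\<close> correspond to each other by a change
  of gauge to the left of \<open>\<gamma>\<close>, so that lassos which do not meet the left side of \<open>\<gamma>\<close> are the same in
  \<open>m\<close> and \<open>m'\<close>, with the same holonomy up to that gauge.

  If \<open>p \<bullet> \<gamma>\<close> is the rightmost lasso of \<open>m\<close>, then its image is the rightmost lasso of \<open>m'\<close>: a lasso of
  \<open>m'\<close> further to the right either avoids \<open>\<gamma>\<close>, or could be closed up along \<open>\<gamma>\<close> where it first meets it,
  and in both cases would yield a lasso of \<open>m\<close> further to the right than \<open>p \<bullet> \<gamma>\<close>.  Hence rotating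
  back along the rightmost loop of \<open>m'\<close> restores \<open>m\<close>.  That lassos exist in positive genus is seen by
  counting labelings with values in the group of order 2.
\<close>

text \<open>The topology is confined to one equivalence, \<open>null_homotopic_iff_holonomy\<close>;
  what follows it concerns permutations of half-edges only. Groups are arbitrary and written
  additively, so that the order of sums matters: commutative groups would miss the separating simple
  loops, which can be noncontractible although all their holonomies in commutative groups vanish.

  The rotation is harmless because the rightmost lasso reaches its loop \<gamma> from the right. Had
  it arrived on the left, the counterclockwise sweep would have met the reverse of \<gamma> before
  \<gamma>, and a loop and its reverse are noncontractible together. Hence the left side of \<gamma>
  can slide without touching the lasso.

  When a competing lasso is closed up along \<gamma>, the result is noncontractible for one of three
  reasons: the new loop is conjugate to \<gamma>; or it crosses \<gamma> exactly once, so that an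
  intersection number is nonzero; or the competitor and \<gamma> form a theta graph, in which two of
  the cycles cannot both have zero holonomy because that of \<gamma> is a combination of
  theirs.\<close>

hide_const (open) List.rev

section \<open>Holonomy of null-homotopic loops\<close>

locale rooted_map =
  fixes m :: "'a rmap"
  assumes is_map: "is_map m"
begin

lemma finite_darts: "finite (darts m)"
  and root_in: "root m \<in> darts m"
  and nxt_permutes: "nxt m permutes darts m"
  and rev_permutes: "rev m permutes darts m"
  and rev_neq: "d \<in> darts m \<Longrightarrow> rev m d \<noteq> d"
  and rev_rev: "d \<in> darts m \<Longrightarrow> rev m (rev m d) = d"
  and connected: "connected_darts m"
  using is_map by (auto simp: is_map_def)

lemma rev_in [simp]: "rev m d \<in> darts m \<longleftrightarrow> d \<in> darts m"
  by (rule permutes_in_image[OF rev_permutes])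

lemma nxt_in [simp]: "nxt m d \<in> darts m \<longleftrightarrow> d \<in> darts m"
  by (rule permutes_in_image[OF nxt_permutes])

lemma topspace_sectors: "topspace (sectors m) = darts m \<times> {0..1} \<times> {0..1}"
  by (simp add: sectors_def)

lemma glue_topspace:
  assumes "glue m x y"
  shows "x \<in> topspace (sectors m)" "y \<in> topspace (sectors m)"
  using assms by (cases; auto simp: topspace_sectors)+

lemma equivclp_glue_topspace:
  assumes "equivclp (glue m) x y"
  shows "x \<in> topspace (sectors m) \<longleftrightarrow> y \<in> topspace (sectors m)"
  using assms
proof (induction rule: equivclp_induct)
  case (step y z)
  then show ?case using glue_topspace by blast
qed simp

abbreviation pcls :: "'a point \<Rightarrow> 'a point set" where
  "pcls y \<equiv> glue_rel m `` {y}"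

lemma pcls_self: "y \<in> topspace (sectors m) \<Longrightarrow> y \<in> pcls y"
  by (simp add: glue_rel_def)

lemma pcls_eq: "glue m x y \<Longrightarrow> pcls x = pcls y"
  using glue_topspace[of x y] equiv_class_eq[OF equiv_glue_rel]
  by (fastforce simp: glue_rel_def)

lemma pcls_centre: "d \<in> darts m \<Longrightarrow> t \<in> {0..1} \<Longrightarrow> t' \<in> {0..1} \<Longrightarrow> pcls (d, 0, t) = pcls (d, 0, t')"
  and pcls_sector: "d \<in> darts m \<Longrightarrow> s \<in> {0..1} \<Longrightarrow> pcls (d, s, 1) = pcls (nxt m d, s, 0)"
  and pcls_side: "d \<in> darts m \<Longrightarrow> t \<in> {0..1} \<Longrightarrow> pcls (d, 1, t) = pcls (rev m d, 1, 1 - t)"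
  by (rule pcls_eq, simp add: glue.intros)+

lemma topspace_surface: "topspace (surface m) = topspace (sectors m) // glue_rel m"
proof
  show "topspace (surface m) \<subseteq> topspace (sectors m) // glue_rel m"
    using openin_surface[of m "topspace (surface m)"] by simp
  have "\<Union>(topspace (sectors m) // glue_rel m) = topspace (sectors m)"
    using Union_quotient[OF equiv_glue_rel] .
  then show "topspace (sectors m) // glue_rel m \<subseteq> topspace (surface m)"
    by (metis openin_surface openin_topspace openin_subset order_refl)
qed

lemma pcls_in_surface: "y \<in> topspace (sectors m) \<Longrightarrow> pcls y \<in> topspace (surface m)"
  by (auto simp: topspace_surface quotientI)

lemma surface_point_eq_pcls:
  assumes "X \<in> topspace (surface m)" "y \<in> X"
  shows "y \<in> topspace (sectors m)" "X = pcls y"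
proof -
  from assms obtain z where z: "z \<in> topspace (sectors m)" "X = pcls z"
    by (auto simp: topspace_surface elim: quotientE)
  with assms show "y \<in> topspace (sectors m)" by (auto simp: glue_rel_def)
  from z assms show "X = pcls y"
    using equiv_class_eq[OF equiv_glue_rel] by fastforce
qed

lemma surface_point_nonempty:
  assumes "X \<in> topspace (surface m)"
  obtains y where "y \<in> X" "y \<in> topspace (sectors m)" "X = pcls y"
  using assms pcls_self by (auto simp: topspace_surface elim!: quotientE)

lemma continuous_map_pcls: "continuous_map (sectors m) (surface m) (\<lambda>y. pcls y)"
proof -
  have "{x \<in> topspace (sectors m). pcls x \<in> U} = \<Union>U" if "openin (surface m) U" for U
  proof -
    have "U \<subseteq> topspace (surface m)" using that openin_subset by blast
    then show ?thesis
      using surface_point_eq_pcls pcls_self by (auto; blast)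
  qed
  then show ?thesis
    using openin_surface by (auto simp: continuous_map_def pcls_in_surface)
qed

lemma saturated_openin:
  assumes "openin (sectors m) A"
    and sat: "\<And>x y. glue m x y \<Longrightarrow> x \<in> A \<longleftrightarrow> y \<in> A"
  shows "openin (surface m) (pcls ` A)" "\<Union>(pcls ` A) = A"
proof -
  have "x \<in> A \<longleftrightarrow> y \<in> A" if "equivclp (glue m) x y" for x y
    using that by (induction rule: equivclp_induct) (use sat in blast)+
  moreover have "A \<subseteq> topspace (sectors m)"
    using assms(1) openin_subset by blast
  ultimately show *: "\<Union>(pcls ` A) = A"
    using pcls_self by (auto simp: glue_rel_def)
  show "openin (surface m) (pcls ` A)"
    unfolding openin_surface * using assms(1) \<open>A \<subseteq> _\<close> by (auto simp: quotientI)
qed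

end

section \<open>Corner labelings and the flat bundles which they define\<close>

definition admissible :: "'a rmap \<Rightarrow> ('a \<Rightarrow> 'g::group_add) \<Rightarrow> bool" where
  "admissible m \<phi> \<longleftrightarrow> (\<forall>d\<in>darts m. - \<phi> (rev m d) + \<phi> (nxt m (rev m d)) = - (- \<phi> d + \<phi> (nxt m d)))"

definition holonomy :: "'a rmap \<Rightarrow> ('a \<Rightarrow> 'g::group_add) \<Rightarrow> 'a list \<Rightarrow> 'g" where
  "holonomy m \<phi> p = sum_list (map (\<lambda>d. - \<phi> d + \<phi> (nxt m d)) p)"

lemma holonomy_simps [simp]:
  "holonomy m \<phi> [] = 0"
  "holonomy m \<phi> (d # p) = - \<phi> d + \<phi> (nxt m d) + holonomy m \<phi> p"
  "holonomy m \<phi> (p @ q) = holonomy m \<phi> p + holonomy m \<phi> q"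
  by (simp_all add: holonomy_def)

text \<open>Read a labeling as a flat principal bundle, trivialized over each polygon, whose
  transition across the side \<open>d\<close> is left translation by
  \<open>\<phi> d - \<phi> (nxt m (rev m d))\<close>. Then \<open>s\<close> is a locally constant
  section over \<open>U\<close> in the coordinates of the polygons. It is a function on the sectors
  and not on the surface because it jumps from one side of an edge to the other. Right translations
  by constants turn sections into sections.\<close>

definition local_section ::
    "'a rmap \<Rightarrow> ('a \<Rightarrow> 'g::group_add) \<Rightarrow> 'a point set set \<Rightarrow> ('a point \<Rightarrow> 'g) \<Rightarrow> bool" where
  "local_section m \<phi> U s \<longleftrightarrow> openin (surface m) U \<and>
     (\<forall>y\<in>\<Union>U. \<exists>W. openin (sectors m) W \<and> y \<in> W \<and> (\<forall>y'\<in>W. s y' = s y)) \<and>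
     (\<forall>d\<in>darts m.
        (\<forall>t\<in>{0..1}. \<forall>t'\<in>{0..1}. (d, 0, t) \<in> \<Union>U \<longrightarrow> s (d, 0, t) = s (d, 0, t')) \<and>
        (\<forall>r\<in>{0..1}. (d, r, 1) \<in> \<Union>U \<longrightarrow> s (d, r, 1) = s (nxt m d, r, 0)) \<and>
        (\<forall>t\<in>{0..1}. (d, 1, t) \<in> \<Union>U \<longrightarrow>
           s (d, 1, t) = \<phi> d - \<phi> (nxt m (rev m d)) + s (rev m d, 1, 1 - t)))"

lemma local_sectionD:
  assumes "local_section m \<phi> U s" "d \<in> darts m"
  shows "t \<in> {0..1} \<Longrightarrow> t' \<in> {0..1} \<Longrightarrow> (d, 0, t) \<in> \<Union>U \<Longrightarrow> s (d, 0, t) = s (d, 0, t')"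
    and "r \<in> {0..1} \<Longrightarrow> (d, r, 1) \<in> \<Union>U \<Longrightarrow> s (d, r, 1) = s (nxt m d, r, 0)"
    and "t \<in> {0..1} \<Longrightarrow> (d, 1, t) \<in> \<Union>U \<Longrightarrow>
           s (d, 1, t) = \<phi> d - \<phi> (nxt m (rev m d)) + s (rev m d, 1, 1 - t)"
  using assms unfolding local_section_def by blast+

lemma local_section_nhd:
  assumes "local_section m \<phi> U s" "y \<in> \<Union>U"
  obtains W where "openin (sectors m) W" "y \<in> W" "\<forall>y'\<in>W. s y' = s y"
  using assms unfolding local_section_def by blast

text \<open>A horizontal lift of \<open>f\<close> over \<open>A\<close>. Instead of building a
  covering space and asking for a continuous map into it, the lift is asked to agree locally with a
  section over the surface, up to a right translation.\<close>

definition section_along ::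
    "'a rmap \<Rightarrow> ('a \<Rightarrow> 'g::group_add) \<Rightarrow> ('z::topological_space \<Rightarrow> 'a point set) \<Rightarrow> 'z set \<Rightarrow>
     ('z \<Rightarrow> 'a point \<Rightarrow> 'g) \<Rightarrow> bool" where
  "section_along m \<phi> f A \<sigma> \<longleftrightarrow>
     (\<forall>z\<in>A. \<exists>N U s g. open N \<and> z \<in> N \<and> local_section m \<phi> U s \<and>
        (\<forall>z'\<in>N \<inter> A. f z' \<in> U \<and> (\<forall>y\<in>f z'. \<sigma> z' y = s y + g)))"

lemma section_alongE:
  assumes "section_along m \<phi> f A \<sigma>" "z \<in> A"
  obtains N U s g where "open N" "z \<in> N" "local_section m \<phi> U s"
    "\<And>z'. z' \<in> N \<Longrightarrow> z' \<in> A \<Longrightarrow> f z' \<in> U"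
    "\<And>z' y. z' \<in> N \<Longrightarrow> z' \<in> A \<Longrightarrow> y \<in> f z' \<Longrightarrow> \<sigma> z' y = s y + g"
proof -
  from assms have "\<exists>N U s g. open N \<and> z \<in> N \<and> local_section m \<phi> U s \<and>
        (\<forall>z'\<in>N \<inter> A. f z' \<in> U \<and> (\<forall>y\<in>f z'. \<sigma> z' y = s y + g))"
    unfolding section_along_def by (rule bspec)
  then show thesis using that by (elim exE conjE) blast
qed

lemma section_along_subset:
  assumes "section_along m \<phi> f A \<sigma>" "B \<subseteq> A"
  shows "section_along m \<phi> f B \<sigma>"
  unfolding section_along_def
proof
  fix z assume "z \<in> B"
  then have "z \<in> A" using assms(2) by blast
  then obtain N U s g where "open N" "z \<in> N" "local_section m \<phi> U s"
    "\<And>z'. z' \<in> N \<Longrightarrow> z' \<in> A \<Longrightarrow> f z' \<in> U"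
    "\<And>z' y. z' \<in> N \<Longrightarrow> z' \<in> A \<Longrightarrow> y \<in> f z' \<Longrightarrow> \<sigma> z' y = s y + g"
    by (rule section_alongE[OF assms(1)]) (rule that)
  then show "\<exists>N U s g. open N \<and> z \<in> N \<and> local_section m \<phi> U s \<and>
        (\<forall>z'\<in>N \<inter> B. f z' \<in> U \<and> (\<forall>y\<in>f z'. \<sigma> z' y = s y + g))"
    using assms(2) by (intro exI[of _ N] exI[of _ U] exI[of _ s] exI[of _ g]) auto
qed

section \<open>Uniqueness and gluing of lifts, and existence of local sections\<close>

context rooted_map
begin

text \<open>The transitions act on the left and cancel in the quotient \<open>- s y + s' y\<close>,
  which therefore descends to the surface and is locally constant there.\<close>

lemma local_section_ratio:
  fixes \<phi> :: "'a \<Rightarrow> 'g::group_add"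
  assumes "local_section m \<phi> U s" "local_section m \<phi> U' s'" and X: "X \<in> U" "X \<in> U'"
  obtains V g where "openin (surface m) V" "X \<in> V" "V \<subseteq> U \<inter> U'"
    "\<And>Y y. Y \<in> V \<Longrightarrow> y \<in> Y \<Longrightarrow> s' y = s y + g"
proof -
  let ?r = "\<lambda>y. - s y + s' y"
  have oU: "openin (surface m) U" "openin (surface m) U'"
    using assms by (auto simp: local_section_def)
  then have sub: "U \<subseteq> topspace (surface m)" "U' \<subseteq> topspace (surface m)"
    using openin_subset by blast+
  have glue_ratio: "?r y = ?r y'" if gl: "glue m y y'" and y: "y \<in> \<Union>U" "y \<in> \<Union>U'" for y y'
    using gl
  proof cases
    case (centre d t t')
    then show ?thesis using local_sectionD(1)[OF assms(1) centre(3-)] local_sectionD(1)[OF assms(2) centre(3-)] y centre(1,2) by simp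
  next
    case (sector d r)
    then show ?thesis using local_sectionD(2)[OF assms(1) sector(3-)] local_sectionD(2)[OF assms(2) sector(3-)] y sector(1,2) by simp
  next
    case (side d t)
    then have "s y = \<phi> d - \<phi> (nxt m (rev m d)) + s y'" "s' y = \<phi> d - \<phi> (nxt m (rev m d)) + s' y'"
      using local_sectionD(3)[OF assms(1) side(3-)] local_sectionD(3)[OF assms(2) side(3-)] y side(1,2) by simp_all
    then show ?thesis by (simp add: minus_add add.assoc diff_conv_add_uminus del: add_uminus_conv_diff)
  qed
  have const: "?r y = ?r y'" if Y: "Y \<in> U" "Y \<in> U'" "y \<in> Y" "y' \<in> Y" for Y y y'
  proof -
    have "equivclp (glue m) y y'"
      using Y sub surface_point_eq_pcls(2)[of Y y] by (auto simp: glue_rel_def)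
    then show ?thesis
    proof (induction rule: equivclp_induct)
      case (step u v)
      have "u \<in> Y"
        using Y sub surface_point_eq_pcls[of Y y] step(1) equivclp_glue_topspace[OF step(1)]
        by (auto simp: glue_rel_def)
      moreover from this step have "v \<in> Y"
        using Y sub surface_point_eq_pcls[of Y u] glue_topspace[of u v] glue_topspace[of v u]
        by (auto simp: glue_rel_def)
      ultimately have "u \<in> \<Union>U" "u \<in> \<Union>U'" "v \<in> \<Union>U" "v \<in> \<Union>U'"
        using Y by auto
      then have "?r u = ?r v"
        using step(2) glue_ratio[of u v] glue_ratio[of v u] by auto
      with step(3) show ?case by simp
    qed simp
  qed
  obtain x where x: "x \<in> X" using X sub surface_point_nonempty by blast
  \<comment> \<open>The points at which the quotient has the same value as at \<open>X\<close>; this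
    set is open because \<open>s\<close> and \<open>s'\<close> are locally constant on the
    sectors.\<close>
  define V where "V = {Y \<in> U \<inter> U'. \<forall>y\<in>Y. ?r y = ?r x}"
  have "openin (sectors m) (\<Union>V)"
  proof (subst openin_subopen, intro ballI)
    fix y assume "y \<in> \<Union>V"
    then obtain Y where Y: "Y \<in> U" "Y \<in> U'" "y \<in> Y" "?r y = ?r x" by (auto simp: V_def)
    obtain W where W: "openin (sectors m) W" "y \<in> W" "\<forall>y'\<in>W. s y' = s y"
      using local_section_nhd[OF assms(1)] Y by blast
    obtain W' where W': "openin (sectors m) W'" "y \<in> W'" "\<forall>y'\<in>W'. s' y' = s' y"
      using local_section_nhd[OF assms(2)] Y by blast
    let ?W = "W \<inter> W' \<inter> \<Union>(U \<inter> U')"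
    have "openin (sectors m) (\<Union>(U \<inter> U'))"
      using openin_Int[OF oU] openin_surface by blast
    then have "openin (sectors m) ?W" using W W' by (intro openin_Int) auto
    moreover have "?W \<subseteq> \<Union>V"
    proof
      fix z assume z: "z \<in> ?W"
      then obtain Z where Z: "Z \<in> U" "Z \<in> U'" "z \<in> Z" by auto
      have "s z = s y" "s' z = s' y" using z W W' by blast+
      then have rz: "?r z = ?r x" using Y(4) by simp
      have "?r y = ?r x" if "y \<in> Z" for y using const[OF Z(1,2) that Z(3)] rz by (rule trans)
      then have "Z \<in> V" using Z unfolding V_def by blast
      with Z show "z \<in> \<Union>V" by auto
    qed
    ultimately show "\<exists>T. openin (sectors m) T \<and> y \<in> T \<and> T \<subseteq> \<Union>V"
      using Y W W' by blast
  qed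
  moreover have "V \<subseteq> topspace (sectors m) // glue_rel m"
    using sub by (auto simp: V_def topspace_surface)
  ultimately have "openin (surface m) V" by (simp add: openin_surface)
  moreover have "X \<in> V" using X const[OF X _ x] unfolding V_def by blast
  moreover have "s' y = s y + ?r x" if "Y \<in> V" "y \<in> Y" for Y y
  proof -
    from that(1) have "\<forall>y\<in>Y. ?r y = ?r x" unfolding V_def by (rule CollectE) (erule conjE, assumption)
    then have "?r y = ?r x" using that(2) by (rule bspec)
    then show ?thesis by (metis add_minus_cancel)
  qed
  ultimately show ?thesis using that[of V "?r x"] unfolding V_def by blast
qed

text \<open>Comparing both lifts with local sections shows that their quotient is locally constant
  in the parameter, hence constant on a connected set.\<close>

lemma section_along_unique:
  fixes \<phi> :: "'a \<Rightarrow> 'g::group_add" and f :: "'z::topological_space \<Rightarrow> 'a point set"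
  assumes "connected A" and f: "continuous_map (top_of_set A) (surface m) f"
    and "section_along m \<phi> f A \<sigma>" "section_along m \<phi> f A \<sigma>'"
  obtains g where "\<And>z y. z \<in> A \<Longrightarrow> y \<in> f z \<Longrightarrow> \<sigma>' z y = \<sigma> z y + g"
proof -
  have loc: "\<exists>N g. open N \<and> z \<in> N \<and> (\<forall>z'\<in>N \<inter> A. \<forall>y\<in>f z'. \<sigma>' z' y = \<sigma> z' y + g)" if z: "z \<in> A" for z
  proof -
    obtain N U s g where 1: "open N" "z \<in> N" "local_section m \<phi> U s"
      "\<And>z'. z' \<in> N \<Longrightarrow> z' \<in> A \<Longrightarrow> f z' \<in> U"
      "\<And>z' y. z' \<in> N \<Longrightarrow> z' \<in> A \<Longrightarrow> y \<in> f z' \<Longrightarrow> \<sigma> z' y = s y + g"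
      by (rule section_alongE[OF assms(3) z]) (rule that)
    obtain N' U' s' g' where 2: "open N'" "z \<in> N'" "local_section m \<phi> U' s'"
      "\<And>z'. z' \<in> N' \<Longrightarrow> z' \<in> A \<Longrightarrow> f z' \<in> U'"
      "\<And>z' y. z' \<in> N' \<Longrightarrow> z' \<in> A \<Longrightarrow> y \<in> f z' \<Longrightarrow> \<sigma>' z' y = s' y + g'"
      by (rule section_alongE[OF assms(4) z]) (rule that)
    have "f z \<in> U" "f z \<in> U'" using 1(4)[OF 1(2) z] 2(4)[OF 2(2) z] .
    note fzU = this
    obtain V k where V: "openin (surface m) V" "f z \<in> V"
      "\<And>Y y. Y \<in> V \<Longrightarrow> y \<in> Y \<Longrightarrow> s' y = s y + k" by (rule local_section_ratio[OF 1(3) 2(3) fzU]) (rule that)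
    have "openin (top_of_set A) {x \<in> A. f x \<in> V}"
      using f V(1) by (auto simp: continuous_map_def)
    then obtain O' where O': "open O'" "{x \<in> A. f x \<in> V} = A \<inter> O'"
      by (auto simp: openin_open)
    have "\<sigma>' z' y = \<sigma> z' y + (- g + k + g')" if "z' \<in> (N \<inter> N' \<inter> O') \<inter> A" "y \<in> f z'" for z' y
    proof -
      have "f z' \<in> V" using that O' by auto
      then show ?thesis
        using 1(5)[of z' y] 2(5)[of z' y] V(3)[of "f z'" y] that by (auto simp: add.assoc)
    qed
    moreover have "z \<in> N \<inter> N' \<inter> O'" using 1(2) 2(2) O' V(2) z by auto
    moreover have "open (N \<inter> N' \<inter> O')" using 1(1) 2(1) O' by auto
    ultimately show ?thesis by blast
  qed
  have fin: "f z \<in> topspace (surface m)" if "z \<in> A" for z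
    using f that by (auto simp: continuous_map_def)
  \<comment> \<open>All representatives of the point \<open>f z\<close> give the same quotient;
    choosing one makes it a function of \<open>z\<close>.\<close>
  define h where "h z = (let y = SOME y. y \<in> f z in - \<sigma> z y + \<sigma>' z y)" for z
  have h: "h z' = g" if "z' \<in> A" "\<forall>y\<in>f z'. \<sigma>' z' y = \<sigma> z' y + g" for z' g
  proof -
    have "(SOME y. y \<in> f z') \<in> f z'"
      using surface_point_nonempty[OF fin[OF that(1)]] by (metis someI_ex)
    then show ?thesis using that by (simp add: h_def Let_def)
  qed
  have hconst: "h z = h z'" if "z \<in> A" "z' \<in> A" for z z'
  proof (rule connected_local_const[OF \<open>connected A\<close> that], intro ballI)
    fix a assume a: "a \<in> A"
    obtain N g where N: "open N" "a \<in> N" "\<forall>z'\<in>N \<inter> A. \<forall>y\<in>f z'. \<sigma>' z' y = \<sigma> z' y + g"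
      using loc[OF a] by blast
    have "h b = g" if "b \<in> N" "b \<in> A" for b using h that N by blast
    then show "\<forall>\<^sub>F b in at a within A. h a = h b"
      using N a unfolding eventually_at_topological by metis
  qed
  show ?thesis
  proof (cases "A = {}")
    case False
    then obtain a where a: "a \<in> A" by auto
    show ?thesis
    proof (rule that[of "h a"])
      fix z y assume z: "z \<in> A" "y \<in> f z"
      obtain N g where N: "open N" "z \<in> N" "\<forall>z'\<in>N \<inter> A. \<forall>y\<in>f z'. \<sigma>' z' y = \<sigma> z' y + g"
        using loc[OF z(1)] by blast
      then have "h z = g" using h z by blast
      then show "\<sigma>' z y = \<sigma> z y + h a" using hconst[OF a z(1)] N z by auto
    qed
  qed (use that in auto)
qed

text \<open>On the connected overlap the two lifts differ by a single right translation, and once it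
  is removed from the second lift they fit together. Closedness takes care of the points in one
  piece only: the other piece is absent from a neighbourhood of them.\<close>

lemma section_along_Un:
  fixes \<phi> :: "'a \<Rightarrow> 'g::group_add" and f :: "'z::topological_space \<Rightarrow> 'a point set"
  assumes cl: "closed A" "closed B" and "connected (A \<inter> B)"
    and f: "continuous_map (top_of_set (A \<union> B)) (surface m) f"
    and A: "section_along m \<phi> f A \<sigma>\<^sub>A" and B: "section_along m \<phi> f B \<sigma>\<^sub>B"
  shows "\<exists>\<sigma>. section_along m \<phi> f (A \<union> B) \<sigma>"
proof -
  have "continuous_map (top_of_set (A \<inter> B)) (surface m) f"
    using f by (rule continuous_map_from_subtopology_mono) auto
  then obtain g where g: "\<And>z y. z \<in> A \<inter> B \<Longrightarrow> y \<in> f z \<Longrightarrow> \<sigma>\<^sub>B z y = \<sigma>\<^sub>A z y + g"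
    using section_along_unique[OF assms(3) _ section_along_subset[OF A Int_lower1] section_along_subset[OF B Int_lower2]]
    by blast
  define \<sigma> where "\<sigma> z y = (if z \<in> A then \<sigma>\<^sub>A z y else \<sigma>\<^sub>B z y + - g)" for z y
  have \<sigma>A: "\<sigma> z y = \<sigma>\<^sub>A z y" if "z \<in> A" for z y using that by (simp add: \<sigma>_def)
  have \<sigma>B: "\<sigma> z y = \<sigma>\<^sub>B z y + - g" if "z \<in> B" "y \<in> f z" for z y
    using that g by (simp add: \<sigma>_def add.assoc)
  have "section_along m \<phi> f (A \<union> B) \<sigma>"
    unfolding section_along_def
  proof
    fix z assume z: "z \<in> A \<union> B"
    have fin: "f z \<in> topspace (surface m)" using f z by (auto simp: continuous_map_def)
    consider "z \<notin> B" | "z \<notin> A" | "z \<in> A" "z \<in> B" by blast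
    then show "\<exists>N U s g. open N \<and> z \<in> N \<and> local_section m \<phi> U s \<and>
        (\<forall>z'\<in>N \<inter> (A \<union> B). f z' \<in> U \<and> (\<forall>y\<in>f z'. \<sigma> z' y = s y + g))"
    proof cases
      case 1
      with z have z: "z \<in> A" by blast
      obtain N U s g' where N: "open N" "z \<in> N" "local_section m \<phi> U s"
        "\<And>z'. z' \<in> N \<Longrightarrow> z' \<in> A \<Longrightarrow> f z' \<in> U"
        "\<And>z' y. z' \<in> N \<Longrightarrow> z' \<in> A \<Longrightarrow> y \<in> f z' \<Longrightarrow> \<sigma>\<^sub>A z' y = s y + g'"
        by (rule section_alongE[OF A z]) (rule that)
      have "\<forall>z'\<in>(N \<inter> - B) \<inter> (A \<union> B). f z' \<in> U \<and> (\<forall>y\<in>f z'. \<sigma> z' y = s y + g')"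
        using N(4,5) \<sigma>A by auto
      moreover have "open (N \<inter> - B)" "z \<in> N \<inter> - B" using N(1,2) cl 1 by auto
      ultimately show ?thesis using N(3) by blast
    next
      case 2
      with z have z: "z \<in> B" by blast
      obtain N U s g' where N: "open N" "z \<in> N" "local_section m \<phi> U s"
        "\<And>z'. z' \<in> N \<Longrightarrow> z' \<in> B \<Longrightarrow> f z' \<in> U"
        "\<And>z' y. z' \<in> N \<Longrightarrow> z' \<in> B \<Longrightarrow> y \<in> f z' \<Longrightarrow> \<sigma>\<^sub>B z' y = s y + g'"
        by (rule section_alongE[OF B z]) (rule that)
      have "\<forall>z'\<in>(N \<inter> - A) \<inter> (A \<union> B). f z' \<in> U \<and> (\<forall>y\<in>f z'. \<sigma> z' y = s y + (g' + - g))"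
        using N(4,5) \<sigma>B by (auto simp: add.assoc simp del: add_uminus_conv_diff)
      moreover have "open (N \<inter> - A)" "z \<in> N \<inter> - A" using N(1,2) cl 2 by auto
      ultimately show ?thesis using N(3) by blast
    next
      case 3
      obtain N U s gA where 1: "open N" "z \<in> N" "local_section m \<phi> U s"
        "\<And>z'. z' \<in> N \<Longrightarrow> z' \<in> A \<Longrightarrow> f z' \<in> U"
        "\<And>z' y. z' \<in> N \<Longrightarrow> z' \<in> A \<Longrightarrow> y \<in> f z' \<Longrightarrow> \<sigma>\<^sub>A z' y = s y + gA" by (rule section_alongE[OF A 3(1)]) (rule that)
      obtain N' U' s' gB where 2: "open N'" "z \<in> N'" "local_section m \<phi> U' s'"
        "\<And>z'. z' \<in> N' \<Longrightarrow> z' \<in> B \<Longrightarrow> f z' \<in> U'"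
        "\<And>z' y. z' \<in> N' \<Longrightarrow> z' \<in> B \<Longrightarrow> y \<in> f z' \<Longrightarrow> \<sigma>\<^sub>B z' y = s' y + gB" by (rule section_alongE[OF B 3(2)]) (rule that)
      have "f z \<in> U" "f z \<in> U'" using 1(4)[OF 1(2) 3(1)] 2(4)[OF 2(2) 3(2)] .
      note fzU = this
      obtain V k where V: "openin (surface m) V" "f z \<in> V" "V \<subseteq> U \<inter> U'"
        "\<And>Y y. Y \<in> V \<Longrightarrow> y \<in> Y \<Longrightarrow> s' y = s y + k" by (rule local_section_ratio[OF 1(3) 2(3) fzU]) (rule that)
      have "openin (top_of_set (A \<union> B)) {x \<in> A \<union> B. f x \<in> V}"
        using f V(1) by (auto simp: continuous_map_def)
      then obtain O' where O': "open O'" "{x \<in> A \<union> B. f x \<in> V} = (A \<union> B) \<inter> O'"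
        by (auto simp: openin_open)
      obtain y where y: "y \<in> f z" using surface_point_nonempty[OF fin] by blast
      \<comment> \<open>Both descriptions of the lift are evaluated at one point above
        \<open>z\<close>. This expresses \<open>gA\<close> by the other constants, a relation that
        then serves in the whole neighbourhood.\<close>
      have "s y + gA = \<sigma> z y" using 1(5)[OF 1(2) 3(1) y] \<sigma>A[OF 3(1), of y] by simp
      also have "\<dots> = \<sigma>\<^sub>B z y + - g" by (rule \<sigma>B[OF 3(2) y])
      also have "\<sigma>\<^sub>B z y = s' y + gB" by (rule 2(5)[OF 2(2) 3(2) y])
      also have "s' y = s y + k" by (rule V(4)[OF V(2) y])
      finally have "s y + gA = s y + (k + gB + - g)"
        by (simp add: add.assoc del: add_uminus_conv_diff)
      then have gA: "gA = k + gB + - g" by (rule add_left_imp_eq)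
      have "f z' \<in> U \<and> (\<forall>y\<in>f z'. \<sigma> z' y = s y + gA)" if z': "z' \<in> (N \<inter> N' \<inter> O') \<inter> (A \<union> B)" for z'
      proof -
        have fz: "f z' \<in> V" using z' O' by auto
        show ?thesis
        proof (cases "z' \<in> A")
          case True
          then show ?thesis using 1(4,5)[of z'] z' \<sigma>A by auto
        next
          case False
          then have "z' \<in> B" using z' by auto
          have "\<sigma> z' y = s y + gA" if y: "y \<in> f z'" for y
          proof -
            have "\<sigma> z' y = \<sigma>\<^sub>B z' y + - g" by (rule \<sigma>B[OF \<open>z' \<in> B\<close> y])
            also have "\<sigma>\<^sub>B z' y = s' y + gB" by (rule 2(5)[OF _ \<open>z' \<in> B\<close> y]) (use z' in auto)
            also have "s' y = s y + k" by (rule V(4)[OF fz y])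
            finally show ?thesis by (simp add: gA add.assoc del: add_uminus_conv_diff)
          qed
          then show ?thesis using V(3) fz by blast
        qed
      qed
      moreover have "open (N \<inter> N' \<inter> O')" "z \<in> N \<inter> N' \<inter> O'" using 1(1,2) 2(1,2) O' V(2) 3 by auto
      ultimately show ?thesis using 1(3) by blast
    qed
  qed
  then show ?thesis by blast
qed

lemma openin_sectors_box:
  assumes "D \<subseteq> darts m" "open R" "open T"
  shows "openin (sectors m) (D \<times> ({0..1} \<inter> R) \<times> ({0..1} \<inter> T))"
  unfolding sectors_def openin_prod_Times_iff using assms by (simp add: openin_open_Int)

lemma local_sectionI:
  assumes op: "openin (sectors m) A" and sat: "\<And>x y. glue m x y \<Longrightarrow> x \<in> A \<longleftrightarrow> y \<in> A"
    and "\<And>y. y \<in> A \<Longrightarrow> \<exists>W. openin (sectors m) W \<and> y \<in> W \<and> (\<forall>y'\<in>W. s y' = s y)"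
    and "\<And>d t t'. d \<in> darts m \<Longrightarrow> t \<in> {0..1} \<Longrightarrow> t' \<in> {0..1} \<Longrightarrow> (d, 0, t) \<in> A \<Longrightarrow> s (d, 0, t) = s (d, 0, t')"
    and "\<And>d r. d \<in> darts m \<Longrightarrow> r \<in> {0..1} \<Longrightarrow> (d, r, 1) \<in> A \<Longrightarrow> s (d, r, 1) = s (nxt m d, r, 0)"
    and "\<And>d t. d \<in> darts m \<Longrightarrow> t \<in> {0..1} \<Longrightarrow> (d, 1, t) \<in> A \<Longrightarrow>
           s (d, 1, t) = \<phi> d - \<phi> (nxt m (rev m d)) + s (rev m d, 1, 1 - t)"
  shows "local_section m \<phi> (pcls ` A) s"
proof -
  have "\<Union>(pcls ` A) = A" "openin (surface m) (pcls ` A)"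
    using saturated_openin[OF op sat] by blast+
  then show ?thesis unfolding local_section_def using assms(3-) by presburger
qed

text \<open>Away from the sides there are no transitions, so the trivialization of the polygons is
  itself a section.\<close>

lemma local_section_interior:
  "local_section m \<phi> (pcls ` (darts m \<times> ({0..1} \<inter> {..<1}) \<times> ({0..1} \<inter> UNIV))) (\<lambda>y. 0)"
proof -
  let ?A = "darts m \<times> ({0..1} \<inter> {..<1::real}) \<times> ({0..1::real} \<inter> UNIV)"
  have op: "openin (sectors m) ?A" by (intro openin_sectors_box) auto
  have sat: "x \<in> ?A \<longleftrightarrow> y \<in> ?A" if "glue m x y" for x y
    using that by cases auto
  show ?thesis
    by (rule local_sectionI[OF op sat]) (use op in blast)+
qed

text \<open>A section around all vertices, along edges cut at one point each: its value is the label
  of the corner reached without passing the cut point \<open>c d\<close>. The cut points of glued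
  sides match because \<open>c (rev m d) = 1 - c d\<close>. Admissibility says that the transition
  across \<open>d\<close> is the same whether it is computed at the tail or at the head of
  \<open>d\<close>, which is what the far side of the cut requires.\<close>

lemma local_section_vertices:
  fixes \<phi> :: "'a \<Rightarrow> 'g::group_add"
  assumes adm: "admissible m \<phi>"
    and c: "\<And>d. d \<in> darts m \<Longrightarrow> 0 < c d \<and> c d < 1 \<and> c (rev m d) = 1 - c d"
  shows "local_section m \<phi> (pcls ` (\<Union>d\<in>darts m. {d} \<times> ({0..1} \<inter> {0<..}) \<times> ({0..1} \<inter> - {c d})))
           (\<lambda>(d, r, t). if t < c d then \<phi> d else \<phi> (nxt m d))"
proof -
  let ?A = "\<Union>d\<in>darts m. {d} \<times> ({0..1} \<inter> {0<..}) \<times> ({0..1} \<inter> - {c d})"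
  let ?s = "\<lambda>(d, r::real, t::real). if t < c d then \<phi> d else \<phi> (nxt m d)"
  have op: "openin (sectors m) ?A" by (intro openin_Union ballI openin_sectors_box | clarify)+ auto
  have sat: "x \<in> ?A \<longleftrightarrow> y \<in> ?A" if "glue m x y" for x y
    using that
  proof cases
    case (sector d s)
    then show ?thesis using c[of d] c[of "nxt m d"] by auto
  next
    case (side d t)
    then show ?thesis using c[of d] by auto
  qed auto
  have loc: "\<exists>W. openin (sectors m) W \<and> y \<in> W \<and> (\<forall>y'\<in>W. ?s y' = ?s y)" if "y \<in> ?A" for y
  proof -
    obtain d r t where y: "y = (d, r, t)" by (cases y)
    with that have d: "d \<in> darts m" "r \<in> {0..1}" "t \<in> {0..1}" "t \<noteq> c d" by auto
    show ?thesis
    proof (cases "t < c d")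
      case True
      have "openin (sectors m) ({d} \<times> ({0..1} \<inter> UNIV) \<times> ({0..1} \<inter> {..<c d}))"
        using d by (intro openin_sectors_box) auto
      then show ?thesis
        by (intro exI conjI, assumption) (use True d in \<open>auto simp: y\<close>)
    next
      case False
      have "openin (sectors m) ({d} \<times> ({0..1} \<inter> UNIV) \<times> ({0..1} \<inter> {c d<..}))"
        using d by (intro openin_sectors_box) auto
      then show ?thesis
        by (intro exI conjI, assumption) (use False d in \<open>auto simp: y\<close>)
    qed
  qed
  have side: "?s (d, 1, t) = \<phi> d - \<phi> (nxt m (rev m d)) + ?s (rev m d, 1, 1 - t)"
    if d: "d \<in> darts m" "t \<noteq> c d" for d t
  proof (cases "t < c d")
    case True
    then show ?thesis using c[OF d(1)] by simp
  next
    case False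
    have "- (- \<phi> (rev m d) + \<phi> (nxt m (rev m d))) = - \<phi> d + \<phi> (nxt m d)"
      using adm d(1) unfolding admissible_def by simp
    then have "\<phi> d + (- \<phi> (nxt m (rev m d)) + \<phi> (rev m d)) = \<phi> (nxt m d)"
      by (simp add: minus_add)
    then show ?thesis using False c[OF d(1)] d(2) by (simp add: add.assoc[symmetric])
  qed
  show ?thesis
  proof (rule local_sectionI[OF op sat loc])
    fix d t assume "d \<in> darts m" "t \<in> {0..1::real}" "(d, 1, t) \<in> ?A"
    then show "?s (d, 1, t) = \<phi> d - \<phi> (nxt m (rev m d)) + ?s (rev m d, 1, 1 - t)"
      by (intro side) auto
  next
    fix d r assume "d \<in> darts m" "r \<in> {0..1::real}"
    then show "?s (d, r, 1) = ?s (nxt m d, r, 0)" using c[of d] c[of "nxt m d"] by simp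
  qed auto
qed

lemma local_section_exists:
  fixes \<phi> :: "'a \<Rightarrow> 'g::group_add"
  assumes adm: "admissible m \<phi>" and X: "X \<in> topspace (surface m)"
  obtains U s where "local_section m \<phi> U s" "X \<in> U"
proof -
  obtain d r t where y: "(d, r, t) \<in> topspace (sectors m)" "X = pcls (d, r, t)"
    using surface_point_nonempty[OF X] by (metis prod_cases3)
  then have d: "d \<in> darts m" "r \<in> {0..1}" "t \<in> {0..1}" by (auto simp: topspace_sectors)
  consider "r < 1" | "r = 1" using d by fastforce
  then show ?thesis
  proof cases
    case 1
    show ?thesis
      by (rule that[OF local_section_interior]) (unfold y(2), rule imageI, use d 1 in auto)
  next
    case 2
    \<comment> \<open>Edges are cut at their midpoints, unless the given point is the midpoint of
      \<open>d\<close>; then the cut on \<open>d\<close> is moved to a quarter, which is three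
      quarters on the reverse.\<close>
    define c where "c e = (if t \<noteq> 1 / 2 then 1 / 2 else if e = d then 1 / 4 else if e = rev m d then 3 / 4 else 1 / 2 :: real)" for e
    have "0 < c e \<and> c e < 1 \<and> c (rev m e) = 1 - c e" if "e \<in> darts m" for e
      using rev_rev[OF that] rev_rev[OF d(1)] rev_neq[OF d(1)] by (auto simp: c_def)
    then have "local_section m \<phi> (pcls ` (\<Union>d\<in>darts m. {d} \<times> ({0..1} \<inter> {0<..}) \<times> ({0..1} \<inter> - {c d})))
           (\<lambda>(d, r, t). if t < c d then \<phi> d else \<phi> (nxt m d))"
      by (rule local_section_vertices[OF adm])
    then show ?thesis
      by (rule that) (unfold y(2), rule imageI, use d 2 in \<open>auto simp: c_def\<close>)
  qed
qed

lemma section_along_local: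
  fixes \<phi> :: "'a \<Rightarrow> 'g::group_add"
  assumes "section_along m \<phi> f A \<sigma>" "z \<in> A" "local_section m \<phi> U s" "f z \<in> U"
  obtains g where "\<And>y. y \<in> f z \<Longrightarrow> \<sigma> z y = s y + g"
proof -
  obtain N U' s' g' where 1: "open N" "z \<in> N" "local_section m \<phi> U' s'"
    "\<And>z'. z' \<in> N \<Longrightarrow> z' \<in> A \<Longrightarrow> f z' \<in> U'"
    "\<And>z' y. z' \<in> N \<Longrightarrow> z' \<in> A \<Longrightarrow> y \<in> f z' \<Longrightarrow> \<sigma> z' y = s' y + g'"
    by (rule section_alongE[OF assms(1,2)]) (rule that)
  obtain V k where V: "openin (surface m) V" "f z \<in> V" "V \<subseteq> U \<inter> U'"
    "\<And>Y y. Y \<in> V \<Longrightarrow> y \<in> Y \<Longrightarrow> s' y = s y + k"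
    by (rule local_section_ratio[OF assms(3) 1(3) assms(4) 1(4)[OF 1(2) assms(2)]]) (rule that)
  show ?thesis
  proof (rule that[of "k + g'"])
    fix y assume y: "y \<in> f z"
    show "\<sigma> z y = s y + (k + g')"
      using 1(5)[OF 1(2) assms(2) y] V(4)[OF V(2) y] by (simp add: add.assoc)
  qed
qed

text \<open>Within one sector no transition occurs, so a lift keeps its value along a curve
  \<open>w\<close> drawn in the sectors above \<open>f\<close>.\<close>

lemma section_along_const:
  fixes \<phi> :: "'a \<Rightarrow> 'g::group_add" and f :: "'z::topological_space \<Rightarrow> 'a point set"
  assumes A: "connected A" and \<sigma>: "section_along m \<phi> f A \<sigma>"
    and w: "continuous_map (top_of_set A) (sectors m) w" "\<And>z. z \<in> A \<Longrightarrow> w z \<in> f z"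
    and ab: "a \<in> A" "b \<in> A"
  shows "\<sigma> a (w a) = \<sigma> b (w b)"
proof (rule connected_local_const[OF A ab], intro ballI)
  fix z assume z: "z \<in> A"
  obtain N U s g where 1: "open N" "z \<in> N" "local_section m \<phi> U s"
    "\<And>z'. z' \<in> N \<Longrightarrow> z' \<in> A \<Longrightarrow> f z' \<in> U"
    "\<And>z' y. z' \<in> N \<Longrightarrow> z' \<in> A \<Longrightarrow> y \<in> f z' \<Longrightarrow> \<sigma> z' y = s y + g"
    by (rule section_alongE[OF \<sigma> z]) (rule that)
  have "w z \<in> \<Union>U" using 1(4)[OF 1(2) z] w(2)[OF z] by blast
  from local_section_nhd[OF 1(3) this] obtain W where
    W: "openin (sectors m) W" "w z \<in> W" "\<forall>y'\<in>W. s y' = s (w z)" by blast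
  have "openin (top_of_set A) {x \<in> A. w x \<in> W}"
    using w(1) W(1) by (auto simp: continuous_map_def)
  then obtain O' where O': "open O'" "{x \<in> A. w x \<in> W} = A \<inter> O'"
    by (auto simp: openin_open)
  have "\<sigma> z (w z) = \<sigma> z' (w z')" if z': "z' \<in> N \<inter> O'" "z' \<in> A" for z'
  proof -
    have "w z' \<in> W" using O' z' by auto
    then have "s (w z') = s (w z)" using W(3) by blast
    then show ?thesis
      using 1(5)[OF 1(2) z w(2)[OF z]] 1(5)[OF _ z'(2) w(2)[OF z'(2)]] z' by simp
  qed
  moreover have "open (N \<inter> O')" "z \<in> N \<inter> O'" using 1(1,2) O' W(2) z by auto
  ultimately show "\<forall>\<^sub>F b in at z within A. \<sigma> z (w z) = \<sigma> b (w b)"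
    unfolding eventually_at_topological by blast
qed

end

lemma section_along_compose:
  fixes f :: "'z::topological_space \<Rightarrow> 'a point set" and u :: "'y::topological_space \<Rightarrow> 'z"
  assumes \<sigma>: "section_along m \<phi> f A \<sigma>" and u: "continuous_on B u" "u ` B \<subseteq> A"
    and f': "\<And>x. x \<in> B \<Longrightarrow> f' x = f (u x)"
  shows "section_along m \<phi> f' B (\<lambda>x. \<sigma> (u x))"
  unfolding section_along_def
proof
  fix x assume x: "x \<in> B"
  then have z: "u x \<in> A" using u by auto
  obtain N U s g where 1: "open N" "u x \<in> N" "local_section m \<phi> U s"
    "\<And>z'. z' \<in> N \<Longrightarrow> z' \<in> A \<Longrightarrow> f z' \<in> U"
    "\<And>z' y. z' \<in> N \<Longrightarrow> z' \<in> A \<Longrightarrow> y \<in> f z' \<Longrightarrow> \<sigma> z' y = s y + g"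
    by (rule section_alongE[OF \<sigma> z]) (rule that)
  obtain N' where N': "open N'" "N' \<inter> B = u -` N \<inter> B"
    using u(1) 1(1) unfolding continuous_on_open_invariant by blast
  have "x \<in> N'" using N' 1(2) x by blast
  moreover have "f' z' \<in> U \<and> (\<forall>y\<in>f' z'. \<sigma> (u z') y = s y + g)" if "z' \<in> N' \<inter> B" for z'
  proof -
    have "u z' \<in> N" "u z' \<in> A" "z' \<in> B" using that N' u by auto
    then show ?thesis using 1(4,5)[of "u z'"] f' by simp
  qed
  ultimately show "\<exists>N U s g. open N \<and> x \<in> N \<and> local_section m \<phi> U s \<and>
        (\<forall>z'\<in>N \<inter> B. f' z' \<in> U \<and> (\<forall>y\<in>f' z'. \<sigma> (u z') y = s y + g))"
    using N'(1) 1(3) by (intro exI[of _ N'] exI[of _ U] exI[of _ s] exI[of _ g]) blast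
qed

section \<open>Existence of lifts over the square\<close>

context rooted_map
begin

text \<open>Bisection in one variable, then in the other. Over a small rectangle a local section is
  a lift, and lifts over rectangles with a common edge are merged, this edge being connected. The
  first bisection must produce strips of positive width for the second one to start; this is why its
  statement carries a \<open>\<delta>\<close>.\<close>

lemma section_along_square_exists:
  fixes \<phi> :: "'a \<Rightarrow> 'g::group_add" and f :: "real \<times> real \<Rightarrow> 'a point set"
  assumes adm: "admissible m \<phi>"
    and f: "continuous_map (top_of_set ({0..1} \<times> {0..1})) (surface m) f"
  shows "\<exists>\<sigma>. section_along m \<phi> f ({0..1} \<times> {0..1}) \<sigma>"
proof -
  let ?Q = "{0..1::real} \<times> {0..1::real}"
  define L where "L a b c d \<longleftrightarrow> (\<exists>\<sigma>. section_along m \<phi> f (({a..b} \<times> {c..d}) \<inter> ?Q) \<sigma>)" for a b c d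
  have convex: "connected (({a..b} \<times> {c..d}) \<inter> ?Q)" for a b c d
    by (intro convex_connected convex_Int convex_Times convex_real_interval)
  have glue: "\<exists>\<sigma>. section_along m \<phi> f (A \<union> B) \<sigma>"
    if "\<exists>\<sigma>. section_along m \<phi> f A \<sigma>" "\<exists>\<sigma>. section_along m \<phi> f B \<sigma>"
      "closed A" "closed B" "connected (A \<inter> B)" "A \<union> B \<subseteq> ?Q" for A B
    using that section_along_Un continuous_map_from_subtopology_mono[OF f] by blast
  have closed: "closed (({a..b} \<times> {c..d}) \<inter> ?Q)" for a b c d
    by (intro closed_Int closed_Times) auto
  have L1: "L a b c e" if "L a b c d" "L a b d e" "c \<le> d" "d \<le> e" for a b c d e
  proof -
    have "({a..b} \<times> {c..d}) \<inter> ?Q \<inter> (({a..b} \<times> {d..e}) \<inter> ?Q) = ({a..b} \<times> {d..d}) \<inter> ?Q"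
      and "({a..b} \<times> {c..d}) \<inter> ?Q \<union> (({a..b} \<times> {d..e}) \<inter> ?Q) = ({a..b} \<times> {c..e}) \<inter> ?Q"
      using that(3,4) by auto
    then show ?thesis
      using glue[OF that(1)[unfolded L_def] that(2)[unfolded L_def] closed closed] convex[of a b d d]
      unfolding L_def by auto
  qed
  have L2: "L a e c d" if "L a b c d" "L b e c d" "a \<le> b" "b \<le> e" for a b c d e
  proof -
    have "({a..b} \<times> {c..d}) \<inter> ?Q \<inter> (({b..e} \<times> {c..d}) \<inter> ?Q) = ({b..b} \<times> {c..d}) \<inter> ?Q"
      and "({a..b} \<times> {c..d}) \<inter> ?Q \<union> (({b..e} \<times> {c..d}) \<inter> ?Q) = ({a..e} \<times> {c..d}) \<inter> ?Q"
      using that(3,4) by auto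
    then show ?thesis
      using glue[OF that(1)[unfolded L_def] that(2)[unfolded L_def] closed closed] convex[of b b c d]
      unfolding L_def by auto
  qed
  have local: "\<exists>\<delta>>0. \<forall>a b c d. a \<le> u \<and> u \<le> b \<and> b - a < \<delta> \<and> c \<le> v \<and> v \<le> d \<and> d - c < \<delta> \<longrightarrow> L a b c d"
    if uv: "(u, v) \<in> ?Q" for u v
  proof -
    have "f (u, v) \<in> topspace (surface m)" using f uv by (auto simp: continuous_map_def)
    then obtain U s where U: "local_section m \<phi> U s" "f (u, v) \<in> U"
      by (rule local_section_exists[OF adm])
    then have "openin (top_of_set ?Q) {z \<in> ?Q. f z \<in> U}"
      using f by (auto simp: continuous_map_def local_section_def)
    then obtain O' where O': "open O'" "{z \<in> ?Q. f z \<in> U} = ?Q \<inter> O'"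
      by (auto simp: openin_open)
    then have "(u, v) \<in> O'" using U uv by blast
    then obtain S T where ST: "open S" "open T" "u \<in> S" "v \<in> T" "S \<times> T \<subseteq> O'"
      using open_prod_elim[OF O'(1)] by (metis mem_Sigma_iff)
    obtain e1 where e1: "e1 > 0" "\<And>x. dist x u < e1 \<Longrightarrow> x \<in> S" using ST by (auto simp: open_dist)
    obtain e2 where e2: "e2 > 0" "\<And>x. dist x v < e2 \<Longrightarrow> x \<in> T" using ST by (auto simp: open_dist)
    have "L a b c d" if "a \<le> u" "u \<le> b" "b - a < min e1 e2" "c \<le> v" "v \<le> d" "d - c < min e1 e2" for a b c d
    proof -
      have "f z \<in> U" if z: "z \<in> ({a..b} \<times> {c..d}) \<inter> ?Q" for z
      proof -
        have "fst z \<in> S" "snd z \<in> T"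
          using z \<open>a \<le> u\<close> \<open>u \<le> b\<close> \<open>b - a < _\<close> \<open>c \<le> v\<close> \<open>v \<le> d\<close> \<open>d - c < _\<close>
          by (auto simp: dist_real_def intro!: e1(2) e2(2))
        then have "z \<in> O'" using ST(5) by (cases z) auto
        then show ?thesis using O'(2) z by blast
      qed
      then have "section_along m \<phi> f (({a..b} \<times> {c..d}) \<inter> ?Q) (\<lambda>z. s)"
        unfolding section_along_def using U(1)
        by (intro ballI exI[of _ UNIV] exI[of _ U] exI[of _ s] exI[of _ 0]) auto
      then show ?thesis unfolding L_def by blast
    qed
    then show ?thesis using e1(1) e2(1) by (intro exI[of _ "min e1 e2"]) auto
  qed
  have strip: "\<exists>\<delta>>0. \<forall>a b. a \<le> u \<and> u \<le> b \<and> b - a < \<delta> \<longrightarrow> L a b 0 1" if u: "u \<in> {0..1}" for u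
    using zero_le_one
  proof (rule Bolzano[where P = "\<lambda>c d. \<exists>\<delta>>0. \<forall>a b. a \<le> u \<and> u \<le> b \<and> b - a < \<delta> \<longrightarrow> L a b c d"])
    fix c d e :: real
    assume cd: "\<exists>\<delta>>0. \<forall>a b. a \<le> u \<and> u \<le> b \<and> b - a < \<delta> \<longrightarrow> L a b c d"
      and de: "\<exists>\<delta>>0. \<forall>a b. a \<le> u \<and> u \<le> b \<and> b - a < \<delta> \<longrightarrow> L a b d e" and "c \<le> d" "d \<le> e"
    from cd obtain \<delta>1 where 1: "\<delta>1 > 0" "\<forall>a b. a \<le> u \<and> u \<le> b \<and> b - a < \<delta>1 \<longrightarrow> L a b c d" by blast
    from de obtain \<delta>2 where 2: "\<delta>2 > 0" "\<forall>a b. a \<le> u \<and> u \<le> b \<and> b - a < \<delta>2 \<longrightarrow> L a b d e" by blast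
    show "\<exists>\<delta>>0. \<forall>a b. a \<le> u \<and> u \<le> b \<and> b - a < \<delta> \<longrightarrow> L a b c e"
      using 1 2 L1[OF _ _ \<open>c \<le> d\<close> \<open>d \<le> e\<close>] by (intro exI[of _ "min \<delta>1 \<delta>2"]) auto
  next
    fix v :: real assume "0 \<le> v" "v \<le> 1"
    then obtain \<delta> where "\<delta> > 0"
      "\<forall>a b c d. a \<le> u \<and> u \<le> b \<and> b - a < \<delta> \<and> c \<le> v \<and> v \<le> d \<and> d - c < \<delta> \<longrightarrow> L a b c d"
      using local[of u v] u by auto
    then show "\<exists>\<epsilon>>0. \<forall>c d. c \<le> v \<and> v \<le> d \<and> d - c < \<epsilon> \<longrightarrow>
        (\<exists>\<delta>>0. \<forall>a b. a \<le> u \<and> u \<le> b \<and> b - a < \<delta> \<longrightarrow> L a b c d)" by blast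
  qed
  have "L 0 1 0 1"
    by (rule Bolzano[where P = "\<lambda>a b. L a b 0 1"]) (use L2 strip in auto)
  then show ?thesis by (simp add: L_def)
qed

section \<open>Vertices as orbits of the rotation, and as points of the surface\<close>

lemma nxt_bij: "bij (nxt m)"
  by (rule permutes_bij[OF nxt_permutes])

lemma nxt_inv_nxt [simp]: "nxt m (inv (nxt m) d) = d" and inv_nxt_nxt [simp]: "inv (nxt m) (nxt m d) = d"
  using nxt_bij by (simp_all add: bij_is_surj surj_f_inv_f bij_is_inj)

lemma inv_nxt_in [simp]: "inv (nxt m) d \<in> darts m \<longleftrightarrow> d \<in> darts m"
  by (rule permutes_in_image[OF permutes_inv[OF nxt_permutes]])

lemma rot_permutes: "rot m permutes darts m"
proof -
  have "rot m = rev m \<circ> inv (nxt m)" by (auto simp: rot_def)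
  then show ?thesis
    using permutes_compose[OF permutes_inv[OF nxt_permutes] rev_permutes] by simp
qed

lemma rot_in [simp]: "rot m d \<in> darts m \<longleftrightarrow> d \<in> darts m"
  by (rule permutes_in_image[OF rot_permutes])

lemma rot_nxt: "rot m (nxt m d) = rev m d"
  by (simp add: rot_def)

lemma rot_funpow_in [simp]: "(rot m ^^ n) d \<in> darts m \<longleftrightarrow> d \<in> darts m"
  by (induction n) auto

lemma permutation_rot: "permutation (rot m)"
  using rot_permutes finite_darts permutation_permutes by blast

lemma tail_self: "d \<in> tail m d"
  unfolding tail_def by (rule permutation_self_in_orbit[OF permutation_rot])

lemma tail_subset: "d \<in> darts m \<Longrightarrow> tail m d \<subseteq> darts m"
  unfolding tail_def by (rule permutes_orbit_subset[OF rot_permutes])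

lemma in_tail_iff: "e \<in> tail m d \<longleftrightarrow> (\<exists>n. e = (rot m ^^ n) d)"
  unfolding tail_def orbit_altdef_permutation[OF permutation_rot] by blast

lemma tail_eq_iff: "tail m d = tail m e \<longleftrightarrow> e \<in> tail m d"
proof
  assume "e \<in> tail m d"
  moreover from this have "d \<in> tail m e"
    using orbit_swap[of d "rot m" e] tail_self[of d] by (simp add: tail_def)
  ultimately show "tail m d = tail m e"
    unfolding tail_def by (auto intro: orbit_trans)
qed (use tail_self[of e] in simp)

lemma tail_rot [simp]: "tail m (rot m d) = tail m d"
  by (metis comp_apply funpow_simps_right(2) funpow_0 funpow.simps(2) id_apply in_tail_iff tail_eq_iff)

lemma tail_nxt: "d \<in> darts m \<Longrightarrow> tail m (nxt m d) = head m d"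
  unfolding head_def by (metis rot_nxt tail_rot)

lemma pcls_rot: "d \<in> darts m \<Longrightarrow> pcls (rot m d, 1, 0) = pcls (d, 1, 0)"
  using pcls_side[of "inv (nxt m) d" 1] pcls_sector[of "inv (nxt m) d" 1] by (simp add: rot_def)

lemma pcls_tail:
  assumes "d \<in> darts m" "tail m d = tail m e"
  shows "pcls (d, 1, 0) = pcls (e, 1, 0)"
proof -
  have "pcls ((rot m ^^ n) d, 1, 0) = pcls (d, 1, 0)" for n
    by (induction n) (use assms(1) pcls_rot in auto)
  moreover obtain n where "e = (rot m ^^ n) d"
    using assms(2) tail_eq_iff in_tail_iff by blast
  ultimately show ?thesis by metis
qed

lemma pcls_head:
  assumes "d \<in> darts m" "head m d = tail m e"
  shows "pcls (d, 1, 1) = pcls (e, 1, 0)"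
  using pcls_side[OF assms(1), of 1] pcls_tail[of "rev m d" e] assms by (simp add: head_def)

end

lemma add_right_eq_selfD: "x = x + g \<Longrightarrow> g = (0 :: 'g::group_add)"
  by (metis add.right_neutral add_left_imp_eq)

lemma path_from_append:
  "path_from m v (p @ q) \<longleftrightarrow> path_from m v p \<and> path_from m (last (visited m v p)) q"
  by (induction m v p rule: path_from.induct) (auto simp: visited_def)

lemma path_from_nth:
  assumes "path_from m v p" "i < length p"
  shows "p ! i \<in> darts m" "Suc i < length p \<Longrightarrow> head m (p ! i) = tail m (p ! Suc i)"
proof -
  have "p = take i p @ p ! i # drop (Suc i) p"
    using assms(2) by (rule id_take_nth_drop)
  with assms(1) have *: "path_from m (last (visited m v (take i p))) (p ! i # drop (Suc i) p)"
    by (metis path_from_append)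
  then show "p ! i \<in> darts m" by simp
  assume "Suc i < length p"
  then have "drop (Suc i) p = p ! Suc i # drop (Suc (Suc i)) p"
    by (simp add: Cons_nth_drop_Suc)
  with * show "head m (p ! i) = tail m (p ! Suc i)" by simp
qed

section \<open>Lifts along the trace of a loop\<close>

context rooted_map
begin

lemma continuous_map_sectors:
  assumes "d \<in> darts m" "continuous_on A r" "continuous_on A t" "\<And>x. x \<in> A \<Longrightarrow> r x \<in> {0..1} \<and> t x \<in> {0..1}"
  shows "continuous_map (top_of_set A) (sectors m) (\<lambda>x. (d, r x, t x))"
  unfolding sectors_def
proof (rule continuous_map_pairedI)
  show "continuous_map (top_of_set A) (discrete_topology (darts m)) (\<lambda>x. d)" using assms by simp
  show "continuous_map (top_of_set A) (prod_topology (top_of_set {0..1}) (top_of_set {0..1})) (\<lambda>x. (r x, t x))"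
    by (rule continuous_map_pairedI) (use assms in \<open>auto simp: continuous_map_in_subtopology\<close>)
qed

text \<open>The segments are closed: at the common end of two consecutive half-edges
  \<open>trace\<close> uses the later one, and the earlier one names the same vertex.\<close>

lemma trace_segment:
  assumes p: "path_from m v p" and i: "i < length p"
    and x: "real i \<le> real (length p) * x" "real (length p) * x \<le> real i + 1"
  shows "trace m p x = pcls (p ! i, 1, real (length p) * x - real i)"
proof (cases "real (length p) * x < real i + 1")
  case True
  then have "\<lfloor>real (length p) * x\<rfloor> = int i" using x by linarith
  then show ?thesis using i by (simp add: trace_def Let_def)
next
  case False
  then have eq: "real (length p) * x = real (Suc i)" using x by simp
  then have fl: "nat \<lfloor>real (length p) * x\<rfloor> = Suc i" by simp
  show ?thesis
  proof (cases "Suc i < length p")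
    case True
    then have "trace m p x = pcls (p ! Suc i, 1, 0)"
      using fl eq by (simp add: trace_def Let_def)
    also have "\<dots> = pcls (p ! i, 1, 1)"
      using pcls_head path_from_nth[OF p i] True by metis
    finally show ?thesis using eq by simp
  next
    case False
    then have "min (Suc i) (length p - 1) = i" using i by simp
    then show ?thesis using fl by (simp add: trace_def Let_def)
  qed
qed

text \<open>Lift the whole homotopy. Over its constant end the lift is constant, and its two other
  sides carry the same curve, so that the lift over the trace takes the same value at both ends.
  Measured against the section around the vertices, the lift changes along the trace by the
  holonomy.\<close>

lemma loop_holonomy_0:
  fixes \<phi> :: "'a \<Rightarrow> 'g::group_add"
  assumes adm: "admissible m \<phi>" and loop: "is_loop m p" and null: "null_homotopic m (trace m p)"
  shows "holonomy m \<phi> p = 0"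
proof -
  let ?I = "{0..1::real}"
  define k where "k = length p"
  have p: "path_from m (origin m p) p" and k: "k > 0"
    using loop by (auto simp: is_loop_def k_def)
  obtain a h where h: "continuous_map (prod_topology (top_of_set ?I) (top_of_set ?I)) (surface m) h"
    and h0: "\<And>x. h (0, x) = trace m p x" and h1: "\<And>x. h (1, x) = a"
    and hl: "\<And>t. t \<in> ?I \<Longrightarrow> h (t, 0) = h (t, 1)"
    using null by (auto simp: null_homotopic_def homotopic_with_def)
  have h': "continuous_map (top_of_set (?I \<times> ?I)) (surface m) h"
    using h by (simp add: subtopology_Times[symmetric] prod_topology_subtopology_eu)
  obtain \<sigma> where \<sigma>: "section_along m \<phi> h (?I \<times> ?I) \<sigma>"
    using section_along_square_exists[OF adm h'] by blast
  have ne: "\<exists>y. y \<in> h z" if "z \<in> ?I \<times> ?I" for z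
  proof -
    have "h z \<in> topspace (surface m)" using h' that by (auto simp: continuous_map_def)
    then show ?thesis using surface_point_nonempty by blast
  qed
  have cI: "connected ?I" by (intro convex_connected convex_real_interval)
  have row: "\<sigma> (1, 0) y = \<sigma> (1, 1) y" if "y \<in> a" for y
  proof -
    have s1: "section_along m \<phi> (\<lambda>x. a) ?I (\<lambda>x. \<sigma> (1, x))"
      by (rule section_along_compose[OF \<sigma>]) (auto intro!: continuous_intros simp: h1)
    have s2: "section_along m \<phi> (\<lambda>x. a) ?I (\<lambda>x. \<sigma> (1, 0))"
      by (rule section_along_compose[OF \<sigma>]) (auto intro!: continuous_intros simp: h1)
    have "a \<in> topspace (surface m)" using h' h1[of 0] by (auto simp: continuous_map_def)
    then have "continuous_map (top_of_set ?I) (surface m) (\<lambda>x. a)" by simp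
    then obtain g where g: "\<And>z y. z \<in> ?I \<Longrightarrow> y \<in> a \<Longrightarrow> \<sigma> (1, 0) y = \<sigma> (1, z) y + g"
      by (rule section_along_unique[OF cI _ s1 s2]) (rule that)
    have "g = 0" by (rule add_right_eq_selfD[OF g[of 0 y]]) (use that in auto)
    then show ?thesis using g[of 1 y] that by simp
  qed
  \<comment> \<open>The lifts over the two sides \<open>h (t, 0)\<close> and \<open>h (t, 1)\<close>
    differ by one right translation, which is trivial at \<open>t = 1\<close> by
    \<open>row\<close>.\<close>
  have ends: "\<sigma> (0, 0) y = \<sigma> (0, 1) y" if y: "y \<in> h (0, 0)" for y
  proof -
    have s1: "section_along m \<phi> (\<lambda>t. h (t, 0)) ?I (\<lambda>t. \<sigma> (t, 0))"
      by (rule section_along_compose[OF \<sigma>]) (auto intro!: continuous_intros)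
    have s2: "section_along m \<phi> (\<lambda>t. h (t, 0)) ?I (\<lambda>t. \<sigma> (t, 1))"
      by (rule section_along_compose[OF \<sigma>]) (auto intro!: continuous_intros simp: hl)
    have "continuous_map (top_of_set ?I) (top_of_set (?I \<times> ?I)) (\<lambda>t. (t, 0))"
      by (auto intro!: continuous_intros)
    from continuous_map_compose[OF this h']
    have "continuous_map (top_of_set ?I) (surface m) (\<lambda>t. h (t, 0))" by (simp add: o_def)
    then obtain g where g: "\<And>t y. t \<in> ?I \<Longrightarrow> y \<in> h (t, 0) \<Longrightarrow> \<sigma> (t, 1) y = \<sigma> (t, 0) y + g"
      by (rule section_along_unique[OF cI _ s1 s2]) (rule that)
    obtain b where b: "b \<in> a" using ne[of "(1, 0)"] h1 by auto
    have "g = 0" by (rule add_right_eq_selfD[of "\<sigma> (1, 0) b"]) (use g[of 1 b] row[OF b] b h1 in simp)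
    then show ?thesis using g[of 0 y] y by simp
  qed
  have c: "section_along m \<phi> (trace m p) ?I (\<lambda>x. \<sigma> (0, x))"
    by (rule section_along_compose[OF \<sigma>]) (auto intro!: continuous_intros simp: h0)
  \<comment> \<open>The section around the vertices, with edges cut at their midpoints. Below,
    \<open>G i\<close> is the right translation which takes it to the lift at the
    \<open>i\<close>-th vertex of the loop.\<close>
  define S where "S = (\<lambda>(d, r::real, t::real). if t < (1 / 2) then \<phi> d else \<phi> (nxt m d))"
  define U where "U = pcls ` (\<Union>d\<in>darts m. {d} \<times> ({0..1} \<inter> {0<..}) \<times> ({0..1} \<inter> - {1 / 2 :: real}))"
  have S: "local_section m \<phi> U S"
    unfolding S_def U_def by (rule local_section_vertices[OF adm]) auto
  have kx: "real (length p) * (real i / real k) = real i" for i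
    using k by (simp add: k_def)
  have xI: "real i / real k \<in> ?I" if "i \<le> k" for i
    using that k by (simp add: divide_le_eq)
  have vertex: "trace m p (real i / real k) \<in> U" if "i \<le> k" for i
  proof (cases "i < k")
    case True
    then have "trace m p (real i / real k) = pcls (p ! i, 1, 0)"
      using trace_segment[OF p, of i "real i / real k", unfolded kx] by (simp add: k_def)
    then show ?thesis
      using path_from_nth(1)[OF p, of i] True by (auto simp: U_def k_def intro!: imageI)
  next
    case False
    then have "trace m p (real i / real k) = pcls (p ! (k - 1), 1, 1)"
      using trace_segment[OF p, of "k - 1" 1] k that by (simp add: k_def of_nat_diff)
    then show ?thesis
      using path_from_nth(1)[OF p, of "k - 1"] that k False by (auto simp: U_def k_def intro!: imageI)
  qed
  have "\<exists>g. \<forall>y\<in>trace m p (real i / real k). \<sigma> (0, real i / real k) y = S y + g" if "i \<le> k" for i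
    by (rule section_along_local[OF c xI[OF that] S vertex[OF that]]) blast
  then obtain G where G: "\<And>i y. i \<le> k \<Longrightarrow> y \<in> trace m p (real i / real k) \<Longrightarrow> \<sigma> (0, real i / real k) y = S y + G i"
    by metis
  have step: "- \<phi> (p ! i) + \<phi> (nxt m (p ! i)) + G (Suc i) = G i" if i: "i < k" for i
  proof -
    let ?d = "p ! i" and ?A = "{real i / real k..real (Suc i) / real k}"
    have d: "?d \<in> darts m" using path_from_nth(1)[OF p] i by (simp add: k_def)
    have A: "real i \<le> real k * x" "real k * x \<le> real i + 1" if "x \<in> ?A" for x
      using that k by (auto simp: field_simps)
    have AI: "?A \<subseteq> ?I" using i k by (auto simp: field_simps; linarith)
    have seg: "trace m p x = pcls (?d, 1, real k * x - real i)" if "x \<in> ?A" for x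
      using trace_segment[OF p, of i x] A[OF that] i by (simp add: k_def)
    have A01: "real k * x - real i \<in> {0..1}" if "x \<in> ?A" for x
      using A[OF that] by simp
    have "continuous_on ?A (\<lambda>x. real k * x - real i)" by (intro continuous_intros)
    then have w: "continuous_map (top_of_set ?A) (sectors m) (\<lambda>x. (?d, 1, real k * x - real i))"
      using d A01 by (intro continuous_map_sectors) auto
    have "\<sigma> (0, real i / real k) (?d, 1, real k * (real i / real k) - real i) =
          \<sigma> (0, real (Suc i) / real k) (?d, 1, real k * (real (Suc i) / real k) - real i)"
    proof (rule section_along_const[OF _ _ w, of \<phi> "trace m p" "\<lambda>x. \<sigma> (0, x)"])
      show "section_along m \<phi> (trace m p) ?A (\<lambda>x. \<sigma> (0, x))"
        by (rule section_along_subset[OF c AI])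
      show "(?d, 1, real k * x - real i) \<in> trace m p x" if "x \<in> ?A" for x
        unfolding seg[OF that] by (rule pcls_self) (use d A01[OF that] in \<open>simp add: topspace_sectors\<close>)
    qed (use k in \<open>auto simp: field_simps intro!: convex_connected convex_real_interval\<close>)
    then have "\<sigma> (0, real i / real k) (?d, 1, 0) = \<sigma> (0, real (Suc i) / real k) (?d, 1, 1)"
      using k by simp
    moreover have "(?d, 1, 0) \<in> trace m p (real i / real k)"
      using seg[of "real i / real k"] pcls_self[of "(?d, 1, 0)"] d k by (simp add: topspace_sectors divide_right_mono)
    moreover have "(?d, 1, 1) \<in> trace m p (real (Suc i) / real k)"
      using seg[of "real (Suc i) / real k"] pcls_self[of "(?d, 1, 1)"] d k by (simp add: topspace_sectors divide_right_mono)
    ultimately have "\<phi> ?d + G i = \<phi> (nxt m ?d) + G (Suc i)"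
      using G[of i "(?d, 1, 0)"] G[of "Suc i" "(?d, 1, 1)"] i by (simp add: S_def)
    then have "- \<phi> ?d + (\<phi> ?d + G i) = - \<phi> ?d + (\<phi> (nxt m ?d) + G (Suc i))" by simp
    then show ?thesis by (simp add: add.assoc[symmetric] del: minus_add_cancel)
  qed
  have "holonomy m \<phi> (take i p) + G i = G 0" if "i \<le> k" for i
    using that
  proof (induction i)
    case (Suc i)
    then have "holonomy m \<phi> (take (Suc i) p) + G (Suc i) =
        holonomy m \<phi> (take i p) + (- \<phi> (p ! i) + \<phi> (nxt m (p ! i)) + G (Suc i))"
      by (simp add: take_Suc_conv_app_nth k_def add.assoc)
    then show ?case using step[of i] Suc by simp
  qed simp
  from this[of k] have hol: "holonomy m \<phi> p + G k = G 0" by (simp add: k_def)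
  obtain y where y: "y \<in> h (0, 0)" using ne[of "(0, 0)"] by auto
  then have "y \<in> h (0, 1)" using hl[of 0] by simp
  then have "S y + G k = S y + G 0"
    using G[of 0 y] G[of k y] y h0 ends[OF y] k by simp
  then have "G k = G 0" by (rule add_left_imp_eq)
  with hol have "holonomy m \<phi> p + G 0 = 0 + G 0" by simp
  then show ?thesis by (rule add_right_imp_eq)
qed

end

section \<open>Noncontractible loops have holonomy\<close>

text \<open>
  A point tagged with a topology.  The surface of a map is a topology on a subset of a type; tagging
  its points makes it a subset of a type in class \<open>topological_space\<close>, as needed for \<open>homotopic_paths\<close>.
\<close>

datatype 'b located = Located "'b topology" (the_point: 'b)

instantiation located :: (type) topological_space
begin

definition open_located :: "'a located set \<Rightarrow> bool" where
  "open_located U \<longleftrightarrow> (\<forall>T. openin T {x \<in> topspace T. Located T x \<in> U})"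

instance
proof
  show "open (UNIV :: 'a located set)" by (simp add: open_located_def)
next
  fix S T :: "'a located set" assume "open S" "open T"
  then have "openin X ({x \<in> topspace X. Located X x \<in> S} \<inter> {x \<in> topspace X. Located X x \<in> T})" for X
    by (intro openin_Int) (auto simp: open_located_def)
  moreover have "{x \<in> topspace X. Located X x \<in> S} \<inter> {x \<in> topspace X. Located X x \<in> T} =
      {x \<in> topspace X. Located X x \<in> S \<inter> T}" for X by auto
  ultimately show "open (S \<inter> T)" by (simp add: open_located_def)
next
  fix K :: "'a located set set" assume "\<forall>S\<in>K. open S"
  then have "openin X (\<Union>S\<in>K. {x \<in> topspace X. Located X x \<in> S})" for X
    by (intro openin_Union) (auto simp: open_located_def)
  moreover have "(\<Union>S\<in>K. {x \<in> topspace X. Located X x \<in> S}) = {x \<in> topspace X. Located X x \<in> \<Union>K}" for X by auto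
  ultimately show "open (\<Union>K)" by (simp add: open_located_def)
qed

end

lemma continuous_map_Located: "continuous_map T (top_of_set (Located T ` topspace T)) (Located T)"
proof -
  have "continuous_map T euclidean (Located T)"
    unfolding continuous_map_def by (auto simp: open_located_def open_openin[symmetric])
  then show ?thesis by (auto simp: continuous_map_in_subtopology)
qed

lemma continuous_map_the_point: "continuous_map (top_of_set (Located T ` topspace T)) T the_point"
  unfolding continuous_map_def
proof (intro conjI allI impI)
  fix V assume V: "openin T V"
  have "openin X {x \<in> topspace X. Located X x \<in> Located T ` V}" for X
  proof (cases "X = T")
    case True
    moreover have "{x \<in> topspace T. Located T x \<in> Located T ` V} = V" using openin_subset[OF V] by auto
    ultimately show ?thesis using V by simp
  next
    case False
    then have "{x \<in> topspace X. Located X x \<in> Located T ` V} = {}" by auto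
    then show ?thesis by (metis openin_empty)
  qed
  then have "open (Located T ` V)" by (simp add: open_located_def)
  moreover have "{z \<in> topspace (top_of_set (Located T ` topspace T)). the_point z \<in> V} =
      Located T ` topspace T \<inter> Located T ` V" using openin_subset[OF V] by auto
  ultimately show "openin (top_of_set (Located T ` topspace T))
      {z \<in> topspace (top_of_set (Located T ` topspace T)). the_point z \<in> V}"
    by (simp add: openin_open_Int)
qed auto

text \<open>
  The fundamental group acts faithfully, by translations, on the homotopy classes of loops at the base
  point.  Its elements are represented by these permutations, composed additively.
\<close>

typedef 's aut = "{f :: 's \<Rightarrow> 's. bij f}" by (rule exI[of _ id]) simp

setup_lifting type_definition_aut

instantiation aut :: (type) group_add
begin
lift_definition zero_aut :: "'a aut" is id by simp
lift_definition plus_aut :: "'a aut \<Rightarrow> 'a aut \<Rightarrow> 'a aut" is "(\<circ>)" by (rule bij_comp)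
lift_definition uminus_aut :: "'a aut \<Rightarrow> 'a aut" is inv by (rule bij_imp_bij_inv)
lift_definition minus_aut :: "'a aut \<Rightarrow> 'a aut \<Rightarrow> 'a aut" is "\<lambda>f g. f \<circ> inv g"
  by (simp add: bij_comp bij_imp_bij_inv)
instance
  by standard (transfer; auto simp: fun_eq_iff bij_is_inj)+
end

text \<open>All four homotopies live on the interval, for its identity path, and are pushed forward
  by \<open>p\<close>.\<close>

lemma homotopic_paths_join_const:
  fixes p :: "real \<Rightarrow> 'b::topological_space"
  assumes "path p" "path_image p \<subseteq> S"
  shows "homotopic_paths S (p +++ (\<lambda>t. pathfinish p)) p" "homotopic_paths S ((\<lambda>t. pathstart p) +++ p) p"
    "homotopic_paths S (p +++ reversepath p) (\<lambda>t. pathstart p)"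
    "homotopic_paths S (reversepath p +++ p) (\<lambda>t. pathfinish p)"
proof -
  let ?l = "linepath 0 1 :: real \<Rightarrow> real"
  have c: "continuous_on {0..1} p" using assms(1) by (simp add: path_def)
  have im: "p \<in> {0..1} \<rightarrow> S" using assms(2) by (auto simp: path_image_def)
  have l: "path ?l" "path_image ?l \<subseteq> {0..1}" "p \<circ> ?l = p"
    unfolding path_image_linepath closed_segment_eq_real_ivl
    by (rule path_linepath, simp, simp add: linepath_def fun_eq_iff)
  note image = homotopic_paths_continuous_image[OF _ c im]
  have k: "p \<circ> linepath 0 0 = (\<lambda>t. pathstart p)" "p \<circ> linepath 1 1 = (\<lambda>t. pathfinish p)"
    by (auto simp: linepath_def fun_eq_iff pathstart_def pathfinish_def)
  show "homotopic_paths S (p +++ (\<lambda>t. pathfinish p)) p"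
    using image[OF homotopic_paths_rid[OF l(1,2)]] by (simp add: path_compose_join l k)
  show "homotopic_paths S ((\<lambda>t. pathstart p) +++ p) p"
    using image[OF homotopic_paths_lid[OF l(1,2)]] by (simp add: path_compose_join l k)
  show "homotopic_paths S (p +++ reversepath p) (\<lambda>t. pathstart p)"
    using image[OF homotopic_paths_rinv[OF l(1,2)]] by (simp add: path_compose_join path_compose_reversepath l k del: reversepath_linepath)
  show "homotopic_paths S (reversepath p +++ p) (\<lambda>t. pathfinish p)"
    using image[OF homotopic_paths_linv[OF l(1,2)]] by (simp add: path_compose_join path_compose_reversepath l k del: reversepath_linepath)
qed

text \<open>The fundamental groupoid is retracted onto the group at a base point \<open>b\<close>:
  with a chosen path \<open>K x\<close> from \<open>b\<close> to every \<open>x\<close>, a path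
  \<open>p\<close> is closed up to the loop \<open>N p\<close>. Loops act on classes of loops by
  left translation. The action is faithful because the image of the class of the constant loop is
  the class of the acting loop.\<close>

lemma path_functor_exists:
  fixes S :: "'b::topological_space set"
  assumes conn: "path_connected S" and ne: "S \<noteq> {}"
  obtains F :: "(real \<Rightarrow> 'b) \<Rightarrow> (real \<Rightarrow> 'b) set aut" where
    "\<And>p q. path p \<Longrightarrow> path_image p \<subseteq> S \<Longrightarrow> path q \<Longrightarrow> path_image q \<subseteq> S \<Longrightarrow> pathfinish p = pathstart q \<Longrightarrow>
       F (p +++ q) = F p + F q"
    "\<And>p q. homotopic_paths S p q \<Longrightarrow> F p = F q"
    "\<And>p. path p \<Longrightarrow> path_image p \<subseteq> S \<Longrightarrow> F (reversepath p) = - F p"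
    "\<And>p. path p \<Longrightarrow> path_image p \<subseteq> S \<Longrightarrow> pathfinish p = pathstart p \<Longrightarrow> F p = 0 \<Longrightarrow>
       homotopic_paths S p (\<lambda>t. pathstart p)"
proof -
  obtain b where b: "b \<in> S" using ne by blast
  define P where "P p \<longleftrightarrow> path p \<and> path_image p \<subseteq> S" for p :: "real \<Rightarrow> 'b"
  define cl where "cl p = {q. homotopic_paths S p q}" for p :: "real \<Rightarrow> 'b"
  let ?h = "homotopic_paths S"
  have PI: "path p \<Longrightarrow> path_image p \<subseteq> S \<Longrightarrow> P p" for p by (simp add: P_def)
  have Pj [simp]: "P (p +++ q)" if "P p" "P q" "pathfinish p = pathstart q" for p q
    using that by (simp add: P_def subset_path_image_join)
  have Pr [simp]: "P (reversepath p) = P p" for p by (simp add: P_def)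
  have Pb [simp]: "P (\<lambda>t. x)" if "x \<in> S" for x using that by (auto simp: P_def path_def path_image_def)
  have ends: "pathstart p \<in> S" "pathfinish p \<in> S" if "P p" for p
    using that by (auto simp: P_def)
  have cl_eq: "cl p = cl q \<longleftrightarrow> ?h p q" if "P p" for p q
  proof
    assume "cl p = cl q"
    moreover have "p \<in> cl p" using that by (simp add: cl_def P_def)
    ultimately show "?h p q" by (simp add: cl_def homotopic_paths_sym)
  next
    assume "?h p q"
    then show "cl p = cl q" unfolding cl_def using homotopic_paths_trans homotopic_paths_sym by blast
  qed
  have hrefl: "?h p p" if "P p" for p using that by (simp add: P_def)
  have hj: "?h (p +++ q) (p' +++ q')" if "?h p p'" "?h q q'" "pathfinish p = pathstart q" for p q p' q'
    using homotopic_paths_join that by blast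
  have assoc: "?h (p +++ (q +++ r)) ((p +++ q) +++ r)"
    if "P p" "P q" "P r" "pathfinish p = pathstart q" "pathfinish q = pathstart r" for p q r
    using that by (simp add: P_def homotopic_paths_assoc)
  note const = homotopic_paths_join_const[where S = S]
  define L where "L p \<longleftrightarrow> P p \<and> pathstart p = b \<and> pathfinish p = b" for p
  have Lj [simp]: "L (p +++ q)" if "L p" "L q" for p q using that by (simp add: L_def)
  have Lr [simp]: "L (reversepath p)" if "L p" for p using that by (simp add: L_def)
  have Lb [simp]: "L (\<lambda>t. b)" using b by (simp add: L_def pathstart_def pathfinish_def)
  have Lh: "L q" if "?h p q" "L p" for p q
    using that homotopic_paths_imp_path homotopic_paths_imp_subset homotopic_paths_imp_pathstart
      homotopic_paths_imp_pathfinish unfolding L_def P_def by metis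
  \<comment> \<open>Sets of paths which are not classes of loops are left fixed, so that
    \<open>act l\<close> permutes the whole type, as \<open>aut\<close> demands.\<close>
  define act where "act l c = (if \<exists>p. L p \<and> c = cl p then cl (l +++ (SOME p. L p \<and> c = cl p)) else c)" for l c
  have act: "act l (cl p) = cl (l +++ p)" if "L l" "L p" for l p
  proof -
    have ex: "\<exists>q. L q \<and> cl p = cl q" using that by blast
    define q where "q = (SOME q. L q \<and> cl p = cl q)"
    have q: "L q" "cl p = cl q" using someI_ex[OF ex] by (auto simp: q_def)
    have "?h p q" using q(2) cl_eq that(2) by (simp add: L_def)
    then have "?h (l +++ p) (l +++ q)" using that hj hrefl by (simp add: L_def)
    then have "cl (l +++ p) = cl (l +++ q)" using cl_eq that by (simp add: L_def)
    then show ?thesis using ex by (simp add: act_def q_def)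
  qed
  have act_other: "act l c = c" if "\<forall>p. L p \<longrightarrow> c \<noteq> cl p" for l c using that unfolding act_def by auto
  have act_join: "act (l +++ l') = act l \<circ> act l'" if "L l" "L l'" for l l'
  proof
    fix c show "act (l +++ l') c = (act l \<circ> act l') c"
    proof (cases "\<exists>p. L p \<and> c = cl p")
      case True
      then obtain p where p: "L p" "c = cl p" by blast
      have "?h (l +++ (l' +++ p)) ((l +++ l') +++ p)" using that p by (intro assoc) (auto simp: L_def)
      then show ?thesis using that p by (simp add: act cl_eq L_def homotopic_paths_sym)
    qed (simp add: act_other)
  qed
  have act_cong: "act l = act l'" if "?h l l'" "L l" for l l'
  proof
    fix c show "act l c = act l' c"
    proof (cases "\<exists>p. L p \<and> c = cl p")
      case True
      then obtain p where p: "L p" "c = cl p" by blast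
      then have "?h (l +++ p) (l' +++ p)" using that by (intro hj hrefl) (auto simp: L_def)
      moreover have "L (l +++ p)" using that p by simp
      ultimately show ?thesis using that p Lh[OF that] by (simp add: act cl_eq L_def)
    qed (simp add: act_other)
  qed
  have act_b: "act (\<lambda>t. b) = id"
  proof
    fix c show "act (\<lambda>t. b) c = id c"
    proof (cases "\<exists>p. L p \<and> c = cl p")
      case True
      then obtain p where p: "L p" "c = cl p" by blast
      then have "?h ((\<lambda>t. b) +++ p) p" using const(2)[of p] by (auto simp: L_def P_def)
      moreover have "L ((\<lambda>t. b) +++ p)" using p by simp
      ultimately show ?thesis using p by (simp add: act cl_eq L_def)
    qed (simp add: act_other)
  qed
  have rinv: "?h (p +++ reversepath p) (\<lambda>t. pathstart p)" "?h (reversepath p +++ p) (\<lambda>t. pathfinish p)"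
    "?h (p +++ (\<lambda>t. pathfinish p)) p" "?h ((\<lambda>t. pathstart p) +++ p) p" if "P p" for p
    using const that by (auto simp: P_def)
  have act_rev: "act l \<circ> act (reversepath l) = id" "act (reversepath l) \<circ> act l = id" if "L l" for l
    using act_cong[OF rinv(1)[of l]] act_cong[OF rinv(2)[of l]] that act_b act_join
    by (auto simp: L_def)
  have bij: "bij (act l)" if "L l" for l
    using act_rev[OF that] by (intro o_bij)
  define M where "M l = Abs_aut (act l)" for l
  have M_join: "M (l +++ l') = M l + M l'" if "L l" "L l'" for l l'
    using that bij by (simp add: M_def act_join plus_aut.abs_eq eq_onp_def)
  have M_cong: "M l = M l'" if "?h l l'" "L l" for l l' using act_cong[OF that] by (simp add: M_def)
  have M_b: "M (\<lambda>t. b) = 0" by (simp add: M_def act_b zero_aut_def)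
  have M_0: "?h l (\<lambda>t. b)" if "M l = 0" "L l" for l
  proof -
    have "act l = id"
      using that bij[OF that(2)] by (simp add: M_def zero_aut_def Abs_aut_inject)
    then have "cl (l +++ (\<lambda>t. b)) = cl (\<lambda>t. b)" using act[OF that(2) Lb] by simp
    moreover have "P (l +++ (\<lambda>t. b))" using Lj[OF that(2) Lb] by (simp add: L_def)
    ultimately have "?h (l +++ (\<lambda>t. b)) (\<lambda>t. b)" using cl_eq by blast
    moreover have "?h (l +++ (\<lambda>t. b)) l" using rinv(3)[of l] that(2) by (simp add: L_def)
    ultimately show ?thesis using homotopic_paths_sym homotopic_paths_trans by blast
  qed
  have "\<exists>k. x \<in> S \<longrightarrow> P k \<and> pathstart k = b \<and> pathfinish k = x" for x
    using conn b unfolding path_connected_def P_def by blast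
  then obtain K where K: "\<And>x. x \<in> S \<Longrightarrow> P (K x) \<and> pathstart (K x) = b \<and> pathfinish (K x) = x" by metis
  define N where "N p = K (pathstart p) +++ (p +++ reversepath (K (pathfinish p)))" for p
  have LN: "L (N p)" if "P p" for p
    using that K ends[OF that] by (simp add: N_def L_def)
  define F where "F p = M (N p)" for p
  have F_cong: "F p = F q" if "?h p q" for p q
  proof -
    have pq: "P p" "pathstart p = pathstart q" "pathfinish p = pathfinish q"
      using that homotopic_paths_imp_path homotopic_paths_imp_subset homotopic_paths_imp_pathstart
      homotopic_paths_imp_pathfinish unfolding P_def by metis+
    note e = ends[OF pq(1)]
    have "?h (N p) (N q)"
      unfolding N_def pq(2,3)
      by (intro hj hrefl that) (use K[OF e(1)] K[OF e(2)] pq in auto)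
    then show ?thesis using M_cong LN[OF pq(1)] by (simp add: F_def)
  qed
  have F_join: "F (p +++ q) = F p + F q" if p: "P p" and q: "P q" and pq: "pathfinish p = pathstart q" for p q
  proof -
    let ?v = "K (pathstart p)" and ?u = "K (pathstart q)" and ?w = "reversepath (K (pathfinish q))"
    have K': "P ?v" "P ?u" "P ?w" "pathfinish ?v = pathstart p" "pathstart ?u = b" "pathfinish ?u = pathstart q"
      "pathstart ?w = pathfinish q" "pathstart ?v = b" "pathfinish ?w = b"
      using K ends[OF p] ends[OF q] pq by auto
    let ?R = "q +++ ?w"
    have R: "P ?R" using K' q by simp
    \<comment> \<open>In the middle the reverse of \<open>?u\<close> meets \<open>?u\<close> and
      both cancel; the other steps only move parentheses.\<close>
    have "?h (N p +++ N q) (?v +++ ((p +++ reversepath ?u) +++ (?u +++ ?R)))"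
      unfolding N_def pq by (rule homotopic_paths_sym, rule assoc) (use K' p q pq in auto)
    also have "?h (?v +++ ((p +++ reversepath ?u) +++ (?u +++ ?R))) (?v +++ (p +++ (reversepath ?u +++ (?u +++ ?R))))"
      by (intro hj hrefl homotopic_paths_sym[OF assoc]) (use K' p q pq in auto)
    also have "?h (?v +++ (p +++ (reversepath ?u +++ (?u +++ ?R)))) (?v +++ (p +++ ((reversepath ?u +++ ?u) +++ ?R)))"
      by (intro hj hrefl assoc) (use K' p q pq in auto)
    also have "?h (?v +++ (p +++ ((reversepath ?u +++ ?u) +++ ?R))) (?v +++ (p +++ ((\<lambda>t. pathfinish ?u) +++ ?R)))"
      by (intro hj hrefl rinv) (use K' p q pq in auto)
    also have "?h (?v +++ (p +++ ((\<lambda>t. pathfinish ?u) +++ ?R))) (?v +++ (p +++ ?R))"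
    proof (rule hj[OF hrefl hj[OF hrefl]])
      show "?h ((\<lambda>t. pathfinish ?u) +++ ?R) ?R" using rinv(4)[OF R] K' by simp
    qed (use K' p q pq in \<open>auto simp: pathstart_def pathfinish_def joinpaths_def\<close>)
    also have "?h (?v +++ (p +++ ?R)) (?v +++ ((p +++ q) +++ ?w))"
      by (intro hj hrefl assoc) (use K' p q pq in auto)
    finally have "?h (N p +++ N q) (N (p +++ q))" by (simp add: N_def)
    from M_cong[OF this] show ?thesis using LN p q pq by (simp add: F_def M_join)
  qed
  have F_const: "F (\<lambda>t. x) = 0" if x: "x \<in> S" for x
  proof -
    let ?k = "K x"
    have Nx: "N (\<lambda>t. x) = ?k +++ ((\<lambda>t. pathstart (reversepath ?k)) +++ reversepath ?k)"
      using K[OF x] by (simp add: N_def pathstart_def[of "\<lambda>t. x"] pathfinish_def[of "\<lambda>t. x"])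
    have "?h (N (\<lambda>t. x)) (?k +++ reversepath ?k)"
      unfolding Nx by (rule hj[OF hrefl rinv(4)]) (use K[OF x] in \<open>simp_all add: pathstart_def[of "(\<lambda>t. x) +++ q" for q] pathstart_def[of "\<lambda>t. x"]\<close>)
    also have "?h (?k +++ reversepath ?k) (\<lambda>t. b)" using rinv(1)[of ?k] K[OF x] by simp
    finally show ?thesis using M_cong LN[OF Pb[OF x]] M_b by (metis F_def)
  qed
  have F_rev: "F (reversepath p) = - F p" if p: "P p" for p
  proof -
    have "F (reversepath p) + F p = F (\<lambda>t. pathfinish p)"
      using F_join[of "reversepath p" p] F_cong[OF rinv(2)[OF p]] p by simp
    also have "\<dots> = 0" using F_const ends[OF p] by simp
    finally show ?thesis by (rule eq_neg_iff_add_eq_0[THEN iffD2])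
  qed
  have F_0: "?h p (\<lambda>t. pathstart p)" if p: "P p" and loop: "pathfinish p = pathstart p" and 0: "F p = 0" for p
  proof -
    let ?k = "K (pathstart p)"
    have K': "P ?k" "pathstart ?k = b" "pathfinish ?k = pathstart p" using K ends[OF p] by auto
    have N0: "?h (?k +++ (p +++ reversepath ?k)) (\<lambda>t. b)"
      using M_0[of "N p"] 0 LN[OF p] by (simp add: F_def N_def loop)
    \<comment> \<open>Cancelling the first \<open>?k\<close> in \<open>N0\<close> shows that
      \<open>?q\<close> is homotopic to the reverse of \<open>?k\<close>; appending
      \<open>?k\<close> to both then gives the claim for \<open>p\<close>.\<close>
    let ?q = "p +++ reversepath ?k"
    have q: "P ?q" using p K' loop by simp
    have "?h ?q ((\<lambda>t. pathstart ?q) +++ ?q)" using rinv(4)[OF q] by (rule homotopic_paths_sym)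
    also have "?h ((\<lambda>t. pathstart ?q) +++ ?q) ((reversepath ?k +++ ?k) +++ ?q)"
    proof (rule hj[OF _ hrefl])
      show "?h (\<lambda>t. pathstart ?q) (reversepath ?k +++ ?k)"
        using rinv(2)[OF K'(1)] K' by (simp add: homotopic_paths_sym)
    qed (use q in \<open>auto simp: pathfinish_def\<close>)
    also have "?h ((reversepath ?k +++ ?k) +++ ?q) (reversepath ?k +++ (?k +++ ?q))"
      by (rule homotopic_paths_sym, rule assoc) (use K' q in auto)
    also have "?h (reversepath ?k +++ (?k +++ ?q)) (reversepath ?k +++ (\<lambda>t. pathfinish (reversepath ?k)))"
    proof (rule hj[OF hrefl])
      show "?h (?k +++ ?q) (\<lambda>t. pathfinish (reversepath ?k))" using N0 K' by simp
    qed (use K' in auto)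
    also have "?h (reversepath ?k +++ (\<lambda>t. pathfinish (reversepath ?k))) (reversepath ?k)"
      by (intro rinv) (use K' in auto)
    finally have q1: "?h ?q (reversepath ?k)" .
    have "?h p (p +++ (\<lambda>t. pathfinish p))" using rinv(3)[OF p] by (rule homotopic_paths_sym)
    also have "?h (p +++ (\<lambda>t. pathfinish p)) (p +++ (reversepath ?k +++ ?k))"
    proof (rule hj[OF hrefl])
      show "?h (\<lambda>t. pathfinish p) (reversepath ?k +++ ?k)"
        using rinv(2)[OF K'(1)] K' loop by (simp add: homotopic_paths_sym)
    qed (use p in \<open>auto simp: pathstart_def\<close>)
    also have "?h (p +++ (reversepath ?k +++ ?k)) (?q +++ ?k)"
      by (rule assoc) (use p K' loop in auto)
    also have "?h (?q +++ ?k) (reversepath ?k +++ ?k)"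
      by (intro hj hrefl q1) (use K' in auto)
    also have "?h (reversepath ?k +++ ?k) (\<lambda>t. pathstart p)" using rinv(2)[OF K'(1)] K' by simp
    finally show ?thesis .
  qed
  show ?thesis
    by (rule that[of F]) (use F_join F_cong F_rev F_0 in \<open>auto simp: P_def\<close>)
qed

section \<open>The labeling by classes of radial paths\<close>

context rooted_map
begin

abbreviation surf :: "'a point set located set" where
  "surf \<equiv> Located (surface m) ` topspace (surface m)"

definition pt :: "'a point \<Rightarrow> 'a point set located" where
  "pt y = Located (surface m) (pcls y)"

lemma pt_in: "y \<in> topspace (sectors m) \<Longrightarrow> pt y \<in> surf"
  by (simp add: pt_def pcls_in_surface)

lemma pt_eq: "d \<in> darts m \<Longrightarrow> t \<in> {0..1} \<Longrightarrow> t' \<in> {0..1} \<Longrightarrow> pt (d, 0, t) = pt (d, 0, t')"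
  "d \<in> darts m \<Longrightarrow> r \<in> {0..1} \<Longrightarrow> pt (d, r, 1) = pt (nxt m d, r, 0)"
  "d \<in> darts m \<Longrightarrow> t \<in> {0..1} \<Longrightarrow> pt (d, 1, t) = pt (rev m d, 1, 1 - t)"
  using pcls_centre[of d t t'] pcls_sector[of d r] pcls_side[of d t] by (simp_all add: pt_def)

lemma continuous_on_pt:
  assumes d: "d \<in> darts m"
  shows "continuous_on ({0..1} \<times> {0..1}) (\<lambda>z. pt (d, z))" "(\<lambda>z. pt (d, z)) \<in> {0..1} \<times> {0..1} \<rightarrow> surf"
proof -
  have "continuous_map (top_of_set ({0..1} \<times> {0..1})) (sectors m) (\<lambda>z. (d, fst z, snd z))"
    by (rule continuous_map_sectors) (use d in \<open>auto intro!: continuous_intros\<close>)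
  from continuous_map_compose[OF continuous_map_compose[OF this continuous_map_pcls] continuous_map_Located]
  have "continuous_map (top_of_set ({0..1} \<times> {0..1})) (top_of_set surf) (\<lambda>z. pt (d, z))"
    by (simp add: o_def pt_def)
  then show "continuous_on ({0..1} \<times> {0..1}) (\<lambda>z. pt (d, z))" "(\<lambda>z. pt (d, z)) \<in> {0..1} \<times> {0..1} \<rightarrow> surf"
    by (auto simp: continuous_map_in_subtopology)
qed

lemma path_pt:
  assumes d: "d \<in> darts m" and q: "path q" "path_image q \<subseteq> {0..1} \<times> {0..1}"
  shows "path (\<lambda>x. pt (d, q x))" "path_image (\<lambda>x. pt (d, q x)) \<subseteq> surf"
proof -
  have "path ((\<lambda>z. pt (d, z)) \<circ> q)"
    using q continuous_on_pt(1)[OF d] by (intro path_continuous_image) (auto intro: continuous_on_subset)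
  then show "path (\<lambda>x. pt (d, q x))" by (simp add: o_def)
  show "path_image (\<lambda>x. pt (d, q x)) \<subseteq> surf"
    using q(2) continuous_on_pt(2)[OF d] unfolding path_image_def Pi_iff by blast
qed

definition edge_path :: "'a \<Rightarrow> real \<Rightarrow> 'a point set located" where
  "edge_path d t = pt (d, 1, t)"

definition radial_path :: "'a \<Rightarrow> real \<Rightarrow> 'a point set located" where
  "radial_path d r = pt (d, r, 0)"

lemma linepath_square: "path_image (linepath a b) \<subseteq> {0..1} \<times> {0..1::real}"
  if "a \<in> {0..1} \<times> {0..1}" "b \<in> {0..1} \<times> {0..1}" for a b :: "real \<times> real"
  unfolding path_image_linepath using that
  by (intro closed_segment_subset) (auto intro: convex_Times convex_real_interval)

lemma path_edge_radial:
  assumes d: "d \<in> darts m"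
  shows "path (edge_path d)" "path_image (edge_path d) \<subseteq> surf"
    "path (radial_path d)" "path_image (radial_path d) \<subseteq> surf"
proof -
  have "edge_path d = (\<lambda>x. pt (d, linepath (1, 0) (1, 1) x))"
    "radial_path d = (\<lambda>x. pt (d, linepath (0, 0) (1, 0) x))"
    by (auto simp: edge_path_def radial_path_def linepath_def)
  then show "path (edge_path d)" "path_image (edge_path d) \<subseteq> surf"
    "path (radial_path d)" "path_image (radial_path d) \<subseteq> surf"
    using path_pt[OF d path_linepath linepath_square] by auto
qed

lemma path_connected_surf: "path_connected surf" and surf_nonempty: "surf \<noteq> {}"
proof -
  let ?Q = "{0..1::real} \<times> {0..1::real}"
  have sec: "path_component surf (pt (d, z)) (pt (d, z'))" if "d \<in> darts m" "z \<in> ?Q" "z' \<in> ?Q" for d z z'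
  proof -
    have "path_connected ?Q" by (intro convex_imp_path_connected convex_Times convex_real_interval)
    then have "path_connected ((\<lambda>z. pt (d, z)) ` ?Q)"
      using continuous_on_pt(1)[OF that(1)] by (rule path_connected_continuous_image[rotated])
    then have "path_component ((\<lambda>z. pt (d, z)) ` ?Q) (pt (d, z)) (pt (d, z'))"
      using that unfolding path_connected_component by blast
    then show ?thesis by (rule path_component_of_subset[rotated]) (use continuous_on_pt(2)[OF that(1)] in auto)
  qed
  let ?c = "\<lambda>d. pt (d, 1, 0)"
  have corner: "path_component surf (?c d) (?c e)"
    if "(d, e) \<in> ({(d, rev m d) |d. d \<in> darts m} \<union> {(d, rot m d) |d. d \<in> darts m})\<^sup>*" "d \<in> darts m" for d e
    using that(1)
  proof (induction rule: rtrancl_induct)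
    case base
    show ?case using sec[OF that(2), of "(1, 0)" "(1, 0)"] by simp
  next
    case (step e e')
    then have e: "e \<in> darts m" by blast
    from step(2) consider "e' = rev m e" | "e' = rot m e" by blast
    then have "path_component surf (?c e) (?c e')"
    proof cases
      case 1
      then have "?c e' = pt (e, 1, 1)" using pt_eq(3)[OF e, of 1] by simp
      then show ?thesis using sec[OF e, of "(1, 0)" "(1, 1)"] by simp
    next
      case 2
      then have "?c e' = ?c e" using pcls_rot[OF e] by (simp add: pt_def)
      then show ?thesis using sec[OF e, of "(1, 0)" "(1, 0)"] by simp
    qed
    with step(3) show ?case by (rule path_component_trans)
  qed
  have root: "path_component surf (?c (root m)) X" if X: "X \<in> surf" for X
  proof -
    obtain Y where "Y \<in> topspace (surface m)" "X = Located (surface m) Y" using X by blast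
    then obtain d z where dz: "(d, z) \<in> topspace (sectors m)" "X = pt (d, z)"
      using surface_point_nonempty[of Y] unfolding pt_def by (metis surj_pair)
    then have d: "d \<in> darts m" "z \<in> ?Q" by (auto simp: topspace_sectors)
    have 1: "path_component surf (?c (root m)) (?c d)"
      using connected root_in d(1) by (intro corner) (auto simp: connected_darts_def)
    have "path_component surf (?c d) X" unfolding dz(2) by (rule sec[OF d(1) _ d(2)]) auto
    with 1 show ?thesis by (rule path_component_trans)
  qed
  show "path_connected surf"
    unfolding path_connected_component
  proof (intro ballI)
    fix x y assume "x \<in> surf" "y \<in> surf"
    from path_component_trans[OF path_component_sym[OF root[OF this(1)]] root[OF this(2)]]
    show "path_component surf x y" .
  qed
  show "surf \<noteq> {}" using root_in pt_in[of "(root m, 1, 0)"] by (auto simp: topspace_sectors)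
qed

text \<open>A single labeling detects all noncontractible loops: a corner is labeled by the class of
  the radial path from the centre of its polygon. Going around a sector gives a trivial class, so
  the increment along a side is the class of that side, and the holonomy of a loop is the class of
  its trace.\<close>

lemma trivial_holonomy_imp_null_homotopic:
  obtains \<phi> :: "'a \<Rightarrow> (real \<Rightarrow> 'a point set located) set aut" where "admissible m \<phi>"
    "\<And>p. is_loop m p \<Longrightarrow> holonomy m \<phi> p = 0 \<Longrightarrow> null_homotopic m (trace m p)"
proof -
  obtain F :: "(real \<Rightarrow> 'a point set located) \<Rightarrow> (real \<Rightarrow> 'a point set located) set aut" where
    F_join: "\<And>p q. path p \<Longrightarrow> path_image p \<subseteq> surf \<Longrightarrow> path q \<Longrightarrow> path_image q \<subseteq> surf \<Longrightarrow>
       pathfinish p = pathstart q \<Longrightarrow> F (p +++ q) = F p + F q" and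
    F_cong: "\<And>p q. homotopic_paths surf p q \<Longrightarrow> F p = F q" and
    F_rev: "\<And>p. path p \<Longrightarrow> path_image p \<subseteq> surf \<Longrightarrow> F (reversepath p) = - F p" and
    F_0: "\<And>p. path p \<Longrightarrow> path_image p \<subseteq> surf \<Longrightarrow> pathfinish p = pathstart p \<Longrightarrow> F p = 0 \<Longrightarrow>
       homotopic_paths surf p (\<lambda>t. pathstart p)"
    by (rule path_functor_exists[OF path_connected_surf surf_nonempty]) (rule that)
  let ?Q = "{0..1::real} \<times> {0..1::real}"
  have F_eq: "F p = F q" if "path p" "path_image p \<subseteq> surf" "\<And>t. t \<in> {0..1} \<Longrightarrow> p t = q t" for p q
    using F_cong homotopic_paths_eq[OF that] by blast
  have F_const: "F (\<lambda>t. x) = 0" if "x \<in> surf" for x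
  proof -
    have "(\<lambda>t. x) +++ (\<lambda>t. x) = (\<lambda>t::real. x)" by (auto simp: joinpaths_def)
    moreover have "path (\<lambda>t. x)" "path_image (\<lambda>t. x) \<subseteq> surf" using that by (auto simp: path_def path_image_def)
    ultimately have "F (\<lambda>t. x) = F (\<lambda>t. x) + F (\<lambda>t. x)"
      using F_join[of "\<lambda>t. x" "\<lambda>t. x"] by (simp add: pathstart_def pathfinish_def)
    then show ?thesis by (rule add_right_eq_selfD)
  qed
  define \<phi> where "\<phi> d = F (radial_path d)" for d
  have edge: "- \<phi> d + \<phi> (nxt m d) = F (edge_path d)" if d: "d \<in> darts m" for d
  proof -
    let ?l = "linepath :: real \<times> real \<Rightarrow> _"
    \<comment> \<open>The two ways around a sector from the centre to the head of the side,
      homotopic since the square is convex. The second starts with a stretch on which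
      \<open>pt\<close> is constant and ends with the radial path of the next side.\<close>
    let ?p = "?l (0, 0) (1, 0) +++ ?l (1, 0) (1, 1)" and ?q = "?l (0, 0) (0, 1) +++ ?l (0, 1) (1, 1)"
    let ?s = "\<lambda>z. pt (d, z)"
    have pq: "path_image ?p \<subseteq> ?Q" "path_image ?q \<subseteq> ?Q"
      by (intro subset_path_image_join linepath_square; simp)+
    have "homotopic_paths ?Q ?p ?q"
    proof (rule homotopic_paths_linear)
      fix t :: real assume "t \<in> {0..1}"
      then have "?p t \<in> ?Q" "?q t \<in> ?Q" using pq by (auto simp: path_image_def)
      then show "closed_segment (?p t) (?q t) \<subseteq> ?Q"
        by (intro closed_segment_subset) (auto intro: convex_Times convex_real_interval)
    qed auto
    from homotopic_paths_continuous_image[OF this continuous_on_pt[OF d]]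
    have "F (?s \<circ> ?p) = F (?s \<circ> ?q)" by (rule F_cong)
    moreover have "?s \<circ> ?p = radial_path d +++ edge_path d"
      unfolding path_compose_join by (intro arg_cong2[where f = "(+++)"]) (auto simp: linepath_def radial_path_def edge_path_def)
    moreover have "?s \<circ> ?q = (\<lambda>t. pt (d, 0, t)) +++ (\<lambda>r. pt (d, r, 1))"
      unfolding path_compose_join by (intro arg_cong2[where f = "(+++)"]) (auto simp: linepath_def)
    moreover have "F (radial_path d +++ edge_path d) = \<phi> d + F (edge_path d)"
      unfolding \<phi>_def using path_edge_radial[OF d]
      by (intro F_join) (auto simp: pathstart_def pathfinish_def radial_path_def edge_path_def)
    moreover have "F ((\<lambda>t. pt (d, 0, t)) +++ (\<lambda>r. pt (d, r, 1))) = 0 + \<phi> (nxt m d)"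
    proof -
      have 1: "path (\<lambda>t. pt (d, 0, t))" "path_image (\<lambda>t. pt (d, 0, t)) \<subseteq> surf"
        using path_pt[OF d path_linepath linepath_square, of "(0, 0)" "(0, 1)"] by (auto simp: linepath_def)
      have 2: "path (\<lambda>r. pt (d, r, 1))" "path_image (\<lambda>r. pt (d, r, 1)) \<subseteq> surf"
        using path_pt[OF d path_linepath linepath_square, of "(0, 1)" "(1, 1)"] by (auto simp: linepath_def)
      have "F (\<lambda>t. pt (d, 0, t)) = F (\<lambda>t. pt (d, 0, 0))"
        by (rule F_eq[OF 1]) (rule pt_eq(1)[OF d], auto)
      also have "\<dots> = 0" using d by (intro F_const pt_in) (auto simp: topspace_sectors)
      finally have "F (\<lambda>t. pt (d, 0, t)) = 0" .
      moreover have "F (\<lambda>r. pt (d, r, 1)) = \<phi> (nxt m d)"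
        unfolding \<phi>_def by (rule F_eq[OF 2]) (simp add: radial_path_def pt_eq(2)[OF d])
      ultimately show ?thesis
        using F_join[OF 1 2] by (simp add: pathstart_def pathfinish_def)
    qed
    ultimately have "\<phi> d + F (edge_path d) = \<phi> (nxt m d)" by simp
    then show ?thesis by (metis minus_add_cancel)
  qed
  have adm: "admissible m \<phi>"
    unfolding admissible_def
  proof
    fix d assume d: "d \<in> darts m"
    have "F (edge_path (rev m d)) = F (reversepath (edge_path d))"
    proof (rule F_eq)
      fix t :: real assume "t \<in> {0..1}"
      then show "edge_path (rev m d) t = reversepath (edge_path d) t"
        using pt_eq(3)[OF d, of "1 - t"] by (simp add: edge_path_def reversepath_def)
    qed (use d path_edge_radial in auto)
    then show "- \<phi> (rev m d) + \<phi> (nxt m (rev m d)) = - (- \<phi> d + \<phi> (nxt m d))"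
      unfolding edge[OF d] using edge[of "rev m d"] d F_rev path_edge_radial(1,2)[OF d] by simp
  qed
  define tr where "tr p x = Located (surface m) (trace m p x)" for p x
  have tr_seg: "tr p x = pt (p ! i, 1, real (length p) * x - real i)"
    if "path_from m v p" "i < length p" "real i \<le> real (length p) * x" "real (length p) * x \<le> real i + 1" for p v i x
    using trace_segment[OF that] by (simp add: tr_def pt_def)
  have tr_start: "pathstart (tr p) = pt (hd p, 1, 0)" and tr_finish: "pathfinish (tr p) = pt (last p, 1, 1)"
    if "path_from m v p" "p \<noteq> []" for v p
  proof -
    show "pathstart (tr p) = pt (hd p, 1, 0)"
      using tr_seg[OF that(1), of 0 0] that(2) by (simp add: pathstart_def hd_conv_nth)
    show "pathfinish (tr p) = pt (last p, 1, 1)"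
      using tr_seg[OF that(1), of "length p - 1" 1] that(2)
      by (cases "length p") (auto simp: pathfinish_def last_conv_nth)
  qed
  have tr: "path (tr p) \<and> path_image (tr p) \<subseteq> surf \<and> F (tr p) = holonomy m \<phi> p"
    if "path_from m v p" "p \<noteq> []" for v p
    using that
  proof (induction p arbitrary: v)
    case (Cons d p)
    have d: "d \<in> darts m" using Cons.prems by simp
    note e = path_edge_radial(1,2)[OF d]
    show ?case
    proof (cases "p = []")
      case True
      have "homotopic_paths surf (edge_path d) (tr (d # p))"
        using tr_seg[OF Cons.prems(1), of 0] True
        by (intro homotopic_paths_eq e) (auto simp: edge_path_def)
      then show ?thesis
        using F_cong[of "edge_path d" "tr (d # p)"] edge[OF d] True
          homotopic_paths_imp_path homotopic_paths_imp_subset by (metis holonomy_simps add.right_neutral)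
    next
      case False
      have p: "path_from m (head m d) p" using Cons.prems by simp
      note IH = Cons.IH[OF p False]
      have "head m d = tail m (hd p)" using p False by (cases p) auto
      then have fin: "pathfinish (edge_path d) = pathstart (tr p)"
        unfolding tr_start[OF p False] using pcls_head[OF d] by (simp add: pathfinish_def edge_path_def pt_def)
      let ?k = "real (length p)"
      have k: "?k > 0" using False by simp
      \<comment> \<open>\<open>tr\<close> spends the same time on each of the \<open>?k + 1\<close>
        half-edges, whereas \<open>+++\<close> spends half of the time on the first one;
        \<open>f\<close> is the piecewise linear change of time. Written as a sum of a minimum and a
        maximum, it is visibly continuous.\<close>
      define f where "f x = min ((?k + 1) * x / 2) (1 / 2) + max 0 (((?k + 1) * x - 1) / (2 * ?k))" for x
      have f1: "f x = (?k + 1) * x / 2" if "(?k + 1) * x \<le> 1" for x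
      proof -
        have "((?k + 1) * x - 1) / (2 * ?k) \<le> 0" using that k by (intro divide_nonpos_nonneg) auto
        then show ?thesis using that by (simp add: f_def)
      qed
      have f2: "f x = 1 / 2 + ((?k + 1) * x - 1) / (2 * ?k)" if "(?k + 1) * x \<ge> 1" for x
      proof -
        have "((?k + 1) * x - 1) / (2 * ?k) \<ge> 0" using that k by (intro divide_nonneg_nonneg) auto
        then show ?thesis using that by (simp add: f_def)
      qed
      have hom: "homotopic_paths surf (edge_path d +++ tr p) (tr (d # p))"
      proof (rule homotopic_paths_reparametrize[where f = f])
        show "path (edge_path d +++ tr p)" using e IH fin by simp
        show "path_image (edge_path d +++ tr p) \<subseteq> surf" using e IH by (intro subset_path_image_join) auto
        show "continuous_on {0..1} f" unfolding f_def using k by (intro continuous_intros) auto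
        show "f 0 = 0" using f1[of 0] by simp
        show "f 1 = 1" using f2[of 1] k by simp
        show "f \<in> {0..1} \<rightarrow> {0..1}"
        proof
          fix x :: real assume x: "x \<in> {0..1}"
          show "f x \<in> {0..1}"
          proof (cases "(?k + 1) * x \<le> 1")
            case True
            moreover have "(?k + 1) * x \<ge> 0" using x by simp
            ultimately show ?thesis using f1[OF True] by simp
          next
            case False
            then have "((?k + 1) * x - 1) / (2 * ?k) \<ge> 0" using k by (intro divide_nonneg_nonneg) auto
            moreover have "(?k + 1) * x \<le> ?k + 1" using x k by (simp add: mult_left_le)
            then have "((?k + 1) * x - 1) / (2 * ?k) \<le> 1 / 2" using k by (simp add: field_simps)
            moreover have "f x = 1 / 2 + ((?k + 1) * x - 1) / (2 * ?k)" using f2[of x] False by linarith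
            ultimately show ?thesis unfolding atLeastAtMost_iff by linarith
          qed
        qed
        fix x :: real assume x: "x \<in> {0..1}"
        show "tr (d # p) x = (edge_path d +++ tr p) (f x)"
        proof (cases "(?k + 1) * x \<le> 1")
          case True
          then show ?thesis
            using tr_seg[OF Cons.prems(1), of 0 x] f1[OF True] x
            by (simp add: joinpaths_def edge_path_def algebra_simps)
        next
          case False
          define y where "y = ((?k + 1) * x - 1) / ?k"
          have y: "?k * y = (?k + 1) * x - 1" "y > 0" using k False by (auto simp: y_def)
          have "(?k + 1) * x \<le> ?k + 1" using x k by (simp add: mult_left_le)
          then have y1: "?k * y \<le> ?k" using y(1) by linarith
          \<comment> \<open>Rounding up, with \<open>y > 0\<close>, keeps the index \<open>i\<close>
            below \<open>length p\<close> even at the end of the path.\<close>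
          define j where "j = \<lceil>?k * y\<rceil>"
          have "?k * y > 0" by (rule mult_pos_pos[OF k y(2)])
          then have j: "real_of_int j \<ge> ?k * y" "real_of_int j < ?k * y + 1" "j \<ge> 1"
            unfolding j_def by linarith+
          have "j \<le> int (length p)" unfolding j_def using y1 by (intro ceiling_le) simp
          define i where "i = nat (j - 1)"
          have i: "real i \<le> ?k * y" "?k * y \<le> real i + 1" "i < length p"
            using j \<open>j \<le> _\<close> by (simp_all add: i_def)
          have "tr (d # p) x = pt (p ! i, 1, ?k * y - real i)"
          proof -
            have len: "real (length (d # p)) * x = ?k * y + 1" unfolding y(1) by (simp add: algebra_simps)
            show ?thesis using tr_seg[OF Cons.prems(1), of "Suc i" x, unfolded len] i by simp
          qed
          also have "\<dots> = tr p y" using tr_seg[OF p i(3,1,2)] by simp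
          also have "\<dots> = (edge_path d +++ tr p) (f x)"
          proof -
            have fx: "f x = 1 / 2 + y / 2" using f2[of x] False by (simp add: y_def)
            then have "\<not> f x \<le> 1 / 2" "2 * f x - 1 = y" using y(2) by auto
            then show ?thesis unfolding joinpaths_def by simp
          qed
          finally show ?thesis .
        qed
      qed
      have "F (tr (d # p)) = F (edge_path d) + F (tr p)"
        using F_cong[OF hom] F_join[OF e _ _ fin] IH by simp
      also have "\<dots> = holonomy m \<phi> (d # p)" using edge[OF d] IH by simp
      finally show ?thesis
        using homotopic_paths_imp_path[OF hom] homotopic_paths_imp_subset[OF hom] by blast
    qed
  qed simp
  have "null_homotopic m (trace m p)" if loop: "is_loop m p" and hol: "holonomy m \<phi> p = 0" for p
  proof -
    have p: "path_from m (origin m p) p" "p \<noteq> []" "head m (last p) = tail m (hd p)"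
      using loop by (auto simp: is_loop_def origin_def)
    have "last p \<in> darts m" using path_from_nth(1)[OF p(1), of "length p - 1"] p(2) by (simp add: last_conv_nth)
    then have fin: "pathfinish (tr p) = pathstart (tr p)"
      unfolding tr_start[OF p(1,2)] tr_finish[OF p(1,2)] using pcls_head p(3) by (simp add: pt_def)
    have "homotopic_paths surf (tr p) (\<lambda>t. pathstart (tr p))"
      using F_0[of "tr p"] tr[OF p(1,2)] hol fin by simp
    then have "homotopic_loops surf (tr p) (\<lambda>t. pathstart (tr p))"
      by (rule homotopic_paths_imp_homotopic_loops) (use fin in \<open>auto simp: pathfinish_def\<close>)
    then have "homotopic_with (\<lambda>r. pathfinish r = pathstart r) (top_of_set {0..1}) (top_of_set surf) (tr p) (\<lambda>t. pathstart (tr p))"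
      by (simp add: homotopic_loops_def)
    then have "homotopic_with (\<lambda>h. h 0 = h 1) (top_of_set {0..1}) (surface m) (the_point \<circ> tr p) (the_point \<circ> (\<lambda>t. pathstart (tr p)))"
      by (rule homotopic_with_compose_continuous_map_left[OF _ continuous_map_the_point])
         (auto simp: pathstart_def pathfinish_def)
    then show ?thesis unfolding null_homotopic_def o_def tr_def by auto
  qed
  with adm show ?thesis by (rule that)
qed

text \<open>A fixed group type is enough to detect noncontractibility, so the labeling can be
  quantified inside the logic. To establish noncontractibility, any other group will do as well
  (\<open>noncontractibleI\<close>); intersection numbers, for instance, are integers.\<close>

theorem null_homotopic_iff_holonomy:
  assumes "is_loop m p"
  shows "null_homotopic m (trace m p) \<longleftrightarrow>
    (\<forall>\<phi> :: 'a \<Rightarrow> (real \<Rightarrow> 'a point set located) set aut. admissible m \<phi> \<longrightarrow> holonomy m \<phi> p = 0)"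
proof -
  obtain \<phi> :: "'a \<Rightarrow> (real \<Rightarrow> 'a point set located) set aut" where "admissible m \<phi>"
    "\<And>p. is_loop m p \<Longrightarrow> holonomy m \<phi> p = 0 \<Longrightarrow> null_homotopic m (trace m p)"
    by (rule trivial_holonomy_imp_null_homotopic) (rule that)
  then show ?thesis using assms loop_holonomy_0 by blast
qed

end

section \<open>Holonomy and combinatorics of paths and loops\<close>

type_synonym 'a holonomy_group = "(real \<Rightarrow> 'a point set located) set aut"

lemma (in rooted_map) noncontractible_iff:
  assumes "is_loop m p"
  shows "noncontractible m p \<longleftrightarrow>
    (\<exists>\<phi> :: 'a \<Rightarrow> 'a holonomy_group. admissible m \<phi> \<and> holonomy m \<phi> p \<noteq> 0)"
  using null_homotopic_iff_holonomy[OF assms] by (auto simp: noncontractible_def)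

lemma (in rooted_map) noncontractibleI:
  fixes \<phi> :: "'a \<Rightarrow> 'g::group_add"
  assumes "is_loop m p" "admissible m \<phi>" "holonomy m \<phi> p \<noteq> 0"
  shows "noncontractible m p"
  using loop_holonomy_0[OF assms(2,1)] assms(3) by (auto simp: noncontractible_def)

lemma (in rooted_map) holonomy_rev:
  assumes "admissible m \<phi>" "set p \<subseteq> darts m"
  shows "holonomy m \<phi> (map (rev m) (List.rev p)) = - holonomy m \<phi> p"
  using assms(2)
proof (induction p)
  case (Cons d p)
  then show ?case using assms(1) by (simp add: admissible_def minus_add)
qed simp

text \<open>The two sums are conjugate. Consequently the starting point of a loop has no influence
  on whether its holonomy vanishes.\<close>

lemma add_eq_0_commute: "a + b = 0 \<longleftrightarrow> b + a = (0 :: 'g::group_add)"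
  by (simp only: eq_neg_iff_add_eq_0[symmetric]) (rule equation_minus_iff)

lemma path_from_darts: "path_from m v p \<Longrightarrow> set p \<subseteq> darts m"
  by (induction m v p rule: path_from.induct) auto

lemma visited_simps [simp]:
  "visited m v [] = [v]"
  "visited m v (e # p) = v # visited m (head m e) p"
  by (simp_all add: visited_def)

lemma visited_neq_Nil [simp]: "visited m v p \<noteq> []"
  by (simp add: visited_def)

lemma last_visited: "last (visited m v p) = (if p = [] then v else head m (last p))"
  by (simp add: visited_def last_map)

lemma visited_eq_tails:
  "path_from m v p \<Longrightarrow> visited m v p = map (tail m) p @ [if p = [] then v else head m (last p)]"
  by (induction m v p rule: path_from.induct) auto

lemma is_loop_iff: "is_loop m p \<longleftrightarrow> p \<noteq> [] \<and> path_from m (tail m (hd p)) p \<and> head m (last p) = tail m (hd p)"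
  by (simp add: is_loop_def origin_def)

lemma path_from_butlast: "path_from m v p \<Longrightarrow> path_from m v (butlast p)"
  by (induction m v p rule: path_from.induct) auto

lemma simple_loop_iff:
  "simple_loop m p \<longleftrightarrow> is_loop m p \<and> distinct (map (tail m) p)"
proof -
  have "visited m (origin m p) (butlast p) = map (tail m) p" if loop: "is_loop m p"
  proof -
    have "visited m (origin m p) (butlast p) = butlast (visited m (origin m p) p)"
      using loop by (simp add: visited_def map_butlast is_loop_def)
    also have "\<dots> = map (tail m) p"
      using visited_eq_tails[of m "origin m p" p] loop by (metis butlast_snoc is_loop_def)
    finally show ?thesis .
  qed
  then show ?thesis
    using path_from_butlast unfolding simple_loop_def simple_path_def by (auto simp: is_loop_def)
qed

section \<open>Lassos\<close>

text \<open>The lasso as one path \<open>w\<close> with the index \<open>k\<close> at which its loop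
  begins. Distinctness of all tails says at once that the stem and the loop are simple and that they
  meet only where the loop begins.\<close>

definition lasso_at :: "'a rmap \<Rightarrow> 'a list \<Rightarrow> nat \<Rightarrow> bool" where
  "lasso_at m w k \<longleftrightarrow> k < length w \<and> path_from m (root_vertex m) w \<and> distinct (map (tail m) w) \<and>
     head m (last w) = tail m (w ! k) \<and> noncontractible m (drop k w)"

lemma lasso_iff: "lasso m p q \<longleftrightarrow> q \<noteq> [] \<and> lasso_at m (p @ q) (length p)"
proof (cases "q = []")
  case True
  then show ?thesis by (simp add: lasso_def simple_loop_iff is_loop_def)
next
  case False
  let ?v = "if p = [] then root_vertex m else head m (last p)"
  have hd: "path_from m v q \<Longrightarrow> tail m (hd q) = v" for v using False by (cases q) auto
  have nth: "(p @ q) ! length p = hd q" using False by (simp add: nth_append hd_conv_nth)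
  have vq: "set (visited m (origin m q) q) = tail m ` set q" if "is_loop m q"
  proof -
    have "set (visited m (origin m q) q) = insert (tail m (hd q)) (tail m ` set q)"
      using that visited_eq_tails[of m "origin m q" q] by (simp add: is_loop_def last_visited origin_def)
    then show ?thesis using False by auto
  qed
  have vp: "visited m (root_vertex m) p = map (tail m) p @ [?v]" if "path_from m (root_vertex m) p"
    using visited_eq_tails[OF that] .
  show ?thesis
  proof
    assume l: "lasso m p q"
    then have *: "path_from m (root_vertex m) p" "distinct (visited m (root_vertex m) p)" "is_loop m q"
      "distinct (map (tail m) q)" "noncontractible m q" "?v = tail m (hd q)"
      "set (visited m (root_vertex m) p) \<inter> set (visited m (origin m q) q) = {tail m (hd q)}"
      by (simp_all add: lasso_def simple_path_def simple_loop_iff origin_def last_visited)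
    have "x \<notin> tail m ` set q" if "x \<in> tail m ` set p" for x
    proof
      assume "x \<in> tail m ` set q"
      moreover have "x \<in> set (visited m (root_vertex m) p)" using vp[OF *(1)] that by simp
      ultimately have "x = ?v" using *(6,7) vq[OF *(3)] by blast
      moreover have "distinct (map (tail m) p @ [?v])" using *(2) unfolding vp[OF *(1)] .
      then have "?v \<notin> tail m ` set p" by auto
      ultimately show False using that by simp
    qed
    then have "tail m ` set p \<inter> tail m ` set q = {}" by blast
    then show "q \<noteq> [] \<and> lasso_at m (p @ q) (length p)"
      using * False vp[OF *(1)] nth by (auto simp: lasso_at_def path_from_append is_loop_iff last_visited)
  next
    assume "q \<noteq> [] \<and> lasso_at m (p @ q) (length p)"
    then have *: "path_from m (root_vertex m) p" "path_from m ?v q" "distinct (map (tail m) p)"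
      "distinct (map (tail m) q)" "tail m ` set p \<inter> tail m ` set q = {}" "head m (last q) = tail m (hd q)"
      "noncontractible m q"
      using nth by (auto simp: lasso_at_def path_from_append last_visited)
    then have v: "?v = tail m (hd q)" using hd by metis
    have loop: "is_loop m q" using * v False by (simp add: is_loop_iff)
    have "tail m (hd q) \<in> tail m ` set q" using False by simp
    then show "lasso m p q"
      using * v loop vp[OF *(1)] vq[OF loop] by (auto simp: lasso_def simple_path_def simple_loop_iff origin_def last_visited)
  qed
qed

lemma lassos_iff: "w \<in> lassos m \<longleftrightarrow> (\<exists>k. lasso_at m w k)"
proof
  assume "\<exists>k. lasso_at m w k"
  then obtain k where k: "lasso_at m w k" by blast
  then have "k < length w" by (simp add: lasso_at_def)
  then have "lasso m (take k w) (drop k w)" using k by (simp add: lasso_iff min_def)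
  then show "w \<in> lassos m" unfolding lassos_def by (metis (mono_tags, lifting) append_take_drop_id mem_Collect_eq)
qed (auto simp: lassos_def lasso_iff)

lemma lasso_at_unique: "lasso_at m w k \<Longrightarrow> lasso_at m w k' \<Longrightarrow> k = k'"
  using nth_eq_iff_index_eq[of "map (tail m) w" k k'] by (auto simp: lasso_at_def)

text \<open>
  With \<open>f = rot m\<close>, these are the half-edges met counterclockwise from an element of \<open>A\<close> on, up to the
  next element of \<open>T\<close>.
\<close>

inductive_set sector :: "('a \<Rightarrow> 'a) \<Rightarrow> 'a set \<Rightarrow> 'a set \<Rightarrow> 'a set" for f A T where
  base: "a \<in> A \<Longrightarrow> a \<in> sector f A T"
| step: "d \<in> sector f A T \<Longrightarrow> f d \<notin> T \<Longrightarrow> f d \<in> sector f A T"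

lemma sector_step_iff:
  assumes "inj f" "A \<subseteq> T" "f d \<notin> T"
  shows "f d \<in> sector f A T \<longleftrightarrow> d \<in> sector f A T"
proof
  assume "f d \<in> sector f A T"
  then show "d \<in> sector f A T"
    by cases (use assms in \<open>auto dest: injD\<close>)
qed (use assms sector.step in metis)

lemma sector_Int_T:
  assumes "A \<subseteq> T"
  shows "sector f A T \<inter> T = A"
proof
  show "sector f A T \<inter> T \<subseteq> A"
  proof
    fix x assume x: "x \<in> sector f A T \<inter> T"
    then have "x \<in> sector f A T" by blast
    then show "x \<in> A" by cases (use x in auto)
  qed
qed (use assms sector.base in auto)

lemma sector_disjoint:
  assumes "inj f" "A \<subseteq> T" "B \<subseteq> T" "A \<inter> B = {}"
  shows "sector f A T \<inter> sector f B T = {}"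
proof -
  have "x \<notin> sector f B T" if "x \<in> sector f A T" for x
    using that
  proof induction
    case (base a)
    then show ?case using sector_Int_T[OF assms(3), of f] assms by blast
  next
    case (step d)
    then show ?case using sector_step_iff[OF assms(1,3)] by blast
  qed
  then show ?thesis by blast
qed

lemma sector_UN: "x \<in> sector f A T \<Longrightarrow> \<exists>a\<in>A. x \<in> sector f {a} T"
  by (induction rule: sector.induct) (auto intro: sector.intros)

lemma sector_mono:
  assumes "A \<subseteq> B"
  shows "sector f A T \<subseteq> sector f B T"
proof
  fix x assume "x \<in> sector f A T"
  then show "x \<in> sector f B T"
    by induction (use assms in \<open>auto intro: sector.intros\<close>)
qed

lemma sector_cong:
  assumes "\<And>d. f d \<notin> T \<longleftrightarrow> f' d \<notin> T" "\<And>d. f d \<notin> T \<Longrightarrow> f' d = f d"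
  shows "sector f' A T = sector f A T"
proof -
  have "x \<in> sector f' A T" if "x \<in> sector f A T" for x
    using that
  proof induction
    case (step d)
    then show ?case using sector.step[of d f' A T] assms by metis
  qed (rule sector.base)
  moreover have "x \<in> sector f A T" if "x \<in> sector f' A T" for x
    using that
  proof induction
    case (step d)
    then show ?case using sector.step[of d f A T] assms by metis
  qed (rule sector.base)
  ultimately show ?thesis by blast
qed

text \<open>Up to the first time at which the orbit of \<open>a\<close> reaches \<open>b\<close>,
  the set \<open>T\<close> is not met again: \<open>a\<close> cannot recur before, for otherwise
  \<open>b\<close> would have been reached earlier. So the element just before \<open>b\<close>
  still belongs to the sector of \<open>a\<close>.\<close>

lemma sector_last:
  assumes "inj f" and b: "b = (f ^^ N) a" "b \<noteq> a"
    and T: "\<And>n. (f ^^ n) a \<in> T \<Longrightarrow> (f ^^ n) a = a \<or> (f ^^ n) a = b" and d: "f d = b"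
  shows "d \<in> sector f {a} T"
proof -
  define n where "n = (LEAST n. (f ^^ n) a = b)"
  have n: "(f ^^ n) a = b" unfolding n_def by (rule LeastI[of _ N]) (use b in simp)
  have least: "(f ^^ j) a \<noteq> b" if "j < n" for j using not_less_Least that unfolding n_def by blast
  have "n \<noteq> 0" using n b(2) by (metis funpow_0)
  have "(f ^^ j) a \<in> sector f {a} T" if "j < n" for j
    using that
  proof (induction j)
    case (Suc j)
    have "(f ^^ Suc j) a \<noteq> a"
    proof
      assume *: "(f ^^ Suc j) a = a"
      have "(f ^^ (n - Suc j)) a = (f ^^ (n - Suc j)) ((f ^^ Suc j) a)" using * by simp
      also have "\<dots> = b" using Suc.prems n by (metis comp_apply funpow_add less_imp_le le_add_diff_inverse2)
      finally show False using least[of "n - Suc j"] \<open>n \<noteq> 0\<close> by simp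
    qed
    then have "(f ^^ Suc j) a \<notin> T" using T[of "Suc j"] least[OF Suc.prems] by blast
    then show ?case using Suc sector.step[of "(f ^^ j) a" f "{a}" T] by simp
  qed (auto intro: sector.base)
  then have "(f ^^ (n - 1)) a \<in> sector f {a} T" using \<open>n \<noteq> 0\<close> by simp
  moreover have "f d = f ((f ^^ (n - 1)) a)" using d n \<open>n \<noteq> 0\<close> by (metis Suc_diff_1 bot_nat_0.not_eq_extremum comp_apply funpow.simps(2))
  then have "d = (f ^^ (n - 1)) a" using \<open>inj f\<close> by (auto dest: injD)
  ultimately show ?thesis by simp
qed

text \<open>Connectedness as absence of proper invariant subsets, a form suited to comparing two
  maps on the same set of half-edges.\<close>

lemma connected_darts_iff:
  assumes "\<And>d. d \<in> darts m \<Longrightarrow> rev m d \<in> darts m" "\<And>d. d \<in> darts m \<Longrightarrow> rot m d \<in> darts m"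
  shows "connected_darts m \<longleftrightarrow>
    (\<forall>S\<subseteq>darts m. S \<noteq> {} \<longrightarrow> (\<forall>d\<in>S. rev m d \<in> S \<and> rot m d \<in> S) \<longrightarrow> S = darts m)"
proof -
  let ?R = "{(d, rev m d) |d. d \<in> darts m} \<union> {(d, rot m d) |d. d \<in> darts m}"
  show ?thesis
  proof (intro iffI allI impI)
    fix S assume c: "connected_darts m" and S: "S \<subseteq> darts m" "S \<noteq> {}" "\<forall>d\<in>S. rev m d \<in> S \<and> rot m d \<in> S"
    then obtain x where x: "x \<in> S" by blast
    have "y \<in> S" if "(x, y) \<in> ?R\<^sup>*" for y
      using that by (induction rule: rtrancl_induct) (use x S in auto)
    then show "S = darts m" using c S x unfolding connected_darts_def by blast
  next
    assume *: "\<forall>S\<subseteq>darts m. S \<noteq> {} \<longrightarrow> (\<forall>d\<in>S. rev m d \<in> S \<and> rot m d \<in> S) \<longrightarrow> S = darts m"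
    show "connected_darts m"
      unfolding connected_darts_def
    proof (intro ballI)
      fix x y assume x: "x \<in> darts m" "y \<in> darts m"
      let ?S = "{y \<in> darts m. (x, y) \<in> ?R\<^sup>*}"
      have "rev m d \<in> ?S \<and> rot m d \<in> ?S" if "d \<in> ?S" for d
        using that assms by (auto intro: rtrancl_into_rtrancl)
      then have "?S = darts m" using * x(1) by blast
      then show "(x, y) \<in> ?R\<^sup>*" using x(2) by blast
    qed
  qed
qed

section \<open>Cutting and regluing\<close>

text \<open>The second assumption excludes loops of the form \<open>[a, rev m a]\<close>, for which
  left and right copies would be the same half-edges. It holds for noncontractible loops, by
  \<open>noncontractible_disjoint\<close>.\<close>

locale cut = rooted_map m for m :: "'a rmap" +
  fixes \<gamma> :: "'a list" and \<epsilon> :: sign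
  assumes simple: "simple_loop m \<gamma>"
    and disjoint: "set \<gamma> \<inter> rev m ` set \<gamma> = {}"
begin

abbreviation "k \<equiv> length \<gamma>"

definition nx :: "nat \<Rightarrow> nat" where "nx i = Suc i mod k"
text \<open>The index of the left copy that is glued to the \<open>i\<close>-th right copy in a
  rotation of sign \<open>e\<close>.\<close>

definition sh :: "sign \<Rightarrow> nat \<Rightarrow> nat" where
  "sh e i = (case e of Plus \<Rightarrow> Suc i mod k | Minus \<Rightarrow> (i + (k - 1)) mod k)"

definition T :: "'a set" where "T = set \<gamma> \<union> rev m ` set \<gamma>"
definition m' :: "'a rmap" where "m' = m\<lparr>rev := reglue m \<gamma> \<epsilon>\<rparr>"
text \<open>The image loop, listed in the order of the right copies: its \<open>i\<close>-th
  half-edge is the one whose reverse is the reverse of the old \<open>\<gamma> ! i\<close>.\<close>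

definition \<gamma>' :: "'a list" where "\<gamma>' = shift \<epsilon> \<gamma>"
text \<open>Read as corners, these are the corners to the left of \<gamma>. Read as half-edges, they
  go from \<open>\<gamma> ! nx i\<close>, included, counterclockwise to
  \<open>rev m (\<gamma> ! i)\<close>, excluded. \<open>Left\<close> and \<open>Right\<close> share
  out all half-edges at the vertices of \<gamma>.\<close>

definition Left :: "'a set" where "Left = sector (rot m) (set \<gamma>) T"
definition Right :: "'a set" where "Right = sector (rot m) (rev m ` set \<gamma>) T"

lemma k: "k > 0"
  using simple by (simp add: simple_loop_iff is_loop_iff)

lemma nx_less [simp]: "nx i < k" and sh_less [simp]: "sh e i < k"
  using k by (simp_all add: nx_def sh_def split: sign.splits)

lemma sh_explicit:
  assumes "i < k"
  shows "sh Plus i = (if Suc i = k then 0 else Suc i)" "sh Minus i = (if i = 0 then k - 1 else i - 1)"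
proof -
  show "sh Plus i = (if Suc i = k then 0 else Suc i)" using assms by (simp add: sh_def)
  show "sh Minus i = (if i = 0 then k - 1 else i - 1)"
  proof (cases i)
    case (Suc j)
    then have "i + (k - 1) = j + k" using k by simp
    then have "(i + (k - 1)) mod k = j" using assms Suc by simp
    then show ?thesis using Suc by (simp add: sh_def)
  qed (use k in \<open>simp add: sh_def\<close>)
qed

lemma sh_sh [simp]: "i < k \<Longrightarrow> sh (opposite e) (sh e i) = i" "i < k \<Longrightarrow> sh e (sh (opposite e) i) = i"
  using sh_less[of Plus i] sh_less[of Minus i] by (cases e; auto simp: sh_explicit)+

lemma nx_eq_sh: "nx = sh Plus"
  by (simp add: nx_def sh_def fun_eq_iff)

lemma sh_nx: "i < k \<Longrightarrow> sh e (nx i) = nx (sh e i)"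
  unfolding nx_eq_sh using sh_sh[of i Plus] by (cases e) simp_all

lemma sh_inj: "i < k \<Longrightarrow> j < k \<Longrightarrow> sh e i = sh e j \<longleftrightarrow> i = j"
  by (metis sh_sh(1))

lemma nx_inj: "i < k \<Longrightarrow> j < k \<Longrightarrow> nx i = nx j \<longleftrightarrow> i = j"
  unfolding nx_eq_sh by (rule sh_inj)

lemma nx_surj: "j < k \<Longrightarrow> \<exists>i<k. nx i = j"
  unfolding nx_eq_sh by (metis opposite.simps(1) sh_less sh_sh(2))

lemma sh_surj: "j < k \<Longrightarrow> \<exists>i<k. sh e i = j"
  by (metis sh_less sh_sh(2))

lemma shift_nth: "i < k \<Longrightarrow> shift e \<gamma> ! i = \<gamma> ! sh e i" and length_shift [simp]: "length (shift e \<gamma>) = k"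
  and set_shift [simp]: "set (shift e \<gamma>) = set \<gamma>"
  by (cases e; simp add: nth_rotate nth_rotate1 sh_def add.commute)+

lemma \<gamma>_darts: "i < k \<Longrightarrow> \<gamma> ! i \<in> darts m" "set \<gamma> \<subseteq> darts m"
  using simple path_from_nth(1) path_from_darts unfolding simple_loop_iff is_loop_iff by metis+

lemma T_darts: "T \<subseteq> darts m"
  using \<gamma>_darts by (auto simp: T_def)

lemma tail_\<gamma>_inj: "i < k \<Longrightarrow> j < k \<Longrightarrow> tail m (\<gamma> ! i) = tail m (\<gamma> ! j) \<longleftrightarrow> i = j"
  using simple nth_eq_iff_index_eq[of "map (tail m) \<gamma>" i j] by (simp add: simple_loop_iff)

lemma \<gamma>_inj: "i < k \<Longrightarrow> j < k \<Longrightarrow> \<gamma> ! i = \<gamma> ! j \<longleftrightarrow> i = j"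
  using tail_\<gamma>_inj by metis

lemma tail_rev_\<gamma>: "i < k \<Longrightarrow> tail m (rev m (\<gamma> ! i)) = tail m (\<gamma> ! nx i)"
proof -
  assume i: "i < k"
  have loop: "path_from m (tail m (hd \<gamma>)) \<gamma>" "head m (last \<gamma>) = tail m (hd \<gamma>)"
    using simple by (auto simp: simple_loop_iff is_loop_iff)
  show ?thesis
  proof (cases "Suc i < k")
    case True
    then show ?thesis using path_from_nth(2)[OF loop(1) i] by (simp add: nx_def head_def)
  next
    case False
    then have "i = k - 1" "nx i = 0" using i by (simp_all add: nx_def le_Suc_eq not_less less_Suc_eq_le)
    then show ?thesis using loop(2) k by (simp add: head_def last_conv_nth hd_conv_nth)
  qed
qed

lemma tail_rev_\<gamma>_inj: "i < k \<Longrightarrow> j < k \<Longrightarrow> tail m (rev m (\<gamma> ! i)) = tail m (rev m (\<gamma> ! j)) \<longleftrightarrow> i = j"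
  by (simp add: tail_rev_\<gamma> tail_\<gamma>_inj nx_inj)

lemma rev_\<gamma>_inj: "i < k \<Longrightarrow> j < k \<Longrightarrow> rev m (\<gamma> ! i) = rev m (\<gamma> ! j) \<longleftrightarrow> i = j"
  using tail_rev_\<gamma>_inj by metis

lemma \<gamma>_neq_rev: "i < k \<Longrightarrow> j < k \<Longrightarrow> \<gamma> ! i \<noteq> rev m (\<gamma> ! j)"
  using disjoint by (metis disjoint_iff imageI nth_mem)

lemma set_\<gamma>: "d \<in> set \<gamma> \<longleftrightarrow> (\<exists>i<k. d = \<gamma> ! i)"
  by (auto simp: in_set_conv_nth)

lemma T_cases: "d \<in> T \<longleftrightarrow> (\<exists>i<k. d = \<gamma> ! i) \<or> (\<exists>i<k. d = rev m (\<gamma> ! i))"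
  by (auto simp: T_def image_iff Bex_def set_\<gamma>)

lemma rev_T: "d \<in> darts m \<Longrightarrow> rev m d \<in> T \<longleftrightarrow> d \<in> T"
  unfolding T_def using \<gamma>_darts(2) rev_rev by (auto; metis image_eqI rev_rev subsetD)

lemma inj_rot: "inj (rot m)"
  using permutes_inj[OF rot_permutes] .

lemma subT: "set \<gamma> \<subseteq> T" "rev m ` set \<gamma> \<subseteq> T"
  by (auto simp: T_def)

lemma Left_step: "rot m d \<notin> T \<Longrightarrow> rot m d \<in> Left \<longleftrightarrow> d \<in> Left"
  unfolding Left_def by (rule sector_step_iff[OF inj_rot subT(1)])

lemma Right_step: "rot m d \<notin> T \<Longrightarrow> rot m d \<in> Right \<longleftrightarrow> d \<in> Right"
  unfolding Right_def by (rule sector_step_iff[OF inj_rot subT(2)])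

lemma Left_Right: "d \<in> Right \<Longrightarrow> d \<notin> Left"
  using sector_disjoint[OF inj_rot subT disjoint] unfolding Left_def Right_def by blast

lemma \<gamma>_Left: "i < k \<Longrightarrow> \<gamma> ! i \<in> Left" "set \<gamma> \<subseteq> Left"
  unfolding Left_def by (auto intro: sector.base)

lemma rev_\<gamma>_Right: "i < k \<Longrightarrow> rev m (\<gamma> ! i) \<in> Right" "i < k \<Longrightarrow> rev m (\<gamma> ! i) \<notin> Left"
proof -
  assume "i < k"
  then show "rev m (\<gamma> ! i) \<in> Right" unfolding Right_def by (auto intro: sector.base)
  then show "rev m (\<gamma> ! i) \<notin> Left" by (rule Left_Right)
qed

lemma T_vertex:
  assumes "x \<in> T" "tail m x = tail m (\<gamma> ! nx i)" "i < k"
  shows "x = \<gamma> ! nx i \<or> x = rev m (\<gamma> ! i)"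
  using assms by (auto simp: T_cases tail_\<gamma>_inj tail_rev_\<gamma> nx_inj)

lemma funpow_tail: "tail m ((rot m ^^ n) d) = tail m d"
  by (induction n) auto

text \<open>At a vertex of \<gamma> exactly two half-edges belong to \<open>T\<close>, so each of
  the two sectors extends up to the half-edge that opens the other.\<close>

lemma before_rev_\<gamma>: "i < k \<Longrightarrow> rot m d = rev m (\<gamma> ! i) \<Longrightarrow> d \<in> sector (rot m) {\<gamma> ! nx i} T"
  and before_\<gamma>: "i < k \<Longrightarrow> rot m d = \<gamma> ! nx i \<Longrightarrow> d \<in> sector (rot m) {rev m (\<gamma> ! i)} T"
proof -
  assume i: "i < k"
  let ?a = "\<gamma> ! nx i" and ?b = "rev m (\<gamma> ! i)"
  have t: "tail m ?b = tail m ?a" using tail_rev_\<gamma>[OF i] .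
  have ne: "?a \<noteq> ?b" using \<gamma>_neq_rev i by simp
  obtain N where N: "?b = (rot m ^^ N) ?a" using t tail_eq_iff in_tail_iff by metis
  obtain M where M: "?a = (rot m ^^ M) ?b" using t tail_eq_iff in_tail_iff by metis
  have T: "x = ?a \<or> x = ?b" if "x \<in> T" "tail m x = tail m ?a" for x
    using T_vertex[OF that i] .
  have ta: "tail m ((rot m ^^ n) ?a) = tail m ?a" and tb: "tail m ((rot m ^^ n) ?b) = tail m ?a" for n
    by (simp_all only: funpow_tail t)
  show "d \<in> sector (rot m) {?a} T" if "rot m d = ?b"
    by (rule sector_last[OF inj_rot N ne[symmetric] T[OF _ ta] that])
  show "d \<in> sector (rot m) {?b} T" if "rot m d = ?a"
    by (rule sector_last[OF inj_rot M ne _ that]) (use T[OF _ tb] in blast)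
qed

lemma before_rev_\<gamma>_Left: "i < k \<Longrightarrow> rot m d = rev m (\<gamma> ! i) \<Longrightarrow> d \<in> Left"
  using before_rev_\<gamma> sector_mono[of "{\<gamma> ! nx i}" "set \<gamma>"] nth_mem[OF nx_less] unfolding Left_def by blast

lemma before_\<gamma>_Right: "i < k \<Longrightarrow> rot m d = \<gamma> ! i \<Longrightarrow> d \<in> Right" "i < k \<Longrightarrow> rot m d = \<gamma> ! i \<Longrightarrow> d \<notin> Left"
proof -
  assume i: "i < k" "rot m d = \<gamma> ! i"
  obtain j where j: "j < k" "nx j = i" using nx_surj i by blast
  then have "d \<in> sector (rot m) {rev m (\<gamma> ! j)} T" using before_\<gamma> i by metis
  then show "d \<in> Right" unfolding Right_def using sector_mono[of "{rev m (\<gamma> ! j)}" "rev m ` set \<gamma>"] j nth_mem by blast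
  then show "d \<notin> Left" by (rule Left_Right)
qed

lemma map_of_left_right:
  assumes "i < k"
  shows "map_of (zip (map (rev m) \<gamma>) (shift \<epsilon> \<gamma>) @ zip (shift \<epsilon> \<gamma>) (map (rev m) \<gamma>)) (rev m (\<gamma> ! i)) = Some (\<gamma> ! sh \<epsilon> i)"
    and "map_of (zip (map (rev m) \<gamma>) (shift \<epsilon> \<gamma>) @ zip (shift \<epsilon> \<gamma>) (map (rev m) \<gamma>)) (\<gamma> ! sh \<epsilon> i) = Some (rev m (\<gamma> ! i))"
proof -
  have d1: "distinct (map (rev m) \<gamma>)" by (auto simp: distinct_conv_nth rev_\<gamma>_inj)
  have d2: "distinct (shift \<epsilon> \<gamma>)" by (auto simp: distinct_conv_nth shift_nth \<gamma>_inj sh_inj)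
  have "map_of (zip (map (rev m) \<gamma>) (shift \<epsilon> \<gamma>)) (map (rev m) \<gamma> ! i) = Some (shift \<epsilon> \<gamma> ! i)"
    by (rule map_of_zip_nth) (use assms d1 in auto)
  moreover have "map_of (zip (shift \<epsilon> \<gamma>) (map (rev m) \<gamma>)) (rev m (\<gamma> ! i)) = None"
    using assms disjoint by (auto simp: map_of_zip_is_None)
  ultimately show "map_of (zip (map (rev m) \<gamma>) (shift \<epsilon> \<gamma>) @ zip (shift \<epsilon> \<gamma>) (map (rev m) \<gamma>)) (rev m (\<gamma> ! i)) = Some (\<gamma> ! sh \<epsilon> i)"
    using assms by (simp add: map_add_def shift_nth)
  have "map_of (zip (shift \<epsilon> \<gamma>) (map (rev m) \<gamma>)) (shift \<epsilon> \<gamma> ! i) = Some (map (rev m) \<gamma> ! i)"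
    by (rule map_of_zip_nth) (use assms d2 in auto)
  moreover have "map_of (zip (map (rev m) \<gamma>) (shift \<epsilon> \<gamma>)) (\<gamma> ! sh \<epsilon> i) = None"
  proof -
    have "\<gamma> ! sh \<epsilon> i \<in> set \<gamma>" by (rule nth_mem[OF sh_less])
    then have "\<gamma> ! sh \<epsilon> i \<notin> set (map (rev m) \<gamma>)" using disjoint unfolding set_map by blast
    then show ?thesis by (simp add: map_of_zip_is_None)
  qed
  ultimately show "map_of (zip (map (rev m) \<gamma>) (shift \<epsilon> \<gamma>) @ zip (shift \<epsilon> \<gamma>) (map (rev m) \<gamma>)) (\<gamma> ! sh \<epsilon> i) = Some (rev m (\<gamma> ! i))"
    using assms by (simp add: map_add_def shift_nth del: map_of_zip_is_None)
qed

lemma rev'_rev_\<gamma>: "i < k \<Longrightarrow> rev m' (rev m (\<gamma> ! i)) = \<gamma> ! sh \<epsilon> i"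
  and rev'_\<gamma>: "i < k \<Longrightarrow> rev m' (\<gamma> ! sh \<epsilon> i) = rev m (\<gamma> ! i)"
  using map_of_left_right[of i] by (simp_all add: m'_def reglue_def Let_def)

lemma rev'_other: "d \<notin> T \<Longrightarrow> rev m' d = rev m d"
proof -
  assume "d \<notin> T"
  then have "map_of (zip (map (rev m) \<gamma>) (shift \<epsilon> \<gamma>) @ zip (shift \<epsilon> \<gamma>) (map (rev m) \<gamma>)) d = None"
    by (auto simp: map_of_eq_None_iff T_def dest: set_zip_leftD)
  then show ?thesis by (simp add: m'_def reglue_def Let_def del: map_of_append)
qed

lemma m'_simps [simp]: "darts m' = darts m" "nxt m' = nxt m" "root m' = root m"
  by (simp_all add: m'_def)

lemma rev'_rev': "d \<in> darts m \<Longrightarrow> rev m' (rev m' d) = d" "d \<in> darts m \<Longrightarrow> rev m' d \<noteq> d"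
  "d \<in> darts m \<Longrightarrow> rev m' d \<in> darts m"
proof -
  assume d: "d \<in> darts m"
  have "rev m' (rev m' d) = d \<and> rev m' d \<noteq> d \<and> rev m' d \<in> darts m"
  proof (cases "d \<in> T")
    case True
    then consider i where "i < k" "d = \<gamma> ! sh \<epsilon> i" | i where "i < k" "d = rev m (\<gamma> ! i)"
      unfolding T_cases using sh_surj by metis
    then show ?thesis
    proof cases
      case 1
      then show ?thesis
        using \<gamma>_neq_rev[OF sh_less 1(1)] \<gamma>_darts(1)[OF 1(1)] by (simp add: rev'_\<gamma> rev'_rev_\<gamma> not_sym)
    next
      case 2
      then show ?thesis
        using \<gamma>_neq_rev[OF sh_less 2(1)] \<gamma>_darts(1)[OF sh_less] by (simp add: rev'_\<gamma> rev'_rev_\<gamma>)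
    qed
  next
    case False
    then show ?thesis using d rev_T rev_rev rev_neq by (simp add: rev'_other)
  qed
  then show "rev m' (rev m' d) = d" "rev m' d \<noteq> d" "rev m' d \<in> darts m" by auto
qed

lemma rev'_permutes: "rev m' permutes darts m"
proof (rule bij_imp_permutes)
  show "bij_betw (rev m') (darts m) (darts m)"
    by (rule bij_betw_byWitness[of _ "rev m'"]) (use rev'_rev' in auto)
  show "rev m' d = d" if "d \<notin> darts m" for d
    using that T_darts rev'_other[of d] permutes_not_in[OF rev_permutes] by auto
qed

text \<open>As \<open>nxt\<close> is unchanged, the new rotation is the old one followed by a
  correction, and this correction acts trivially off \<open>T\<close>.\<close>

lemma rot'_def: "rot m' d = rev m' (rev m (rot m d))" if "d \<in> darts m"
  using that by (simp add: rot_def rev_rev)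

lemma rot'_other: "rot m d \<notin> T \<Longrightarrow> rot m' d = rot m d"
proof (cases "d \<in> darts m")
  case True
  assume "rot m d \<notin> T"
  then show ?thesis using True rot'_def[OF True] rev'_other[of "rev m (rot m d)"] rev_T by (simp add: rev_rev)
next
  case False
  then have "inv (nxt m) d = d" using permutes_not_in[OF permutes_inv[OF nxt_permutes]] by blast
  then show ?thesis using False T_darts rev'_other[of d] by (auto simp: rot_def)
qed

text \<open>The rotation changes only where it passes from one sector to another: the right sector
  at the vertex of index \<open>i\<close> is now joined to the left sector at the vertex of index
  \<open>sh \<epsilon> i\<close>, at both of its ends.\<close>

lemma rot'_rev_\<gamma>: "i < k \<Longrightarrow> rot m d = rev m (\<gamma> ! sh \<epsilon> i) \<Longrightarrow> rot m' d = rev m (\<gamma> ! i)"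
  and rot'_\<gamma>: "i < k \<Longrightarrow> rot m d = \<gamma> ! i \<Longrightarrow> rot m' d = \<gamma> ! sh \<epsilon> i"
proof -
  assume i: "i < k"
  have d: "d \<in> darts m" if "rot m d = x" "x \<in> darts m" for x using that rot_in by metis
  show "rot m' d = rev m (\<gamma> ! i)" if "rot m d = rev m (\<gamma> ! sh \<epsilon> i)"
    using rot'_def[OF d[OF that]] that i \<gamma>_darts by (simp add: rev_rev rev'_\<gamma>)
  show "rot m' d = \<gamma> ! sh \<epsilon> i" if "rot m d = \<gamma> ! i"
    using rot'_def[OF d[OF that]] that i \<gamma>_darts by (simp add: rev'_rev_\<gamma>)
qed

lemma rot'_T: "rot m' d \<notin> T \<longleftrightarrow> rot m d \<notin> T"
proof (cases "rot m d \<in> T")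
  case True
  then consider i where "i < k" "rot m d = rev m (\<gamma> ! sh \<epsilon> i)" | i where "i < k" "rot m d = \<gamma> ! i"
    unfolding T_cases using sh_surj by metis
  then show ?thesis
    by cases (use True in \<open>auto simp: rot'_rev_\<gamma> rot'_\<gamma> T_def\<close>)
qed (simp add: rot'_other)

lemma rot'_darts: "d \<in> darts m \<Longrightarrow> rot m' d \<in> darts m"
  by (simp add: rot_def rev'_rev'(3))

text \<open>Inside a sector both rotations agree, so closure under the new one carries a set through
  the whole sector.\<close>

lemma sector_closed:
  assumes "d \<in> sector (rot m) {a} T" "a \<in> S" "\<And>x. x \<in> S \<Longrightarrow> rot m' x \<in> S"
  shows "d \<in> S"
  using assms(1) by induction (use assms(2,3) rot'_other in force)+

text \<open>Connectedness is the point. Let a set be closed under the new permutations. If it meets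
  \<open>T\<close>, then it contains \<open>T\<close>, because the left side of \<gamma> can still
  be followed backwards in the new map. Containing or avoiding \<open>T\<close>, it is closed under
  the old permutations as well, and connectedness of the old map applies.\<close>

lemma is_map_m': "is_map m'"
proof -
  have "S = darts m" if S: "S \<subseteq> darts m" "S \<noteq> {}" and cl: "\<And>d. d \<in> S \<Longrightarrow> rev m' d \<in> S" "\<And>d. d \<in> S \<Longrightarrow> rot m' d \<in> S" for S
  proof -
    \<comment> \<open>Turn through the left sector from \<open>\<gamma> ! nx i\<close> to its last
      element \<open>d\<close>; the new rotation followed by the new reversal then leads to
      \<open>\<gamma> ! i\<close>.\<close>
    have pred: "\<gamma> ! i \<in> S" if i: "i < k" and nxt: "\<gamma> ! nx i \<in> S" for i
    proof -
      obtain d where d: "rot m d = rev m (\<gamma> ! i)" using permutes_surj[OF rot_permutes] by (metis surjD)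
      obtain j where j: "j < k" "sh \<epsilon> j = i" using sh_surj[OF i, of \<epsilon>] by blast
      have "d \<in> S" using sector_closed[OF before_rev_\<gamma>[OF i d] nxt cl(2)] .
      then have "rev m' (rot m' d) \<in> S" using cl by blast
      then show "\<gamma> ! i \<in> S" using rot'_rev_\<gamma>[OF j(1), of d] rev'_rev_\<gamma>[OF j(1)] d j(2) by simp
    qed
    have TS: "T \<subseteq> S" if meets: "T \<inter> S \<noteq> {}"
    proof -
      obtain t where t: "t \<in> T" "t \<in> S" using meets by blast
      have "\<exists>i<k. \<gamma> ! i \<in> S"
      proof (cases "t \<in> set \<gamma>")
        case False
        then obtain j where "j < k" "t = rev m (\<gamma> ! j)" using t(1) unfolding T_cases set_\<gamma> by blast
        then have "\<gamma> ! sh \<epsilon> j \<in> S" using cl(1)[OF t(2)] rev'_rev_\<gamma> by simp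
        then show ?thesis using sh_less by blast
      qed (use t in \<open>auto simp: set_\<gamma>\<close>)
      then obtain i where i: "i < k" "\<gamma> ! i \<in> S" by blast
      have down: "\<gamma> ! j \<in> S" if "j \<le> i" "i < k" "\<gamma> ! i \<in> S" for i j
        using that(1)
      proof (induction rule: inc_induct)
        case (step n)
        then have "nx n = Suc n" using that(2) by (simp add: nx_def)
        then show ?case using pred[of n] step that(2) by simp
      qed (use that in simp)
      \<comment> \<open>Having descended to index 0, wrap around to the last index and descend
        again, which reaches the indices above \<open>i\<close>.\<close>
      have "nx (k - 1) = 0" using k by (simp add: nx_def)
      then have "\<gamma> ! (k - 1) \<in> S" using pred[of "k - 1"] down[OF _ i, of 0] k by simp
      then have \<gamma>: "\<gamma> ! j \<in> S" if "j < k" for j using down[of j "k - 1"] that k by simp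
      moreover have "rev m (\<gamma> ! j) \<in> S" if "j < k" for j
        using cl(1)[OF \<gamma>[OF sh_less]] rev'_\<gamma>[OF that] by metis
      ultimately show "T \<subseteq> S" unfolding T_cases subset_iff by blast
    qed
    have "rev m d \<in> S \<and> rot m d \<in> S" if d: "d \<in> S" for d
    proof (cases "T \<inter> S = {}")
      case True
      then have "d \<notin> T" using d by blast
      moreover have "rot m d \<notin> T" using rot'_T cl(2)[OF d] True by blast
      ultimately show ?thesis using cl[OF d] rev'_other rot'_other by simp
    next
      case False
      have dm: "d \<in> darts m" using d S by blast
      have "rev m d \<in> S" using TS[OF False] cl(1)[OF d] rev'_other rev_T[OF dm] by (metis subsetD)
      moreover have "rot m d \<in> S" using TS[OF False] cl(2)[OF d] rot'_other by (metis subsetD)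
      ultimately show ?thesis ..
    qed
    then show "S = darts m"
      using connected connected_darts_iff[of m] S by simp
  qed
  then have "connected_darts m'"
    using connected_darts_iff[of m'] rev'_rev'(3) rot'_darts by simp
  then show ?thesis
    using finite_darts root_in nxt_permutes rev'_permutes rev'_rev' by (simp add: is_map_def)
qed

end

lemma path_fromI:
  assumes "\<And>i. i < length p \<Longrightarrow> p ! i \<in> darts m" "\<And>i. Suc i < length p \<Longrightarrow> head m (p ! i) = tail m (p ! Suc i)"
    and "p \<noteq> [] \<Longrightarrow> tail m (hd p) = v"
  shows "path_from m v p"
  using assms
proof (induction p arbitrary: v)
  case (Cons d p)
  have 1: "d \<in> darts m" using Cons.prems(1)[of 0] by simp
  have "path_from m (head m d) p"
  proof (rule Cons.IH)
    show "p ! i \<in> darts m" if "i < length p" for i using Cons.prems(1)[of "Suc i"] that by simp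
    show "head m (p ! i) = tail m (p ! Suc i)" if "Suc i < length p" for i using Cons.prems(2)[of "Suc i"] that by simp
    show "tail m (hd p) = head m d" if "p \<noteq> []" using Cons.prems(2)[of 0] that by (cases p) auto
  qed
  then show ?case using 1 Cons.prems(3) by simp
qed simp

section \<open>Vertices of the new map\<close>

context cut
begin

interpretation m': rooted_map m'
  by unfold_locales (rule is_map_m')

lemma sector_tails:
  assumes "d \<in> sector (rot m) {a} T"
  shows "tail m d = tail m a" "tail m' d = tail m' a"
proof -
  have "tail m d = tail m a \<and> tail m' d = tail m' a"
    using assms
  proof induction
    case (step d)
    then show ?case using m'.tail_rot[of d] rot'_other[OF step(2)] by simp
  qed simp
  then show "tail m d = tail m a" "tail m' d = tail m' a" by auto
qed

lemma Left_tails: "d \<in> Left \<Longrightarrow> \<exists>i<k. tail m d = tail m (\<gamma> ! i) \<and> tail m' d = tail m' (\<gamma> ! i)"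
proof -
  assume "d \<in> Left"
  then obtain a where "a \<in> set \<gamma>" "d \<in> sector (rot m) {a} T"
    unfolding Left_def using sector_UN by meson
  moreover from this(1) obtain i where "i < k" "a = \<gamma> ! i" by (metis in_set_conv_nth)
  ultimately show ?thesis using sector_tails[of d a] by auto
qed

lemma Right_tails:
  "d \<in> Right \<Longrightarrow> \<exists>i<k. tail m d = tail m (rev m (\<gamma> ! i)) \<and> tail m' d = tail m' (rev m (\<gamma> ! i))"
proof -
  assume "d \<in> Right"
  then obtain a where "a \<in> rev m ` set \<gamma>" "d \<in> sector (rot m) {a} T"
    unfolding Right_def using sector_UN by meson
  moreover from this(1) obtain i where "i < k" "a = rev m (\<gamma> ! i)" by (metis imageE in_set_conv_nth)
  ultimately show ?thesis using sector_tails[of d a] by auto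
qed

lemma T_sub: "T \<subseteq> Left \<union> Right"
  unfolding T_def using \<gamma>_Left(2) rev_\<gamma>_Right(1) by (auto simp: set_\<gamma>)

lemma Left_or_Right:
  assumes "tail m d \<inter> T \<noteq> {}"
  shows "d \<in> Left \<or> d \<in> Right"
proof -
  obtain t where t: "t \<in> tail m d" "t \<in> T" using assms by blast
  have "tail m t = tail m d" using t(1) tail_eq_iff by metis
  then obtain n where n: "d = (rot m ^^ n) t" using in_tail_iff tail_self by metis
  have "(rot m ^^ n) t \<in> Left \<or> (rot m ^^ n) t \<in> Right" for n
  proof (induction n)
    case 0
    then show ?case using t(2) T_sub by auto
  next
    case (Suc n)
    then show ?case
      using Left_step[of "(rot m ^^ n) t"] Right_step[of "(rot m ^^ n) t"] T_sub
      by (cases "rot m ((rot m ^^ n) t) \<in> T") auto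
  qed
  then show ?thesis using n by blast
qed

lemma tail_off:
  assumes "tail m d \<inter> T = {}"
  shows "tail m' d = tail m d"
proof -
  have "(rot m' ^^ n) d = (rot m ^^ n) d" for n
  proof (induction n)
    case (Suc n)
    have "(rot m ^^ Suc n) d \<in> tail m d" using in_tail_iff by blast
    then have "rot m ((rot m ^^ n) d) \<notin> T" using assms by auto
    then show ?case using Suc rot'_other by simp
  qed simp
  then show ?thesis using in_tail_iff[of _ d] m'.in_tail_iff[of _ d] by (simp add: set_eq_iff)
qed

text \<open>A vertex which avoids \<open>T\<close> is unchanged, and at a vertex of \<gamma> the
  right sector stays whole.\<close>

lemma tail_imp_tail':
  assumes "d \<notin> Left" "d' \<notin> Left" "tail m d = tail m d'"
  shows "tail m' d = tail m' d'"
proof (cases "tail m d \<inter> T = {}")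
  case True
  then show ?thesis using tail_off[of d] tail_off[of d'] assms(3) by simp
next
  case False
  then have "d \<in> Right" "d' \<in> Right" using Left_or_Right assms by metis+
  then obtain i j where "i < k" "tail m d = tail m (rev m (\<gamma> ! i))" "tail m' d = tail m' (rev m (\<gamma> ! i))"
    and "j < k" "tail m d' = tail m (rev m (\<gamma> ! j))" "tail m' d' = tail m' (rev m (\<gamma> ! j))"
    using Right_tails by meson
  then show ?thesis using assms(3) tail_rev_\<gamma>_inj by metis
qed

text \<open>
  The vertex of the new map containing \<open>d\<close>, encoded by the vertex of the old map whose right part
  it contains.
\<close>

definition right_vertex :: "'a \<Rightarrow> 'a set \<Rightarrow> bool" where
  "right_vertex d v \<longleftrightarrow> (d \<notin> Left \<and> v = tail m d) \<or>
     (d \<in> Left \<and> (\<exists>i<k. tail m d = tail m (\<gamma> ! sh \<epsilon> i) \<and> v = tail m (\<gamma> ! i)))"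

lemma right_vertex_rot':
  assumes J: "right_vertex d v"
  shows "right_vertex (rot m' d) v"
proof (cases "rot m d \<in> T")
  case False
  then show ?thesis using J Left_step[OF False] rot'_other[OF False] by (simp add: right_vertex_def)
next
  case True
  then consider i where "i < k" "rot m d = rev m (\<gamma> ! sh \<epsilon> i)" | i where "i < k" "rot m d = \<gamma> ! i"
    unfolding T_cases using sh_surj by metis
  then show ?thesis
  proof cases
    case 1
    have "d \<in> Left" by (rule before_rev_\<gamma>_Left[OF sh_less 1(2)])
    then obtain j where j: "j < k" "tail m d = tail m (\<gamma> ! sh \<epsilon> j)" "v = tail m (\<gamma> ! j)"
      using J by (auto simp: right_vertex_def)
    have "tail m d = tail m (\<gamma> ! nx (sh \<epsilon> i))"
      using tail_rot[of d] 1(2) tail_rev_\<gamma>[OF sh_less, of \<epsilon> i] by simp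
    then have "sh \<epsilon> j = sh \<epsilon> (nx i)" using j(2) tail_\<gamma>_inj[of "sh \<epsilon> j" "nx (sh \<epsilon> i)"] sh_nx[OF 1(1)] by simp
    then have "j = nx i" using sh_inj[OF j(1)] by simp
    then have "v = tail m (rev m (\<gamma> ! i))" using j(3) tail_rev_\<gamma>[OF 1(1)] by simp
    then show ?thesis
      using rot'_rev_\<gamma>[OF 1] rev_\<gamma>_Right(2)[OF 1(1)] by (simp add: right_vertex_def)
  next
    case 2
    have "d \<notin> Left" by (rule before_\<gamma>_Right(2)[OF 2])
    then have "v = tail m d" using J by (simp add: right_vertex_def)
    also have "\<dots> = tail m (\<gamma> ! i)" using tail_rot[of d] 2(2) by simp
    finally show ?thesis
      using rot'_\<gamma>[OF 2] \<gamma>_Left(1)[OF sh_less] 2(1) unfolding right_vertex_def by auto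
  qed
qed

text \<open>The relation \<open>right_vertex\<close> is preserved by the new rotation, and off
  \<open>Left\<close> it determines the old vertex.\<close>

lemma tail'_imp_tail:
  assumes "d \<notin> Left" "d' \<notin> Left" "tail m' d = tail m' d'"
  shows "tail m d = tail m d'"
proof -
  obtain n where n: "d' = (rot m' ^^ n) d" using m'.tail_eq_iff m'.in_tail_iff assms(3) by metis
  have "right_vertex ((rot m' ^^ n) d) (tail m d)" for n
  proof (induction n)
    case 0
    then show ?case using assms(1) by (simp add: right_vertex_def)
  qed (simp add: right_vertex_rot')
  then show ?thesis using n assms(2) by (auto simp: right_vertex_def)
qed

lemma tail'_iff: "d \<notin> Left \<Longrightarrow> d' \<notin> Left \<Longrightarrow> tail m' d = tail m' d' \<longleftrightarrow> tail m d = tail m d'"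
  using tail'_imp_tail tail_imp_tail' by metis

lemma tail'_\<gamma>:
  assumes "i < k"
  shows "tail m' (\<gamma> ! sh \<epsilon> (nx i)) = tail m' (rev m (\<gamma> ! i))"
proof -
  obtain d where d: "rot m d = \<gamma> ! nx i" using permutes_surj[OF rot_permutes] by (metis surjD)
  have "tail m' d = tail m' (rev m (\<gamma> ! i))" by (rule sector_tails(2)[OF before_\<gamma>[OF assms d]])
  then show ?thesis using rot'_\<gamma>[OF nx_less d] m'.tail_rot[of d] by simp
qed

lemma \<gamma>'_nth: "i < k \<Longrightarrow> \<gamma>' ! i = \<gamma> ! sh \<epsilon> i" and length_\<gamma>' [simp]: "length \<gamma>' = k" and set_\<gamma>' [simp]: "set \<gamma>' = set \<gamma>"
  by (simp_all add: \<gamma>'_def shift_nth)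

lemma rev'_set: "rev m' ` set \<gamma> = rev m ` set \<gamma>"
proof -
  have "rev m' ` set \<gamma> = (\<lambda>i. rev m' (\<gamma> ! sh \<epsilon> i)) ` {..<k}"
    using sh_surj[of _ \<epsilon>] sh_less[of \<epsilon>] unfolding set_eq_iff image_iff Bex_def set_\<gamma> lessThan_iff by metis
  also have "\<dots> = (\<lambda>i. rev m (\<gamma> ! i)) ` {..<k}" by (intro image_cong) (auto simp: rev'_\<gamma>)
  also have "\<dots> = rev m ` set \<gamma>"
  proof -
    have "(!) \<gamma> ` {..<k} = set \<gamma>" by (simp add: lessThan_atLeast0 nth_image)
    then show ?thesis by (metis image_image)
  qed
  finally show ?thesis .
qed

text \<open>The vertices of the image loop contain the half-edges
  \<open>rev m (\<gamma> ! i)\<close>. These are not in \<open>Left\<close>, and so they lie at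
  distinct vertices of the new map just as in the old one.\<close>

lemma cut': "cut m' \<gamma>'"
proof
  have head: "head m' (\<gamma>' ! i) = tail m' (\<gamma>' ! nx i)" if "i < k" for i
    using that rev'_\<gamma> tail'_\<gamma> by (simp add: head_def \<gamma>'_nth)
  have ne: "\<gamma>' \<noteq> []" using k length_\<gamma>' by (metis less_irrefl list.size(3))
  have path: "path_from m' (tail m' (hd \<gamma>')) \<gamma>'"
  proof (rule path_fromI)
    show "\<gamma>' ! i \<in> darts m'" if "i < length \<gamma>'" for i
      using that \<gamma>_darts(1)[OF sh_less] by (simp add: \<gamma>'_nth)
    show "head m' (\<gamma>' ! i) = tail m' (\<gamma>' ! Suc i)" if "Suc i < length \<gamma>'" for i
      using head[of i] that by (simp add: nx_def)
  qed simp
  have "nx (k - 1) = 0" using k by (simp add: nx_def)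
  then have "head m' (last \<gamma>') = tail m' (hd \<gamma>')"
    using head[of "k - 1"] k ne by (simp add: last_conv_nth hd_conv_nth)
  moreover have "distinct (map (tail m') \<gamma>')"
    unfolding distinct_conv_nth
  proof (intro allI impI)
    fix i j assume "i < length (map (tail m') \<gamma>')" "j < length (map (tail m') \<gamma>')" "i \<noteq> j"
    then have ij: "i < k" "j < k" "i \<noteq> j" by simp_all
    obtain i' j' where i': "i' < k" "nx i' = i" and j': "j' < k" "nx j' = j" using nx_surj ij by meson
    have "tail m' (rev m (\<gamma> ! i')) \<noteq> tail m' (rev m (\<gamma> ! j'))"
      using tail'_iff[OF rev_\<gamma>_Right(2)[OF i'(1)] rev_\<gamma>_Right(2)[OF j'(1)]] tail_rev_\<gamma>_inj[OF i'(1) j'(1)] ij i' j' by auto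
    then show "map (tail m') \<gamma>' ! i \<noteq> map (tail m') \<gamma>' ! j"
      using tail'_\<gamma>[OF i'(1)] tail'_\<gamma>[OF j'(1)] i' j' ij by (simp add: \<gamma>'_nth)
  qed
  ultimately show "simple_loop m' \<gamma>'"
    using path ne by (simp add: simple_loop_iff is_loop_iff)
  show "set \<gamma>' \<inter> rev m' ` set \<gamma>' = {}" using disjoint by (simp add: rev'_set)
qed

section \<open>Rotating back, and transfer of paths between the two maps\<close>

interpretation c': cut m' \<gamma>' "opposite \<epsilon>" by (rule cut')

lemma c'_T: "c'.T = T"
  by (simp add: c'.T_def T_def rev'_set)

lemma c'_Left: "c'.Left = Left"
  unfolding c'.Left_def Left_def c'_T set_\<gamma>' by (rule sector_cong) (use rot'_T rot'_other in auto)

lemma c'_sh: "c'.sh e i = sh e i"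
  unfolding c'.sh_def sh_def length_\<gamma>' ..

lemma c'_m': "c'.m' = m"
proof -
  have "rev c'.m' d = rev m d" for d
  proof (cases "d \<in> T")
    case False
    then show ?thesis using c'.rev'_other[of d] c'_T rev'_other by simp
  next
    case True
    then consider i where "i < k" "d = \<gamma> ! i" | i where "i < k" "d = rev m (\<gamma> ! i)"
      unfolding T_cases by blast
    then show ?thesis
    proof cases
      case 1
      let ?j = "sh \<epsilon> i"
      have "\<gamma>' ! sh (opposite \<epsilon>) i = \<gamma> ! i" using 1 by (simp add: \<gamma>'_nth)
      then have "rev c'.m' (\<gamma> ! i) = rev m' (\<gamma>' ! i)" using c'.rev'_\<gamma>[of i] 1 by (simp add: c'_sh)
      then show ?thesis using 1 rev'_\<gamma> by (simp add: \<gamma>'_nth)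
    next
      case 2
      have "rev m' (\<gamma>' ! i) = rev m (\<gamma> ! i)" using rev'_\<gamma> 2 by (simp add: \<gamma>'_nth)
      then have "rev c'.m' (rev m (\<gamma> ! i)) = \<gamma>' ! sh (opposite \<epsilon>) i" using c'.rev'_rev_\<gamma>[of i] 2 by (simp add: c'_sh)
      then show ?thesis using 2 \<gamma>_darts(1) by (simp add: \<gamma>'_nth rev_rev)
    qed
  qed
  then have "rev c'.m' = rev m" by blast
  then have "m\<lparr>rev := rev c'.m'\<rparr> = m" by simp
  moreover have "m'\<lparr>rev := f\<rparr> = m\<lparr>rev := f\<rparr>" for f by (simp add: m'_def)
  then have "c'.m' = m\<lparr>rev := rev c'.m'\<rparr>" unfolding c'.m'_def by simp
  ultimately show ?thesis by simp
qed

text \<open>The half-edges available to a path which does not touch the left side of \<gamma>. Those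
  of \<gamma> are in \<open>Left\<close> by their name, but a path along \<gamma> can be thought of
  as running along the right copies.\<close>

definition right_dart :: "'a \<Rightarrow> bool" where
  "right_dart e \<longleftrightarrow> e \<in> set \<gamma> \<or> (e \<in> darts m \<and> e \<notin> Left \<and> rev m e \<notin> Left)"

text \<open>A half-edge of \<gamma> is followed through the rotation by its right copy, as expressed
  by \<open>rev m' (move e) = rev m e\<close>. Since it is named after its left copy, its name
  changes.\<close>

definition move :: "'a \<Rightarrow> 'a" where
  "move e = (if e \<in> set \<gamma> then rev m' (rev m e) else e)"

lemma move_\<gamma>: "i < k \<Longrightarrow> move (\<gamma> ! i) = \<gamma> ! sh \<epsilon> i"
  by (simp add: move_def rev'_rev_\<gamma>)

lemma map_move_\<gamma>: "map move \<gamma> = \<gamma>'"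
  by (intro nth_equalityI) (simp_all add: move_\<gamma> \<gamma>'_nth)

lemma right_dart_notin_T: "right_dart e \<Longrightarrow> e \<notin> set \<gamma> \<Longrightarrow> e \<notin> T"
  unfolding right_dart_def using \<gamma>_Left(2) rev_T[of e] rev_\<gamma>_Right(2) unfolding T_def
  by (auto simp: rev_rev set_\<gamma> subset_iff; metis \<gamma>_darts(1) rev_rev)

lemma right_dart_darts: "right_dart e \<Longrightarrow> e \<in> darts m"
  using \<gamma>_darts(2) by (auto simp: right_dart_def)

lemma right_dart_head:
  assumes "right_dart e"
  shows "rev m e \<notin> Left" "head m' (move e) = tail m' (rev m e)" "rev m' (move e) = rev m e"
proof -
  show 1: "rev m e \<notin> Left"
    using assms rev_\<gamma>_Right(2) unfolding right_dart_def set_\<gamma> by blast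
  show 2: "rev m' (move e) = rev m e"
  proof (cases "e \<in> set \<gamma>")
    case True
    then have "rev m e \<in> darts m" using \<gamma>_darts(2) by auto
    then show ?thesis using True rev'_rev'(1) by (simp add: move_def)
  next
    case False
    then show ?thesis using rev'_other[OF right_dart_notin_T[OF assms False]] by (simp add: move_def)
  qed
  show "head m' (move e) = tail m' (rev m e)" using 2 by (simp add: head_def)
qed

text \<open>For a half-edge of \<gamma>, the reverse of the preceding one represents the same vertex
  and is not in \<open>Left\<close>, so that \<open>tail'_iff\<close> becomes applicable.\<close>

lemma right_dart_tail:
  assumes "right_dart e"
  obtains t where "t \<notin> Left" "tail m t = tail m e" "tail m' t = tail m' (move e)"
proof (cases "e \<in> set \<gamma>")
  case True
  then obtain i where i: "i < k" "e = \<gamma> ! i" by (auto simp: set_\<gamma>)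
  then obtain j where j: "j < k" "nx j = i" using nx_surj by blast
  show ?thesis
    by (rule that[of "rev m (\<gamma> ! j)"])
       (use i j rev_\<gamma>_Right(2) tail_rev_\<gamma> tail'_\<gamma> in \<open>auto simp: move_\<gamma>\<close>)
next
  case False
  then show ?thesis using that[of e] assms by (simp add: right_dart_def move_def)
qed

lemma right_dart_tails_eq:
  "right_dart e \<Longrightarrow> right_dart e' \<Longrightarrow> tail m' (move e) = tail m' (move e') \<longleftrightarrow> tail m e = tail m e'"
  "x \<notin> Left \<Longrightarrow> right_dart e \<Longrightarrow> tail m' x = tail m' (move e) \<longleftrightarrow> tail m x = tail m e"
  "right_dart e \<Longrightarrow> right_dart e' \<Longrightarrow> head m' (move e) = tail m' (move e') \<longleftrightarrow> head m e = tail m e'"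
proof -
  show *: "tail m' x = tail m' (move e) \<longleftrightarrow> tail m x = tail m e" if x: "x \<notin> Left" and e: "right_dart e" for x e
  proof -
    obtain t where "t \<notin> Left" "tail m t = tail m e" "tail m' t = tail m' (move e)"
      using right_dart_tail[OF e] .
    then show ?thesis using tail'_iff[OF x] by metis
  qed
  show "tail m' (move e) = tail m' (move e') \<longleftrightarrow> tail m e = tail m e'" if e: "right_dart e" "right_dart e'"
  proof -
    obtain t where "t \<notin> Left" "tail m t = tail m e" "tail m' t = tail m' (move e)"
      using right_dart_tail[OF e(1)] .
    then show ?thesis using *[OF _ e(2), of t] by metis
  qed
  show "head m' (move e) = tail m' (move e') \<longleftrightarrow> head m e = tail m e'" if e: "right_dart e" "right_dart e'"
    using *[OF right_dart_head(1)[OF e(1)] e(2)] right_dart_head(2)[OF e(1)] by (simp add: head_def)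
qed

lemma path_from_move:
  assumes "x \<notin> Left" "list_all right_dart p"
  shows "path_from m' (tail m' x) (map move p) \<longleftrightarrow> path_from m (tail m x) p"
  using assms
proof (induction p arbitrary: x)
  case (Cons e p)
  then have e: "right_dart e" by simp
  have "move e \<in> darts m"
    using right_dart_darts[OF e] rev'_rev'(3) by (simp add: move_def)
  moreover have "path_from m' (head m' (move e)) (map move p) \<longleftrightarrow> path_from m (head m e) p"
    using Cons.IH[OF right_dart_head(1)[OF e]] Cons.prems right_dart_head(2)[OF e] by (simp add: head_def)
  moreover have "tail m' (move e) = tail m' x \<longleftrightarrow> tail m e = tail m x"
    using right_dart_tails_eq(2)[OF Cons.prems(1) e] by auto
  ultimately show ?case using right_dart_darts[OF e] by simp
qed simp

text \<open>
  A labeling of the new map becomes one of the old map after a change of gauge on the corners to the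
  left of \<open>\<gamma>\<close>, which compensates the displacement of the left copy of \<open>\<gamma>\<close>.
\<close>

lemma transport_labeling:
  fixes \<phi>' :: "'a \<Rightarrow> 'g::group_add"
  assumes adm: "admissible m' \<phi>'"
  obtains \<phi> :: "'a \<Rightarrow> 'g" where "admissible m \<phi>"
    "\<And>e. right_dart e \<Longrightarrow> - \<phi> e + \<phi> (nxt m e) = - \<phi>' (move e) + \<phi>' (nxt m (move e))"
proof -
  define a where "a d = - \<phi>' d + \<phi>' (nxt m d)" for d
  have a_rev: "a (rev m' d) = - a d" if "d \<in> darts m" for d
    using adm that by (simp add: admissible_def a_def)
  \<comment> \<open>The increment from the vertex of index \<open>sh \<epsilon> i\<close> on the
    left side to that of index \<open>i\<close>, along the edge of \<gamma> between them. The
    identity below then says that the gauge turns the increment along \<open>\<gamma> ! i\<close>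
    into that along \<open>\<gamma> ! sh \<epsilon> i\<close>, which is opposite to the increment
    along \<open>rev m (\<gamma> ! i)\<close>.\<close>
  define \<beta> where "\<beta> i = (case \<epsilon> of Plus \<Rightarrow> - a (\<gamma> ! i) | Minus \<Rightarrow> a (\<gamma> ! sh Minus i))" for i
  have \<beta>: "\<beta> i + a (\<gamma> ! i) - \<beta> (nx i) = a (\<gamma> ! sh \<epsilon> i)" if "i < k" for i
  proof (cases \<epsilon>)
    case Plus
    then show ?thesis by (simp add: \<beta>_def nx_eq_sh)
  next
    case Minus
    have "sh Minus (nx i) = i" using sh_sh(1)[OF that, of Plus] by (simp add: nx_eq_sh)
    then show ?thesis using Minus by (simp add: \<beta>_def add.assoc diff_conv_add_uminus del: add_uminus_conv_diff)
  qed
  define b where "b d = (if d \<in> Left then \<beta> (THE i. i < k \<and> tail m d = tail m (\<gamma> ! i)) else 0)" for d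
  have b_Left: "b d = \<beta> i" if "d \<in> Left" "i < k" "tail m d = tail m (\<gamma> ! i)" for d i
  proof -
    have "(THE i. i < k \<and> tail m d = tail m (\<gamma> ! i)) = i"
      by (rule the_equality) (use that tail_\<gamma>_inj in auto)
    then show ?thesis using that by (simp add: b_def)
  qed
  have b_const: "b c = b (rot m c)" if "rot m c \<notin> T" for c
    using Left_step[OF that] by (simp add: b_def)
  define \<phi> where "\<phi> d = \<phi>' d - b d" for d
  have hol: "- \<phi> d + \<phi> (nxt m d) = b d + a d - b (nxt m d)" for d
    by (simp add: \<phi>_def a_def minus_add add.assoc diff_conv_add_uminus del: add_uminus_conv_diff)
  have \<gamma>: "- \<phi> (\<gamma> ! i) + \<phi> (nxt m (\<gamma> ! i)) = a (\<gamma> ! sh \<epsilon> i)"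
    and rev\<gamma>: "- \<phi> (rev m (\<gamma> ! i)) + \<phi> (nxt m (rev m (\<gamma> ! i))) = - a (\<gamma> ! sh \<epsilon> i)" if i: "i < k" for i
  proof -
    have "b (\<gamma> ! i) = \<beta> i" using b_Left[OF \<gamma>_Left(1)[OF i] i] by simp
    moreover have "b (nxt m (\<gamma> ! i)) = \<beta> (nx i)"
      by (rule b_Left[OF before_rev_\<gamma>_Left[OF i rot_nxt] nx_less])
         (use tail_nxt[OF \<gamma>_darts(1)[OF i]] tail_rev_\<gamma>[OF i] in \<open>simp add: head_def\<close>)
    ultimately show "- \<phi> (\<gamma> ! i) + \<phi> (nxt m (\<gamma> ! i)) = a (\<gamma> ! sh \<epsilon> i)" using hol \<beta>[OF i] by simp
    have "b (rev m (\<gamma> ! i)) = 0" using rev_\<gamma>_Right(2)[OF i] by (simp add: b_def)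
    moreover have "rot m (nxt m (rev m (\<gamma> ! i))) = \<gamma> ! i" using rot_nxt rev_rev \<gamma>_darts(1)[OF i] by simp
    then have "b (nxt m (rev m (\<gamma> ! i))) = 0" using before_\<gamma>_Right(2)[OF i] by (simp add: b_def)
    moreover have "a (rev m (\<gamma> ! i)) = - a (\<gamma> ! sh \<epsilon> i)"
      using a_rev[OF \<gamma>_darts(1)[OF sh_less], of \<epsilon> i] rev'_\<gamma>[OF i] by simp
    ultimately show "- \<phi> (rev m (\<gamma> ! i)) + \<phi> (nxt m (rev m (\<gamma> ! i))) = - a (\<gamma> ! sh \<epsilon> i)" using hol by simp
  qed
  have adm\<phi>: "admissible m \<phi>"
    unfolding admissible_def
  proof
    fix d assume d: "d \<in> darts m"
    show "- \<phi> (rev m d) + \<phi> (nxt m (rev m d)) = - (- \<phi> d + \<phi> (nxt m d))"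
    proof (cases "d \<in> T")
      case True
      then consider i where "i < k" "d = \<gamma> ! i" | i where "i < k" "d = rev m (\<gamma> ! i)" unfolding T_cases by blast
      then show ?thesis by cases (use \<gamma> rev\<gamma> \<gamma>_darts in \<open>simp_all add: rev_rev\<close>)
    next
      case False
      have r: "rot m (nxt m (rev m d)) = d" using rot_nxt rev_rev d by simp
      have "b (nxt m (rev m d)) = b d" using b_const[of "nxt m (rev m d)"] r False by simp
      moreover have "b (nxt m d) = b (rev m d)" using b_const[of "nxt m d"] rot_nxt[of d] rev_T[OF d] False by simp
      moreover have "a (rev m d) = - a d" using a_rev[OF d] rev'_other[OF False] by simp
      ultimately show ?thesis unfolding hol
        by (simp add: minus_add add.assoc diff_conv_add_uminus del: add_uminus_conv_diff)
    qed
  qed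
  have "- \<phi> e + \<phi> (nxt m e) = - \<phi>' (move e) + \<phi>' (nxt m (move e))" if e: "right_dart e" for e
  proof (cases "e \<in> set \<gamma>")
    case True
    then obtain i where "i < k" "e = \<gamma> ! i" by (auto simp: set_\<gamma>)
    then show ?thesis using \<gamma> move_\<gamma> by (simp add: a_def)
  next
    case False
    have "e \<notin> T" by (rule right_dart_notin_T[OF e False])
    then have "nxt m e \<notin> Left" using Left_step[of "nxt m e"] rot_nxt[of e] rev_T right_dart_darts[OF e] right_dart_head(1)[OF e] by simp
    moreover have "e \<notin> Left" using e False by (simp add: right_dart_def)
    ultimately show ?thesis using hol[of e] False by (simp add: b_def a_def move_def)
  qed
  with adm\<phi> show ?thesis by (rule that)
qed

lemma noncontractible_move:
  assumes p: "list_all right_dart p" and loop: "is_loop m p" "is_loop m' (map move p)"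
    and nc: "noncontractible m' (map move p)"
  shows "noncontractible m p"
proof -
  obtain \<phi>' :: "'a \<Rightarrow> 'a holonomy_group" where \<phi>': "admissible m' \<phi>'" "holonomy m' \<phi>' (map move p) \<noteq> 0"
    using m'.noncontractible_iff[OF loop(2)] nc by blast
  obtain \<phi> where \<phi>: "admissible m \<phi>"
    "\<And>e. right_dart e \<Longrightarrow> - \<phi> e + \<phi> (nxt m e) = - \<phi>' (move e) + \<phi>' (nxt m (move e))"
    using transport_labeling[OF \<phi>'(1)] by blast
  have "holonomy m \<phi> p = holonomy m' \<phi>' (map move p)"
    using p by (induction p) (simp_all add: \<phi>(2))
  then show ?thesis using noncontractibleI[OF loop(1) \<phi>(1)] \<phi>'(2) by simp
qed

lemma lasso_at_move:
  assumes p: "list_all right_dart w" and root: "root m \<notin> Left" and l: "lasso_at m' (map move w) j"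
  shows "lasso_at m w j"
proof -
  have j: "j < length w" and path': "path_from m' (tail m' (root m)) (map move w)"
    and dist: "distinct (map (tail m') (map move w))"
    and closed: "head m' (move (last w)) = tail m' (move (w ! j))" and nc: "noncontractible m' (map move (drop j w))"
  proof -
    have "w \<noteq> []" using l by (auto simp: lasso_at_def)
    then show "head m' (move (last w)) = tail m' (move (w ! j))"
      using l by (simp add: lasso_at_def last_map)
  qed (use l in \<open>simp_all add: lasso_at_def root_vertex_def drop_map\<close>)
  have rd: "right_dart (w ! i)" if "i < length w" for i using p that by (simp add: list_all_length)
  have path: "path_from m (tail m (root m)) w" using path_from_move[OF root p] path' by simp
  have lst: "last w = w ! (length w - 1)" using j by (cases w) (auto simp: last_conv_nth)
  have closed': "head m (last w) = tail m (w ! j)"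
    using closed right_dart_tails_eq(3)[of "last w" "w ! j"] rd[OF j] rd[of "length w - 1"] lst j by auto
  have dist': "distinct (map (tail m) w)"
    using dist right_dart_tails_eq(1)[OF rd rd] unfolding distinct_conv_nth by auto
  have pd: "list_all right_dart (drop j w)" using rd by (auto simp: list_all_length)
  have sub: "path_from n (tail n (hd (drop j v))) (drop j v)" if "path_from n x v" "j < length v" for n :: "'a rmap" and v x
  proof -
    have "path_from n (last (visited n x (take j v))) (drop j v)"
      using that(1) path_from_append[of n x "take j v" "drop j v"] by simp
    moreover have "drop j v \<noteq> []" using that(2) by simp
    ultimately show ?thesis by (cases "drop j v") auto
  qed
  have "is_loop m (drop j w)"
    using sub[OF path j] closed' j by (simp add: is_loop_iff hd_drop_conv_nth last_drop)
  moreover have "is_loop m' (map move (drop j w))"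
    using sub[OF path'] closed j by (simp add: is_loop_iff hd_drop_conv_nth last_drop hd_map last_map drop_map)
  ultimately have "noncontractible m (drop j w)"
    using noncontractible_move[OF pd] nc by blast
  then show ?thesis using j path dist' closed' by (simp add: lasso_at_def root_vertex_def)
qed

end

context cut
begin

interpretation c': cut m' \<gamma>' "opposite \<epsilon>" by (rule cut')

lemma right_dart_move:
  assumes "right_dart e"
  shows "c'.right_dart (move e)" "c'.move (move e) = e"
proof -
  have "move e \<in> set \<gamma> \<longleftrightarrow> e \<in> set \<gamma>"
    unfolding set_\<gamma> using move_\<gamma> sh_less set_\<gamma> by (metis move_def)
  note mem = this
  show "c'.right_dart (move e)"
    using assms mem right_dart_head(3)[OF assms] right_dart_head(1)[OF assms]
    unfolding c'.right_dart_def right_dart_def c'_Left set_\<gamma>' m'_simps by (auto simp: move_def)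
  show "c'.move (move e) = e"
    using mem right_dart_head(3)[OF assms] rev_rev[OF right_dart_darts[OF assms]]
    unfolding c'.move_def set_\<gamma>' c'_m' by (auto simp: move_def)
qed

text \<open>The other direction comes from rotating back, which is a rotation with the same
  \<open>Left\<close> and with the inverse renaming.\<close>

lemma lasso_at_move_iff:
  assumes p: "list_all right_dart w" and root: "root m \<notin> Left"
  shows "lasso_at m' (map move w) j \<longleftrightarrow> lasso_at m w j"
proof
  assume "lasso_at m w j"
  moreover have "map c'.move (map move w) = w"
    using p right_dart_move(2) by (induction w) auto
  moreover have "list_all c'.right_dart (map move w)"
    using p right_dart_move(1) by (induction w) auto
  ultimately show "lasso_at m' (map move w) j"
    using c'.lasso_at_move[of "map move w" j] root unfolding c'_Left c'_m' by simp
qed (rule lasso_at_move[OF assms])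

end

section \<open>The greedy construction\<close>

text \<open>A certificate for the outcome of the greedy construction, which can be checked on a
  given path, in particular on the image of a path.\<close>

definition rightmost :: "'a rmap \<Rightarrow> 'a list \<Rightarrow> bool" where
  "rightmost m w \<longleftrightarrow> w \<in> lassos m \<and> (\<forall>i<length w. w ! i = next_dart m (take i w))"

definition turn :: "'a rmap \<Rightarrow> 'a list \<Rightarrow> nat \<Rightarrow> 'a" where
  "turn m p n = (rot m ^^ Suc n) (sweep_start m p)"

lemma next_dart_def': "next_dart m p = turn m p (LEAST n. extendable m (p @ [turn m p n]))"
  by (simp add: next_dart_def turn_def Let_def)

lemma turn_0: "turn m p 0 = rot m (sweep_start m p)" and turn_Suc: "turn m p (Suc n) = rot m (turn m p n)"
  by (simp_all add: turn_def)

text \<open>A lasso ends at the first vertex which it meets twice, so the greedy construction does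
  not stop before it is complete.\<close>

lemma lasso_take_notin_lassos:
  assumes w: "w \<in> lassos m" and i: "i < length w"
  shows "take i w \<notin> lassos m"
proof
  assume "take i w \<in> lassos m"
  then obtain j where j: "lasso_at m (take i w) j" using lassos_iff by blast
  obtain l where l: "lasso_at m w l" using w lassos_iff by blast
  have ji: "j < i" "head m (last (take i w)) = tail m (w ! j)"
    using j i by (auto simp: lasso_at_def)
  have "last (take i w) = w ! (i - 1)" using ji i by (cases i) (auto simp: take_Suc_conv_app_nth)
  then have "tail m (w ! i) = tail m (w ! j)"
    using path_from_nth(2)[of m "root_vertex m" w "i - 1"] l i ji by (simp add: lasso_at_def)
  then have "i = j"
    using nth_eq_iff_index_eq[of "map (tail m) w" i j] l i ji by (simp add: lasso_at_def)
  then show False using ji by simp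
qed

lemma length_rightmost_prefix [simp]: "length (rightmost_prefix m i) = i"
  by (induction i) auto

lemma take_rightmost_prefix: "i \<le> n \<Longrightarrow> take i (rightmost_prefix m n) = rightmost_prefix m i"
  by (induction n) (auto simp: le_Suc_eq)

lemma rightmost_lasso_eq:
  assumes "rightmost m w"
  shows "rightmost_lasso m = w"
proof -
  have pre: "rightmost_prefix m i = take i w" if "i \<le> length w" for i
    using that
  proof (induction i)
    case (Suc i)
    then show ?case using assms by (simp add: rightmost_def take_Suc_conv_app_nth)
  qed simp
  have "(LEAST i. rightmost_prefix m i \<in> lassos m) = length w"
  proof (rule Least_equality)
    show "rightmost_prefix m (length w) \<in> lassos m" using pre[of "length w"] assms by (simp add: rightmost_def)
    fix j assume j: "rightmost_prefix m j \<in> lassos m"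
    show "length w \<le> j"
    proof (rule ccontr)
      assume "\<not> length w \<le> j"
      then have "take j w \<in> lassos m" "j < length w" using pre[of j] j by auto
      then show False using lasso_take_notin_lassos[of w m j] assms by (simp add: rightmost_def)
    qed
  qed
  then show ?thesis using pre[of "length w"] by (simp add: rightmost_lasso_def)
qed

lemma rightmost_loop_eq:
  assumes "rightmost m w" "lasso_at m w j"
  shows "rightmost_loop m = drop j w"
  unfolding rightmost_loop_def rightmost_lasso_eq[OF assms(1)]
proof (rule the_equality)
  have "j < length w" using assms(2) by (simp add: lasso_at_def)
  then have "lasso m (take j w) (drop j w)" using assms(2) by (simp add: lasso_iff min_def)
  then show "\<exists>p. w = p @ drop j w \<and> lasso m p (drop j w)" by (metis append_take_drop_id)
  fix q assume "\<exists>p. w = p @ q \<and> lasso m p q"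
  then obtain p where p: "w = p @ q" "lasso m p q" by blast
  then have "lasso_at m w (length p)" by (simp add: lasso_iff)
  then have "length p = j" using lasso_at_unique assms(2) by metis
  then show "q = drop j w" using p by auto
qed

lemma rightmost_sweep:
  assumes "rightmost m w" "i < length w"
  obtains N where "turn m (take i w) N = w ! i" "\<And>n. n < N \<Longrightarrow> \<not> extendable m (take i w @ [turn m (take i w) n])"
proof -
  let ?P = "\<lambda>n. extendable m (take i w @ [turn m (take i w) n])"
  have "w ! i = next_dart m (take i w)" using assms by (simp add: rightmost_def)
  then have "turn m (take i w) (LEAST n. ?P n) = w ! i" by (simp add: next_dart_def')
  moreover have "\<not> ?P n" if "n < (LEAST n. ?P n)" for n using not_less_Least[OF that] .
  ultimately show ?thesis by (rule that)
qed

lemma next_dart_eqI: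
  assumes "extendable m (p @ [d])" "turn m p N = d" "\<And>n. n < N \<Longrightarrow> \<not> extendable m (p @ [turn m p n])"
  shows "next_dart m p = d"
proof -
  have "(LEAST n. extendable m (p @ [turn m p n])) = N"
    by (rule Least_equality) (use assms in \<open>auto simp: not_less[symmetric]\<close>)
  then show ?thesis using assms(2) by (simp add: next_dart_def')
qed

lemma extendable_take: "w \<in> lassos m \<Longrightarrow> i < length w \<Longrightarrow> extendable m (take i w @ [w ! i])"
  unfolding extendable_def by (metis append_take_drop_id take_Suc_conv_app_nth)

context rooted_map
begin

lemma tail_sweep_start:
  assumes "path_from m (root_vertex m) (p @ [d])"
  shows "tail m (sweep_start m p) = tail m d"
proof (cases "p = []")
  case True
  then show ?thesis using assms by (simp add: sweep_start_def root_vertex_def)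
next
  case False
  then show ?thesis using assms by (simp add: path_from_append last_visited sweep_start_def head_def)
qed

lemma turn_exists:
  assumes "path_from m (root_vertex m) (p @ [d])"
  shows "\<exists>n. turn m p n = d"
proof -
  have "d \<in> orbit (rot m) (sweep_start m p)"
    using tail_sweep_start[OF assms] tail_self[of d] by (simp add: tail_def)
  then obtain n where "0 < n" "d = (rot m ^^ n) (sweep_start m p)" unfolding orbit_altdef by blast
  then show ?thesis unfolding turn_def by (metis Suc_pred)
qed

lemma tail_turn: "tail m (turn m p n) = tail m (sweep_start m p)"
  by (induction n) (simp_all add: turn_0 turn_Suc)

lemma lasso_length:
  assumes "w \<in> lassos m"
  shows "length w \<le> card (darts m)"
proof -
  obtain j where "lasso_at m w j" using assms lassos_iff by blast
  then have "distinct w" "set w \<subseteq> darts m"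
    using path_from_darts by (auto simp: lasso_at_def distinct_map)
  then show ?thesis using card_mono[OF finite_darts] distinct_card by metis
qed

text \<open>As long as no lasso is reached the prefix stays extendable, and lassos have at most
  \<open>card (darts m)\<close> half-edges.\<close>

lemma rightmost_exists:
  assumes ne: "lassos m \<noteq> {}"
  shows "rightmost m (rightmost_lasso m)"
proof -
  let ?P = "rightmost_prefix m"
  have ext: "extendable m (?P i)" if "\<And>j. j < i \<Longrightarrow> ?P j \<notin> lassos m" for i
    using that
  proof (induction i)
    case 0
    then show ?case using ne by (auto simp: extendable_def)
  next
    case (Suc i)
    then obtain q where q: "?P i @ q \<in> lassos m" by (auto simp: extendable_def)
    then have "q \<noteq> []" using Suc.prems[of i] by auto
    then obtain d q' where dq: "q = d # q'" by (cases q) auto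
    have "path_from m (root_vertex m) ((?P i @ [d]) @ q')"
      using q dq by (auto simp: lassos_iff lasso_at_def)
    then have "path_from m (root_vertex m) (?P i @ [d])" unfolding path_from_append[of m _ "?P i @ [d]"] by blast
    then obtain n where n: "turn m (?P i) n = d" using turn_exists by blast
    have "extendable m (?P i @ [turn m (?P i) n])"
      unfolding extendable_def n using q dq by (intro exI[of _ q']) simp
    then have "extendable m (?P i @ [next_dart m (?P i)])"
      unfolding next_dart_def' by (rule LeastI)
    then show ?case by simp
  qed
  have "\<exists>i. ?P i \<in> lassos m"
  proof (rule ccontr)
    assume no: "\<not> ?thesis"
    let ?n = "Suc (card (darts m))"
    have "extendable m (?P ?n)" using no by (intro ext) auto
    then obtain q where "?P ?n @ q \<in> lassos m" unfolding extendable_def by blast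
    then show False using lasso_length by fastforce
  qed
  then have "rightmost_lasso m \<in> lassos m"
    unfolding rightmost_lasso_def by (rule LeastI_ex)
  moreover have "rightmost_lasso m ! i = next_dart m (take i (rightmost_lasso m))"
    if "i < length (rightmost_lasso m)" for i
  proof -
    define N where "N = (LEAST i. ?P i \<in> lassos m)"
    have iN: "i < N" using that by (simp add: rightmost_lasso_def N_def)
    have "rightmost_lasso m ! i = take (Suc i) (?P N) ! i" by (simp add: rightmost_lasso_def N_def)
    also have "\<dots> = ?P (Suc i) ! i" using iN take_rightmost_prefix[of "Suc i" N m] by simp
    also have "\<dots> = next_dart m (?P i)" by (simp add: nth_append)
    also have "?P i = take i (rightmost_lasso m)"
      using iN take_rightmost_prefix[of i N m] by (simp add: rightmost_lasso_def N_def)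
    finally show ?thesis .
  qed
  ultimately show ?thesis by (simp add: rightmost_def)
qed

lemma sublist_path:
  assumes "path_from m v w" "j < length w"
  shows "path_from m (tail m (w ! j)) (drop j w)"
proof -
  have "path_from m (last (visited m v (take j w))) (drop j w)"
    using assms(1) path_from_append[of m v "take j w" "drop j w"] by simp
  then show ?thesis using assms(2) Cons_nth_drop_Suc[OF assms(2)] by (metis path_from.simps(2))
qed

lemma lasso_atI:
  fixes \<phi> :: "'a \<Rightarrow> 'g::group_add"
  assumes "k < length w" "path_from m (root_vertex m) w" "distinct (map (tail m) w)"
    "head m (last w) = tail m (w ! k)" "admissible m \<phi>" "holonomy m \<phi> (drop k w) \<noteq> 0"
  shows "lasso_at m w k"
proof -
  have "is_loop m (drop k w)"
    using sublist_path[OF assms(2,1)] assms(1,4) by (simp add: is_loop_iff hd_drop_conv_nth last_drop)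
  then show ?thesis
    using assms noncontractibleI[OF _ assms(5,6)] by (simp add: lasso_at_def)
qed

lemma path_from_rev:
  assumes "path_from m v p"
  shows "path_from m (last (visited m v p)) (map (rev m) (List.rev p)) \<and>
    last (visited m (last (visited m v p)) (map (rev m) (List.rev p))) = v"
  using assms
proof (induction p arbitrary: v)
  case (Cons e p)
  then have e: "e \<in> darts m" "tail m e = v" and IH:
    "path_from m (last (visited m (head m e) p)) (map (rev m) (List.rev p))"
    "last (visited m (last (visited m (head m e) p)) (map (rev m) (List.rev p))) = head m e"
    by auto
  have "last (visited m (head m e) p) = last (visited m v (e # p))" by simp
  then show ?case
    using IH e rev_rev[OF e(1)] by (simp add: path_from_append last_visited head_def)
qed simp

text \<open>If an edge is used in both directions, then distinctness of the tails forces each of the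
  two half-edges to follow the other cyclically. The loop is thus a half-edge followed by its
  reverse, and its holonomy is zero.\<close>

lemma noncontractible_disjoint:
  assumes simple: "simple_loop m p" and nc: "noncontractible m p"
  shows "set p \<inter> rev m ` set p = {}"
proof (rule ccontr)
  assume "set p \<inter> rev m ` set p \<noteq> {}"
  then obtain i j where ij: "i < length p" "j < length p" "p ! i = rev m (p ! j)"
    by (auto simp: in_set_conv_nth)
  have loop: "is_loop m p" and dist: "distinct (map (tail m) p)" using simple by (auto simp: simple_loop_iff)
  then have path: "path_from m (tail m (hd p)) p" "head m (last p) = tail m (hd p)" "p \<noteq> []" by (auto simp: is_loop_iff)
  let ?k = "length p"
  have k: "?k > 0" using path(3) by simp
  have hd_nx: "head m (p ! i) = tail m (p ! (Suc i mod ?k))" if "i < ?k" for i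
  proof (cases "Suc i < ?k")
    case True
    then show ?thesis using path_from_nth(2)[OF path(1) that] by simp
  next
    case False
    then have "Suc i = ?k" using that by simp
    then have "i = ?k - 1" "Suc i mod ?k = 0" by simp_all
    then show ?thesis using path by (simp add: last_conv_nth hd_conv_nth)
  qed
  have inj: "a = b" if "tail m (p ! a) = tail m (p ! b)" "a < ?k" "b < ?k" for a b
    using nth_eq_iff_index_eq[of "map (tail m) p" a b] that dist by simp
  have darts: "p ! i \<in> darts m" "p ! j \<in> darts m" using path_from_nth(1)[OF path(1)] ij by auto
  have "i = Suc j mod ?k" using inj[of i "Suc j mod ?k"] hd_nx[OF ij(2)] ij k by (simp add: head_def)
  moreover have "rev m (p ! i) = p ! j" using ij(3) rev_rev[OF darts(2)] by simp
  then have "j = Suc i mod ?k" using inj[of j "Suc i mod ?k"] hd_nx[OF ij(1)] ij k by (simp add: head_def)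
  moreover have "i \<noteq> j" using ij(3) rev_neq[OF darts(2)] by metis
  moreover have "Suc a mod ?k = (if Suc a = ?k then 0 else Suc a)" if "a < ?k" for a using that by simp
  ultimately have "?k = 2" using ij(1,2) by (auto split: if_splits)
  then obtain a b where ab: "p = [a, b]" by (auto simp: length_Suc_conv numeral_2_eq_2)
  then have "a \<in> darts m" "b = rev m a"
    using ij \<open>i \<noteq> j\<close> darts rev_rev by (auto simp: less_Suc_eq numeral_2_eq_2)
  then have "holonomy m \<phi> p = 0" if "admissible m \<phi>" for \<phi> :: "'a \<Rightarrow> 'a holonomy_group"
    using that holonomy_rev[OF that, of "[a]"] ab by (simp add: admissible_def)
  then show False using noncontractible_iff[OF loop] nc by blast
qed

end

lemma path_from_appendI:
  "path_from m v u \<Longrightarrow> u \<noteq> [] \<Longrightarrow> path_from m (head m (last u)) q \<Longrightarrow> path_from m v (u @ q)"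
  by (simp add: path_from_append last_visited)

lemma distinct_map_appendI:
  "distinct (map f u) \<Longrightarrow> distinct (map f v) \<Longrightarrow> (\<And>x y. x \<in> set u \<Longrightarrow> y \<in> set v \<Longrightarrow> f x \<noteq> f y) \<Longrightarrow>
    distinct (map f (u @ v))"
  unfolding map_append distinct_append set_map by blast

section \<open>First arrival on the cut, and intersection numbers\<close>

context cut
begin

interpretation m': rooted_map m'
  by unfold_locales (rule is_map_m')

definition on_cut :: "'a set \<Rightarrow> bool" where "on_cut v \<longleftrightarrow> (\<exists>l<k. v = tail m (\<gamma> ! l))"
definition on_cut' :: "'a set \<Rightarrow> bool" where "on_cut' v \<longleftrightarrow> (\<exists>l<k. v = tail m' (\<gamma> ! l))"

lemma on_cutI: "d \<in> Left \<or> d \<in> Right \<Longrightarrow> on_cut (tail m d)"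
  using Left_tails[of d] Right_tails[of d] tail_rev_\<gamma> unfolding on_cut_def by (metis nx_less)

lemma on_cut'I: "d \<in> Left \<or> d \<in> Right \<Longrightarrow> on_cut' (tail m' d)"
  using Left_tails[of d] Right_tails[of d] tail'_\<gamma> unfolding on_cut'_def by (metis sh_less)

lemma on_cutD: "on_cut (tail m d) \<Longrightarrow> d \<in> Left \<or> d \<in> Right"
proof -
  assume "on_cut (tail m d)"
  then obtain l where l: "l < k" "tail m d = tail m (\<gamma> ! l)" by (auto simp: on_cut_def)
  then have "\<gamma> ! l \<in> tail m d \<inter> T" using tail_self[of "\<gamma> ! l"] by (auto simp: T_def)
  then show ?thesis using Left_or_Right by blast
qed

lemma on_cut'_imp: "d \<notin> Left \<Longrightarrow> on_cut' (tail m' d) \<Longrightarrow> on_cut (tail m d)"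
proof -
  assume d: "d \<notin> Left" and "on_cut' (tail m' d)"
  then obtain l where l: "l < k" "tail m' d = tail m' (\<gamma> ! l)" by (auto simp: on_cut'_def)
  obtain i where i: "i < k" "sh \<epsilon> i = l" using sh_surj[OF l(1), of \<epsilon>] by blast
  obtain j where j: "j < k" "nx j = i" using nx_surj[OF i(1)] by blast
  have "tail m' d = tail m' (rev m (\<gamma> ! j))" using l(2) tail'_\<gamma>[OF j(1)] i j by simp
  then have "tail m d = tail m (rev m (\<gamma> ! j))" using tail'_iff[OF d rev_\<gamma>_Right(2)[OF j(1)]] by simp
  then show ?thesis using tail_rev_\<gamma>[OF j(1)] nx_less unfolding on_cut_def by blast
qed

text \<open>The left side can be entered only by way of a vertex of \<gamma>.\<close>

lemma right_run:
  assumes "path_from m' v xs" "xs \<noteq> [] \<Longrightarrow> hd xs \<notin> Left \<and> hd xs \<notin> T" "\<forall>x\<in>set xs. \<not> on_cut' (head m' x)"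
  shows "list_all right_dart xs \<and> (\<forall>x\<in>set xs. x \<notin> T) \<and> (\<forall>x\<in>set (tl xs). \<not> on_cut (tail m x))"
  using assms
proof (induction xs arbitrary: v)
  case (Cons x xs)
  have x: "x \<in> darts m" "x \<notin> Left" "x \<notin> T" "\<not> on_cut' (head m' x)" using Cons.prems by auto
  have "head m' x = tail m' (rev m x)" using rev'_other[OF x(3)] by (simp add: head_def)
  then have "rev m x \<notin> Left" using on_cut'I x(4) by metis
  then have rx: "right_dart x" using x by (simp add: right_dart_def)
  have p: "path_from m' (head m' x) xs" using Cons.prems(1) by simp
  have h: "hd xs \<notin> Left \<and> hd xs \<notin> Right" if "xs \<noteq> []"
  proof -
    have "tail m' (hd xs) = head m' x" using p that by (cases xs) auto
    then show ?thesis using on_cut'I x(4) by metis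
  qed
  then have IH: "list_all right_dart xs \<and> (\<forall>x\<in>set xs. x \<notin> T) \<and> (\<forall>x\<in>set (tl xs). \<not> on_cut (tail m x))"
    using T_sub Cons.prems(3) by (intro Cons.IH[OF p]) auto
  have "\<not> on_cut (tail m y)" if "y \<in> set xs" for y
  proof (cases "y = hd xs")
    case True
    then show ?thesis using h on_cutD that by (metis empty_iff list.set(1))
  next
    case False
    then have "y \<in> set (tl xs)" using that by (cases xs) auto
    then show ?thesis using IH by blast
  qed
  then show ?case using rx x(3) IH by simp
qed simp

text \<open>The last half-edge \<open>e\<close> may arrive on the left side of \<gamma>, so it need
  not be a \<open>right_dart\<close>; for the path and its tails only its beginning matters.\<close>

lemma right_extend:
  assumes "list_all right_dart u" "root m \<notin> Left" "e \<notin> Left" "e \<in> darts m"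
    and "path_from m' (root_vertex m') (map move u @ [e])" "distinct (map (tail m') (map move u @ [e]))"
  shows "path_from m (root_vertex m) (u @ [e])" "distinct (map (tail m) (u @ [e]))"
proof -
  have pu: "path_from m (root_vertex m) u"
    using path_from_move[OF assms(2,1)] assms(5) by (simp add: path_from_append root_vertex_def)
  have "tail m e = (if u = [] then root_vertex m else head m (last u))"
  proof (cases "u = []")
    case True
    then have "tail m' e = tail m' (root m)" using assms(5) by (simp add: root_vertex_def)
    then show ?thesis using tail'_iff[OF assms(3,2)] True by (simp add: root_vertex_def)
  next
    case False
    then have r: "right_dart (last u)" using assms(1) by (simp add: list_all_iff)
    have "tail m' e = head m' (move (last u))"
      using assms(5) False by (simp add: path_from_append last_visited last_map)
    then have "tail m' e = tail m' (rev m (last u))" using right_dart_head(2)[OF r] by simp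
    then show ?thesis using tail'_iff[OF assms(3) right_dart_head(1)[OF r]] False by (simp add: head_def)
  qed
  then show "path_from m (root_vertex m) (u @ [e])"
    using pu assms(4) by (auto simp: path_from_append last_visited)
  have rd: "right_dart x" if "x \<in> set u" for x using assms(1) that by (simp add: list_all_iff)
  have "distinct (map (tail m') (map move u))" using assms(6) by simp
  then have "distinct (map (tail m) u)"
    using right_dart_tails_eq(1)[OF rd rd] unfolding distinct_conv_nth by auto
  moreover have "tail m x \<noteq> tail m e" if "x \<in> set u" for x
    using assms(6) right_dart_tails_eq(2)[OF assms(3) rd[OF that]] that by auto
  ultimately show "distinct (map (tail m) (u @ [e]))" by auto
qed

text \<open>
  The intersection number with \<open>\<gamma>\<close> is the holonomy of an integer labeling.
\<close>

definition crossing :: "'a \<Rightarrow> int" where "crossing d = (if d \<in> Left then - 1 else 0)"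

lemma admissible_crossing: "admissible m crossing"
  unfolding admissible_def
proof
  fix d assume d: "d \<in> darts m"
  have r: "rot m (nxt m (rev m d)) = d" using rot_nxt rev_rev d by simp
  show "- crossing (rev m d) + crossing (nxt m (rev m d)) = - (- crossing d + crossing (nxt m d))"
  proof (cases "d \<in> T")
    case False
    have "nxt m (rev m d) \<in> Left \<longleftrightarrow> d \<in> Left" using Left_step[of "nxt m (rev m d)"] r False by simp
    moreover have "nxt m d \<in> Left \<longleftrightarrow> rev m d \<in> Left" using Left_step[of "nxt m d"] rot_nxt[of d] rev_T[OF d] False by simp
    ultimately show ?thesis by (simp add: crossing_def)
  next
    case True
    have *: "\<gamma> ! i \<in> Left \<and> nxt m (\<gamma> ! i) \<in> Left \<and> rev m (\<gamma> ! i) \<notin> Left \<and> nxt m (rev m (\<gamma> ! i)) \<notin> Left"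
      if i: "i < k" for i
    proof -
      have "rot m (nxt m (rev m (\<gamma> ! i))) = \<gamma> ! i" using rot_nxt rev_rev \<gamma>_darts(1)[OF i] by simp
      then show ?thesis
        using \<gamma>_Left(1)[OF i] rev_\<gamma>_Right(2)[OF i] before_rev_\<gamma>_Left[OF i rot_nxt] before_\<gamma>_Right(2)[OF i] by blast
    qed
    from True consider i where "i < k" "d = \<gamma> ! i" | i where "i < k" "d = rev m (\<gamma> ! i)" unfolding T_cases by blast
    then show ?thesis by cases (use * \<gamma>_darts rev_rev in \<open>simp_all add: crossing_def\<close>)
  qed
qed

lemma crossing_right: "list_all right_dart u \<Longrightarrow> holonomy m crossing u = 0"
proof (induction u)
  case (Cons e u)
  have e: "right_dart e" using Cons.prems by simp
  have "crossing (nxt m e) = crossing e"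
  proof (cases "e \<in> set \<gamma>")
    case True
    then obtain i where i: "i < k" "e = \<gamma> ! i" by (auto simp: set_\<gamma>)
    then show ?thesis using \<gamma>_Left(1)[OF i(1)] before_rev_\<gamma>_Left[OF i(1) rot_nxt] by (simp add: crossing_def)
  next
    case False
    have "e \<notin> T" by (rule right_dart_notin_T[OF e False])
    then have "nxt m e \<notin> Left"
      using Left_step[of "nxt m e"] rot_nxt[of e] rev_T right_dart_darts[OF e] right_dart_head(1)[OF e] by simp
    moreover have "e \<notin> Left" using e False by (simp add: right_dart_def)
    ultimately show ?thesis by (simp add: crossing_def)
  qed
  then show ?case using Cons by simp
qed simp

lemma crossing_left:
  assumes "e \<in> darts m" "e \<notin> T" "e \<notin> Left" "rev m e \<in> Left"
  shows "- crossing e + crossing (nxt m e) = - 1"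
  using Left_step[of "nxt m e"] rot_nxt[of e] rev_T[OF assms(1)] assms by (simp add: crossing_def)

end

section \<open>The rightmost lasso of the rotated map\<close>

locale rightmost_cut = cut m \<gamma> \<epsilon> for m :: "'a rmap" and \<gamma> \<epsilon> +
  fixes p w
  assumes w_eq: "w = p @ \<gamma>" and rightmost: "rightmost m w" and lasso_w: "lasso_at m w (length p)"
begin

interpretation m': rooted_map m'
  by unfold_locales (rule is_map_m')

lemma path_w: "path_from m (root_vertex m) w" and distinct_w: "distinct (map (tail m) w)"
  using lasso_w by (simp_all add: lasso_at_def)

lemma nth_w: "length p \<le> i \<Longrightarrow> w ! i = \<gamma> ! (i - length p)" "j < k \<Longrightarrow> w ! (length p + j) = \<gamma> ! j"
  "length w = length p + k"
  by (simp_all add: w_eq nth_append)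

lemma p_off: "x \<in> set p \<Longrightarrow> \<not> on_cut (tail m x)"
  using distinct_w by (auto simp: w_eq on_cut_def disjoint_iff)

lemma w_off: "i < length p \<Longrightarrow> \<not> on_cut (tail m (w ! i))"
  using p_off by (simp add: w_eq nth_append)

lemma noncontractible_label:
  obtains \<phi> :: "'a \<Rightarrow> 'a holonomy_group" where "admissible m \<phi>" "holonomy m \<phi> \<gamma> \<noteq> 0"
  using noncontractible_iff[of \<gamma>] lasso_w simple by (auto simp: lasso_at_def w_eq simple_loop_iff)

lemma \<gamma>_ne: "\<gamma> \<noteq> []" and hd_\<gamma>: "hd \<gamma> = \<gamma> ! 0" and last_\<gamma>: "head m (last \<gamma>) = tail m (\<gamma> ! 0)"
  and path_\<gamma>: "path_from m (tail m (\<gamma> ! 0)) \<gamma>"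
  using simple by (auto simp: simple_loop_iff is_loop_iff hd_conv_nth)

lemma head_\<gamma>: "i < k \<Longrightarrow> head m (\<gamma> ! i) = tail m (\<gamma> ! nx i)"
  using tail_rev_\<gamma> by (simp add: head_def)

text \<open>This is the competitor which forces the rightmost lasso to arrive at its loop from the
  right.\<close>

lemma reversed_lasso: "p @ map (rev m) (List.rev \<gamma>) \<in> lassos m"
proof -
  let ?r = "map (rev m) (List.rev \<gamma>)"
  obtain \<phi> :: "'a \<Rightarrow> 'a holonomy_group" where \<phi>: "admissible m \<phi>" "holonomy m \<phi> \<gamma> \<noteq> 0"
    by (rule noncontractible_label) (rule that)
  have v: "last (visited m (root_vertex m) p) = tail m (\<gamma> ! 0)"
    using path_w \<gamma>_ne hd_\<gamma> by (cases \<gamma>) (auto simp: w_eq path_from_append)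
  have end\<gamma>: "last (visited m (tail m (\<gamma> ! 0)) \<gamma>) = tail m (\<gamma> ! 0)"
    using \<gamma>_ne last_\<gamma> by (simp add: last_visited)
  have r: "path_from m (tail m (\<gamma> ! 0)) ?r" "last (visited m (tail m (\<gamma> ! 0)) ?r) = tail m (\<gamma> ! 0)"
    using path_from_rev[OF path_\<gamma>] unfolding end\<gamma> by auto
  have tails: "map (tail m) ?r = List.rev (map (\<lambda>e. tail m (rev m e)) \<gamma>)" by (simp add: rev_map comp_def)
  have "tail m x \<noteq> tail m (rev m y)" if "x \<in> set p" "y \<in> set \<gamma>" for x y
    using p_off[OF that(1)] that(2) on_cutI[of "rev m y"] rev_\<gamma>_Right(1) unfolding set_\<gamma> by metis
  moreover have "distinct (map (\<lambda>e. tail m (rev m e)) \<gamma>)"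
    by (auto simp: distinct_conv_nth tail_rev_\<gamma>_inj)
  ultimately have dist: "distinct (map (tail m) (p @ ?r))"
    using distinct_w unfolding map_append distinct_append tails w_eq by auto
  have hr: "?r ! 0 = rev m (last \<gamma>)" "?r \<noteq> []" using \<gamma>_ne by (simp_all add: rev_nth last_conv_nth)
  have "lasso_at m (p @ ?r) (length p)"
  proof (rule lasso_atI[OF _ _ dist _ \<phi>(1)])
    show "path_from m (root_vertex m) (p @ ?r)" using path_w r v by (simp add: path_from_append w_eq)
    have "(p @ ?r) ! length p = ?r ! 0" using hr by (simp add: nth_append)
    then show "head m (last (p @ ?r)) = tail m ((p @ ?r) ! length p)"
      using r(2) hr last_\<gamma> by (simp add: last_visited head_def)
    show "holonomy m \<phi> (drop (length p) (p @ ?r)) \<noteq> 0"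
      using holonomy_rev[OF \<phi>(1) \<gamma>_darts(2)] \<phi>(2) by simp
  qed (use \<gamma>_ne in simp)
  then show ?thesis using lassos_iff by blast
qed

text \<open>The critical case is the arrival at the loop, by way of \<open>p\<close> or, if
  \<open>p\<close> is empty, at the root corner. Starting in \<open>Left\<close>, the
  counterclockwise sweep would meet the reverse of the last half-edge of \<gamma> before
  \<open>\<gamma> ! 0\<close>, contrary to the choice of \<open>w\<close>, since
  \<open>reversed_lasso\<close> begins there.\<close>

lemma start_notin_Left:
  assumes i: "i < length w"
  shows "sweep_start m (take i w) \<notin> Left"
proof -
  let ?s = "sweep_start m (take i w)"
  have "take i w @ w ! i # drop (Suc i) w = w" using i by (simp add: id_take_nth_drop[symmetric])
  then have "path_from m (root_vertex m) ((take i w @ [w ! i]) @ drop (Suc i) w)" using path_w by simp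
  then have "path_from m (root_vertex m) (take i w @ [w ! i])" by (simp only: path_from_append)
  then have ts: "tail m ?s = tail m (w ! i)" by (rule tail_sweep_start)
  consider "i < length p" | "i = length p" | "i > length p" by linarith
  then show ?thesis
  proof cases
    case 1
    then show ?thesis using w_off ts on_cutI by metis
  next
    case 2
    have w0: "w ! i = \<gamma> ! 0" using nth_w(2)[of 0] k 2 by simp
    have tp: "take i w = p" using 2 w_eq by simp
    obtain N where N: "turn m p N = \<gamma> ! 0" "\<And>n. n < N \<Longrightarrow> \<not> extendable m (p @ [turn m p n])"
      using rightmost_sweep[OF rightmost i] unfolding tp w0 by blast
    show ?thesis
    proof
      assume s: "?s \<in> Left"
      \<comment> \<open>The sweep could leave \<open>Left\<close> only through the reversed loop,
        which is excluded; but the half-edge just before \<open>\<gamma> ! 0\<close> is not in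
        \<open>Left\<close>.\<close>
      have "(rot m ^^ n) ?s \<in> Left" if "n \<le> N" for n
        using that
      proof (induction n)
        case (Suc n)
        have t: "turn m p n = rot m ((rot m ^^ n) ?s)" by (simp add: turn_def tp)
        have tt: "tail m (turn m p n) = tail m (\<gamma> ! 0)" using tail_turn[of p n] ts tp w0 by simp
        have ext: "\<not> extendable m (p @ [turn m p n])" using N(2) Suc.prems by simp
        show ?case
        proof (cases "turn m p n \<in> T")
          case False
          then show ?thesis using Left_step[of "(rot m ^^ n) ?s"] Suc t by simp
        next
          case True
          obtain i0 where i0: "i0 < k" "nx i0 = 0" using nx_surj[OF k] by blast
          then have "turn m p n = \<gamma> ! 0 \<or> turn m p n = rev m (\<gamma> ! i0)" using T_vertex[OF True _ i0(1)] tt by simp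
          moreover have "turn m p n \<noteq> rev m (\<gamma> ! i0)"
          proof
            assume *: "turn m p n = rev m (\<gamma> ! i0)"
            have "nx (k - 1) = 0" using k by (simp add: nx_def)
            then have "i0 = k - 1" using nx_inj[of i0 "k - 1"] i0 k by simp
            then have "map (rev m) (List.rev \<gamma>) = turn m p n # map (rev m) (tl (List.rev \<gamma>))"
              using * \<gamma>_ne by (cases \<gamma> rule: rev_cases) simp_all
            then have "extendable m (p @ [turn m p n])"
              using reversed_lasso unfolding extendable_def by auto
            then show False using ext by blast
          qed
          ultimately have "turn m p n \<in> Left" using \<gamma>_Left(1)[OF k] by simp
          then show ?thesis using t by simp
        qed
      qed (use s in simp)
      then have "(rot m ^^ N) ?s \<in> Left" by simp
      moreover have "rot m ((rot m ^^ N) ?s) = \<gamma> ! 0" using N(1) by (simp add: turn_def tp)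
      ultimately show False using before_\<gamma>_Right(2)[OF k] by blast
    qed
  next
    case 3
    then obtain j where j: "i = Suc (length p + j)" "j < k" using i nth_w(3) less_imp_Suc_add[OF 3] by auto
    then have "take i w \<noteq> []" "last (take i w) = \<gamma> ! j"
      using i nth_w(2)[OF j(2)] by (auto simp: take_Suc_conv_app_nth)
    then show ?thesis using rev_\<gamma>_Right(2)[OF j(2)] by (simp add: sweep_start_def)
  qed
qed

lemma root_notin_Left: "root m \<notin> Left"
  using start_notin_Left[of 0] k nth_w(3) by (simp add: sweep_start_def)

lemma right_w: "i < length w \<Longrightarrow> right_dart (w ! i)"
proof (cases "i < length p")
  case True
  assume i: "i < length w"
  have si: "Suc i < length w" using True nth_w(3) k by linarith
  have "w ! i \<notin> Left" using w_off[OF True] on_cutI by blast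
  moreover have "rev m (w ! i) \<notin> Left"
    using start_notin_Left[OF si] i by (simp add: sweep_start_def take_Suc_conv_app_nth)
  moreover have "w ! i \<in> darts m" using path_from_nth(1)[OF path_w i] .
  ultimately show ?thesis by (simp add: right_dart_def)
next
  case False
  assume "i < length w"
  then have "w ! i = \<gamma> ! (i - length p)" "i - length p < k" using False nth_w by auto
  then show ?thesis by (simp add: right_dart_def)
qed

lemma right_all: "list_all right_dart w"
  using right_w by (simp add: list_all_length)

lemma right_take: "list_all right_dart (take i w)"
  using right_all by (metis append_take_drop_id list_all_append)

lemma sweep_start': "i < length w \<Longrightarrow> sweep_start m' (map move (take i w)) = sweep_start m (take i w)"
proof (cases i)
  case (Suc j)
  assume "i < length w"
  then have "take i w \<noteq> []" "last (take i w) = w ! j" "right_dart (w ! j)"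
    using Suc right_w[of j] by (auto simp: take_Suc_conv_app_nth)
  then show ?thesis using right_dart_head(3) by (simp add: sweep_start_def last_map)
qed (simp add: sweep_start_def)

text \<open>The competing lasso is followed up to its first arrival on \<gamma>; so far it is a path
  of the old map as well. How it is closed up along \<gamma> depends on whether it left
  \<open>w\<close> before or on \<gamma>, and on the side from which it arrives.\<close>

lemma extendable_move:
  assumes i: "i < length w" and d: "d \<notin> Left" "d \<notin> T" "tail m d = tail m (w ! i)"
    and ext: "extendable m' (map move (take i w) @ [d])"
  shows "extendable m (take i w @ [d])"
proof -
  let ?P = "take i w"
  obtain q j where l: "lasso_at m' (map move ?P @ d # q) j"
    using ext lassos_iff unfolding extendable_def by fastforce
  have path': "path_from m' (root_vertex m') (map move ?P @ d # q)"
    and dist': "distinct (map (tail m') (map move ?P @ d # q))" using l by (auto simp: lasso_at_def)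
  have P: "list_all right_dart ?P" by (rule right_take)
  have extI: "extendable m (?P @ [d])" if "lasso_at m (?P @ d # r) j" for r j
    using that lassos_iff unfolding extendable_def by fastforce
  show ?thesis
  proof (cases "\<exists>e\<in>set (d # q). on_cut' (head m' e)")
    case False
    have "path_from m' (last (visited m' (root_vertex m') (map move ?P))) (d # q)"
      using path' by (simp only: path_from_append)
    from right_run[OF this] False d
    have r: "list_all right_dart (d # q)" "\<forall>x\<in>set (d # q). x \<notin> T" by auto
    have "map move (?P @ d # q) = map move ?P @ d # q"
      using r(2) by (auto simp: move_def T_def intro!: map_idI)
    then have "lasso_at m' (map move (?P @ d # q)) j" using l by simp
    then have "lasso_at m (?P @ d # q) j"
      by (rule lasso_at_move[rotated 2]) (use P r root_notin_Left in auto)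
    then show ?thesis by (rule extI)
  next
    case True
    obtain xs e ys where es: "d # q = xs @ e # ys" and e: "on_cut' (head m' e)"
      and xs: "\<forall>x\<in>set xs. \<not> on_cut' (head m' x)"
      using split_list_first_prop[OF True] by blast
    \<comment> \<open>\<open>?X\<close> is the excursion from its departure from \<open>w\<close> to
      the first arrival on \<gamma>; \<open>?u\<close> adds the way from the root.\<close>
    let ?X = "xs @ [e]"
    let ?u = "?P @ ?X"
    have X: "hd ?X = d" "?X = d # tl ?X" using es by (cases xs; simp)+
    have pe: "path_from m' (last (visited m' (root_vertex m') (map move ?P))) (xs @ e # ys)"
      using path' unfolding es by (simp only: path_from_append)
    then have pxs: "path_from m' (last (visited m' (root_vertex m') (map move ?P))) xs"
      and pe': "path_from m' (last (visited m' (last (visited m' (root_vertex m') (map move ?P))) xs)) (e # ys)"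
      by (simp_all only: path_from_append)
    have rxs: "list_all right_dart xs" "\<forall>x\<in>set xs. x \<notin> T" "\<forall>x\<in>set (tl xs). \<not> on_cut (tail m x)"
      using right_run[OF pxs _ xs] d X(1) by (cases xs; simp)+
    have ed: "e \<in> darts m" using pe' by simp
    have eX: "e \<notin> Left \<and> e \<notin> T \<and> (xs \<noteq> [] \<longrightarrow> \<not> on_cut (tail m e))"
    proof (cases "xs = []")
      case True
      then show ?thesis using X(1) d by simp
    next
      case False
      then have "tail m' e = head m' (last xs)" using pe' by (simp add: last_visited)
      then have "\<not> on_cut' (tail m' e)" using xs False by simp
      then have "e \<notin> Left" "e \<notin> Right" using on_cut'I by blast+
      then show ?thesis using T_sub on_cutD by blast
    qed
    then have tlX: "\<forall>x\<in>set (tl ?X). \<not> on_cut (tail m x)" using rxs(3) by (cases xs) auto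
    have mxs: "map move (?P @ xs) = map move ?P @ xs"
      using rxs(2) by (auto simp: move_def T_def intro!: map_idI)
    have "map move ?P @ d # q = (map move (?P @ xs) @ [e]) @ ys" unfolding mxs es by simp
    note z' = this
    have Pxs: "list_all right_dart (?P @ xs)" using P rxs(1) by simp
    have u: "path_from m (root_vertex m) ?u" "distinct (map (tail m) ?u)"
    proof -
      have 1: "path_from m' (root_vertex m') (map move (?P @ xs) @ [e])"
        using path' unfolding z' by (simp only: path_from_append[of _ _ "map move (?P @ xs) @ [e]"])
      have 2: "distinct (map (tail m') (map move (?P @ xs) @ [e]))"
        using dist' unfolding z' by (simp only: map_append[of _ "map move (?P @ xs) @ [e]"] distinct_append)
      have "e \<notin> Left" using eX by blast
      from right_extend[OF Pxs root_notin_Left this ed 1 2]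
      show "path_from m (root_vertex m) ?u" "distinct (map (tail m) ?u)" by (simp_all only: append_assoc)
    qed
    have head': "head m' e = tail m' (rev m e)" using rev'_other eX by (simp add: head_def)
    have "on_cut (head m e)"
    proof (cases "rev m e \<in> Left")
      case True
      then show ?thesis using on_cutI by (simp add: head_def)
    next
      case False
      then show ?thesis using on_cut'_imp[OF False] e head' by (simp add: head_def)
    qed
    then obtain c where c: "c < k" "head m e = tail m (\<gamma> ! c)" by (auto simp: on_cut_def)
    have lu: "last ?u = e" "?u \<noteq> []" by auto
    have dropc: "path_from m (tail m (\<gamma> ! c)) (drop c \<gamma>)" by (rule sublist_path[OF path_\<gamma> c(1)])
    have ud: "?u = ?P @ d # tl ?X" using X(2) by simp
    obtain \<phi> :: "'a \<Rightarrow> 'a holonomy_group" where \<phi>: "admissible m \<phi>" "holonomy m \<phi> \<gamma> \<noteq> 0"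
      by (rule noncontractible_label) (rule that)
    show ?thesis
    proof (cases "i < length p")
      case True
      have off: "\<not> on_cut (tail m x)" if "x \<in> set ?u" for x
      proof -
        from that consider "x \<in> set ?P" | "x = d" | "x \<in> set (tl ?X)" using ud by auto
        then show ?thesis
        proof cases
          case 1
          then show ?thesis using p_off True by (auto simp: w_eq dest: in_set_takeD)
        qed (use d(3) w_off[OF True] tlX in auto)
      qed
      \<comment> \<open>For a departure before \<gamma>, the path \<open>?u\<close> has met no
        vertex of \<gamma> before its end, so all of \<gamma> can be run through from there; the
        holonomy is conjugate to that of \<gamma>.\<close>
      let ?r = "drop c \<gamma> @ take c \<gamma>"
      have "lasso_at m (?u @ ?r) (length ?u)"
      proof (rule lasso_atI[OF _ _ _ _ \<phi>(1)])
        show "length ?u < length (?u @ ?r)" using c(1) \<gamma>_ne by simp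
        have "path_from m (tail m (\<gamma> ! 0)) (take c \<gamma>)"
          using path_\<gamma> path_from_append[of m _ "take c \<gamma>" "drop c \<gamma>"] by simp
        then have "path_from m (tail m (\<gamma> ! c)) ?r"
          using dropc c by (intro path_from_appendI) (simp_all add: last_drop last_\<gamma>)
        then show "path_from m (root_vertex m) (?u @ ?r)"
          using path_from_appendI[OF u(1) lu(2)] lu c by simp
        have "distinct (map (tail m) (take c \<gamma> @ drop c \<gamma>))" using simple by (simp add: simple_loop_iff)
        then have "distinct (map (tail m) ?r)" unfolding map_append distinct_append by blast
        moreover have "tail m x \<noteq> tail m y" if "x \<in> set ?u" "y \<in> set ?r" for x y
        proof -
          have "y \<in> set \<gamma>" using that(2) by (auto dest: in_set_takeD in_set_dropD)
          then have "on_cut (tail m y)" using on_cut_def set_\<gamma> by metis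
          then show ?thesis using off[OF that(1)] by metis
        qed
        ultimately show "distinct (map (tail m) (?u @ ?r))"
          by (rule distinct_map_appendI[OF u(2)])
        have hr: "(?u @ ?r) ! length ?u = \<gamma> ! c"
          using nth_append_length_plus[of ?u ?r 0] c(1) by (simp only: add_0_right) (simp add: nth_append)
        have "head m (last ?r) = tail m (\<gamma> ! c)"
        proof (cases "c = 0")
          case True
          then show ?thesis using last_\<gamma> by simp
        next
          case False
          then have ne: "take c \<gamma> \<noteq> []" using \<gamma>_ne by simp
          then have "last ?r = last (take c \<gamma>)" by simp
          also have "\<dots> = \<gamma> ! (c - 1)" using ne False c(1) by (simp add: last_conv_nth min_absorb2)
          finally have "last ?r = \<gamma> ! (c - 1)" .
          moreover have "nx (c - 1) = c" using False c(1) by (simp add: nx_def)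
          ultimately show ?thesis using head_\<gamma>[of "c - 1"] c(1) by simp
        qed
        moreover have "?r \<noteq> []" using c(1) by simp
        then have "last (?u @ ?r) = last ?r" by (rule last_appendR)
        ultimately show "head m (last (?u @ ?r)) = tail m ((?u @ ?r) ! length ?u)" unfolding hr by (simp only:)
        have "holonomy m \<phi> (take c \<gamma>) + holonomy m \<phi> (drop c \<gamma>) \<noteq> 0"
          using \<phi>(2) holonomy_simps(3)[of m \<phi> "take c \<gamma>" "drop c \<gamma>"] by simp
        then have "holonomy m \<phi> (drop c \<gamma>) + holonomy m \<phi> (take c \<gamma>) \<noteq> 0" using add_eq_0_commute by metis
        then show "holonomy m \<phi> (drop (length ?u) (?u @ ?r)) \<noteq> 0" by simp
      qed
      then show ?thesis using extI[of "tl ?X @ ?r"] ud by simp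
    next
      case False
      define j where "j = i - length p"
      have j: "j < k" "i = length p + j" using False i nth_w(3) by (auto simp: j_def)
      have Pj: "?P = p @ take j \<gamma>" using j by (simp add: w_eq)
      have td: "tail m d = tail m (\<gamma> ! j)" using d(3) nth_w(2) j by simp
      have lenP: "length ?P = i" using i by simp
      have nthu: "(?u @ v) ! i = d" for v
      proof -
        have eq: "?u @ v = ?P @ d # (tl ?X @ v)" using ud by simp
        show ?thesis unfolding eq using nth_append_length[of ?P d "tl ?X @ v"] unfolding lenP .
      qed
      have set_u: "set ?u = set p \<union> set (take j \<gamma>) \<union> insert d (set (tl ?X))"
      proof -
        have "set ?u = set (?P @ d # tl ?X)" using ud by (rule arg_cong)
        then show ?thesis unfolding Pj set_append list.set(2) .
      qed
      \<comment> \<open>On \<gamma>, \<open>?u\<close> has used up only the vertices of index at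
        most \<open>j\<close>; an arc that stays beyond \<open>j\<close> may be appended.\<close>
      have below: "y \<le> j" if "x \<in> set ?u" "y < k" "tail m x = tail m (\<gamma> ! y)" for x y
      proof -
        have on: "on_cut (tail m x)" using that(2,3) on_cut_def by blast
        from that(1) consider "x \<in> set p" | "x \<in> set (take j \<gamma>)" | "x = d" | "x \<in> set (tl ?X)"
          unfolding set_u by blast
        then show ?thesis
        proof cases
          case 2
          then obtain a where "a < j" "x = \<gamma> ! a" using j(1) by (auto simp: in_set_conv_nth)
          then show ?thesis using tail_\<gamma>_inj[of a y] that j(1) by simp
        next
          case 3
          then show ?thesis using td tail_\<gamma>_inj[of j y] that j(1) by simp
        qed (use on p_off tlX in auto)
      qed
      have nth0: "tail m ((?u @ v) ! length p) = tail m (\<gamma> ! 0)" for v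
      proof (cases "j = 0")
        case True
        then have "(?u @ v) ! length p = d" using nthu[of v] j(2) by (metis add_0_right)
        then show ?thesis using td True by simp
      next
        case False
        then have "(?u @ v) ! length p = \<gamma> ! 0" unfolding Pj using j(1) by (simp add: nth_append)
        then show ?thesis by simp
      qed
      \<comment> \<open>The loop obtained from \<gamma> by replacing the arc from \<open>j\<close>
        to \<open>c\<close> by the excursion.\<close>
      have beyond: "lasso_at m (?u @ drop c \<gamma>) (length p)"
        if "j < c" "admissible m \<psi>" "holonomy m \<psi> (take j \<gamma> @ ?X @ drop c \<gamma>) \<noteq> 0" for \<psi> :: "'a \<Rightarrow> 'g::group_add"
      proof (rule lasso_atI[OF _ _ _ _ that(2)])
        show "path_from m (root_vertex m) (?u @ drop c \<gamma>)"
          using path_from_appendI[OF u(1) lu(2)] lu c dropc by simp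
        have "tail m x \<noteq> tail m y" if xu: "x \<in> set ?u" and y: "y \<in> set (drop c \<gamma>)" for x y
        proof
          assume *: "tail m x = tail m y"
          obtain b where "b < length (drop c \<gamma>)" "y = drop c \<gamma> ! b" using y by (metis in_set_conv_nth)
          then have "c + b < k" "y = \<gamma> ! (c + b)" using c(1) by auto
          then show False using below[OF xu, of "c + b"] * \<open>j < c\<close> by simp
        qed
        moreover have "distinct (map (tail m) (drop c \<gamma>))"
          using simple by (metis distinct_drop drop_map simple_loop_iff)
        ultimately show "distinct (map (tail m) (?u @ drop c \<gamma>))"
          by (rule distinct_map_appendI[OF u(2), rotated])
        show "head m (last (?u @ drop c \<gamma>)) = tail m ((?u @ drop c \<gamma>) ! length p)"
        proof -
          have "drop c \<gamma> \<noteq> []" using c(1) by simp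
          then have "last (?u @ drop c \<gamma>) = last (drop c \<gamma>)" by (rule last_appendR)
          also have "\<dots> = last \<gamma>" by (rule last_drop[OF c(1)])
          finally show ?thesis unfolding nth0 using last_\<gamma> by simp
        qed
        show "holonomy m \<psi> (drop (length p) (?u @ drop c \<gamma>)) \<noteq> 0" using that(3) Pj by simp
      qed (use j Pj in simp)
      show ?thesis
      proof (cases "rev m e \<in> Left")
        case True
        \<comment> \<open>An excursion that arrives on the left crosses \<gamma> once, with its last
          half-edge, while the rest contributes nothing: the intersection number is -1.\<close>
        have cr: "holonomy m crossing (v @ xs @ [e] @ v') \<noteq> 0"
          if "list_all right_dart v" "list_all right_dart v'" for v v'
          using crossing_right[OF that(1)] crossing_right[OF that(2)] crossing_right[OF rxs(1)]
            crossing_left[OF ed _ _ True] eX by simp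
        have r\<gamma>: "list_all right_dart v" if "set v \<subseteq> set \<gamma>" for v using that by (auto simp: list_all_iff right_dart_def)
        show ?thesis
        proof (cases "j < c")
          case True
          have "holonomy m crossing (take j \<gamma> @ ?X @ drop c \<gamma>) \<noteq> 0"
            unfolding append_assoc by (rule cr[OF r\<gamma>[OF set_take_subset] r\<gamma>[OF set_drop_subset]])
          from beyond[OF True admissible_crossing this] show ?thesis
            using extI[of "tl ?X @ drop c \<gamma>"] ud by simp
        next
          case False
          \<comment> \<open>If the arrival vertex is not beyond \<open>j\<close>, then
            \<open>?u\<close> has visited it and closes up there.\<close>
          have "lasso_at m ?u (length p + c)"
          proof (rule lasso_atI[OF _ u _ admissible_crossing])
            show "length p + c < length ?u" using False Pj j(1) by simp
            show "head m (last ?u) = tail m (?u ! (length p + c))"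
            proof (cases "c = j")
              case True
              then have "?u ! (length p + c) = d" using nthu[of "[]"] j(2) by (metis append_Nil2)
              then show ?thesis using c td True lu by simp
            next
              case False
              then have "?u ! (length p + c) = \<gamma> ! c" unfolding Pj using \<open>\<not> j < c\<close> j(1) by (simp add: nth_append)
              then show ?thesis using c lu by simp
            qed
            have "drop (length p + c) ?u = drop c (take j \<gamma>) @ xs @ [e] @ []" using False Pj j(1) by simp
            moreover have "set (drop c (take j \<gamma>)) \<subseteq> set \<gamma>" by (meson in_set_dropD in_set_takeD subsetI)
            ultimately show "holonomy m crossing (drop (length p + c) ?u) \<noteq> 0"
              using cr[OF r\<gamma>, of "drop c (take j \<gamma>)" "[]"] by simp
          qed
          then show ?thesis using extI[of "tl ?X"] ud by simp
        qed
      next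
        case False
        have re: "right_dart e" using False eX ed by (simp add: right_dart_def)
        have ru: "list_all right_dart ?u" using Pxs re by simp
        have me: "move e = e" using eX by (simp add: move_def T_def)
        have mu: "map move ?u = map move (?P @ xs) @ [e]" using me by simp
        show ?thesis
        proof (cases "ys = []")
          case True
          \<comment> \<open>The competitor ends with \<open>e\<close>, so it consists of right
            half-edges and is a lasso of the old map.\<close>
          then have "lasso_at m' (map move ?u) j" if "lasso_at m' (map move ?P @ d # q) j" for j
            using that unfolding z' mu by simp
          from this[OF l] have "\<exists>j. lasso_at m ?u j" using lasso_at_move[OF ru root_notin_Left] by blast
          then show ?thesis using extI[of "tl ?X"] ud by auto
        next
          case False
          have ty: "tail m' (hd ys) = head m' e" using pe' False by (cases ys) auto
          \<comment> \<open>The competitor continues after \<open>e\<close>, hence arrives at a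
            vertex not met before. As \<open>\<gamma>\<close> has been visited up to index
            \<open>j\<close>, this puts \<open>c\<close> beyond \<open>j\<close>.\<close>
          have "head m e \<noteq> tail m x" if "x \<in> set ?u" for x
          proof -
            have rx: "right_dart x" using ru that unfolding list_all_iff by blast
            have tx: "tail m' (move x) \<in> set (map (tail m') (map move ?u))"
              using that unfolding set_map by blast
            have "distinct (map (tail m') (map move ?u @ ys))" using dist' unfolding z' mu .
            then have "set (map (tail m') (map move ?u)) \<inter> set (map (tail m') ys) = {}"
              unfolding map_append[of _ "map move ?u"] distinct_append[of "map _ (map move ?u)"] by blast
            moreover have "tail m' (hd ys) \<in> set (map (tail m') ys)" using False by simp
            ultimately have "tail m' (hd ys) \<noteq> tail m' (move x)" using tx disjoint_iff by metis
            then have "head m' (move e) \<noteq> tail m' (move x)" using ty me by simp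
            then show ?thesis using right_dart_tails_eq(3)[OF re rx] by simp
          qed
          note new = this
          have "j < c"
          proof (rule ccontr)
            assume "\<not> j < c"
            then consider "c < j" | "c = j" by linarith
            then show False
            proof cases
              case 1
              then have "\<gamma> ! c \<in> set (take j \<gamma>)" using j(1) by (auto simp: in_set_conv_nth intro!: exI[of _ c])
              then show False using new[of "\<gamma> ! c"] c Pj by simp
            next
              case 2
              have "d \<in> set ?u" unfolding ud by simp
              then show False using new[of d] td c 2 by simp
            qed
          qed
          \<comment> \<open>A theta graph: \<open>?mid\<close> and the excursion both lead from
            index \<open>j\<close> to index \<open>c\<close>. If replacing \<open>?mid\<close> by
            the excursion gives zero holonomy, then the two arcs have different holonomies, as
            otherwise that of \<gamma> would vanish; the excursion followed by the reverse of
            \<open>?mid\<close> is then the loop wanted.\<close>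
          let ?mid = "drop j (take c \<gamma>)"
          let ?r = "map (rev m) (List.rev ?mid)"
          show ?thesis
          proof (cases "holonomy m \<phi> (take j \<gamma> @ ?X @ drop c \<gamma>) = 0")
            case False
            from beyond[OF \<open>j < c\<close> \<phi>(1) False] show ?thesis
              using extI[of "tl ?X @ drop c \<gamma>"] ud by simp
          next
            case True
            have \<gamma>3: "\<gamma> = take j \<gamma> @ ?mid @ drop c \<gamma>"
            proof -
              have "take j (take c \<gamma>) = take j \<gamma>" using \<open>j < c\<close> by (simp add: min_absorb1)
              then have tc: "take c \<gamma> = take j \<gamma> @ ?mid" using append_take_drop_id[of j "take c \<gamma>"] by (simp only:)
              have "(take j \<gamma> @ ?mid) @ drop c \<gamma> = \<gamma>"
                by (subst tc[symmetric]) (rule append_take_drop_id)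
              then show ?thesis unfolding append_assoc by (rule sym)
            qed
            have hol: "holonomy m \<phi> ?X - holonomy m \<phi> ?mid \<noteq> 0"
            proof
              assume "holonomy m \<phi> ?X - holonomy m \<phi> ?mid = 0"
              then have "holonomy m \<phi> ?X = holonomy m \<phi> ?mid" unfolding right_minus_eq .
              then have "holonomy m \<phi> (take j \<gamma> @ ?mid @ drop c \<gamma>) = 0"
                using True by (simp only: holonomy_simps(3))
              then show False using \<phi>(2) unfolding \<gamma>3[symmetric] by blast
            qed
            have mid_sub: "set ?mid \<subseteq> set \<gamma>" by (meson in_set_dropD in_set_takeD subsetI)
            have mid_ne: "?mid \<noteq> []" using \<open>j < c\<close> c by simp
            have len_take: "length (take c \<gamma>) = c" using c by simp
            have "path_from m (tail m (\<gamma> ! 0)) (take c \<gamma>)"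
              using path_\<gamma> path_from_append[of m _ "take c \<gamma>" "drop c \<gamma>"] by simp
            from sublist_path[OF this, of j] have pm: "path_from m (tail m (\<gamma> ! j)) ?mid"
              using \<open>j < c\<close> len_take by simp
            have "last ?mid = last (take c \<gamma>)" by (rule last_drop) (use \<open>j < c\<close> len_take in simp)
            also have "\<dots> = take c \<gamma> ! (c - 1)"
              by (subst last_conv_nth) (use \<open>j < c\<close> len_take in auto)
            also have "\<dots> = \<gamma> ! (c - 1)" by (rule nth_take) (use \<open>j < c\<close> in simp)
            finally have "last ?mid = \<gamma> ! (c - 1)" .
            moreover have "nx (c - 1) = c" using \<open>j < c\<close> c(1) by (simp add: nx_def)
            ultimately have em: "last (visited m (tail m (\<gamma> ! j)) ?mid) = tail m (\<gamma> ! c)"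
              using mid_ne head_\<gamma>[of "c - 1"] c(1) unfolding last_visited by simp
            have r: "path_from m (tail m (\<gamma> ! c)) ?r" "last (visited m (tail m (\<gamma> ! c)) ?r) = tail m (\<gamma> ! j)"
              using path_from_rev[OF pm] unfolding em by auto
            have "lasso_at m (?u @ ?r) i"
            proof (rule lasso_atI[OF _ _ _ _ \<phi>(1)])
              show "i < length (?u @ ?r)" using lenP by simp
              show "path_from m (root_vertex m) (?u @ ?r)"
                using path_from_appendI[OF u(1) lu(2)] lu c r(1) by simp
              have tails: "map (tail m) ?r = List.rev (map (\<lambda>e. tail m (rev m e)) ?mid)" by (simp add: rev_map comp_def)
              have "distinct (map (\<lambda>e. tail m (rev m e)) \<gamma>)"
                by (auto simp: distinct_conv_nth tail_rev_\<gamma>_inj)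
              then have "distinct (drop j (take c (map (\<lambda>e. tail m (rev m e)) \<gamma>)))" by (intro distinct_drop distinct_take)
              then have dr: "distinct (map (tail m) ?r)" unfolding tails by (simp add: drop_map take_map)
              \<comment> \<open>The reversed arc has its tails at the vertices of index
                \<open>Suc j\<close> to \<open>c\<close>, beyond those used by
                \<open>?u\<close>.\<close>
              have sep: "tail m x \<noteq> tail m (rev m y)" if xu: "x \<in> set ?u" and y: "y \<in> set ?mid" for x y
              proof
                assume *: "tail m x = tail m (rev m y)"
                obtain b where b: "b < length ?mid" "y = ?mid ! b" using y by (metis in_set_conv_nth)
                then have b': "j + b < c" "y = \<gamma> ! (j + b)" using c \<open>j < c\<close> by auto
                then have "tail m (rev m y) = tail m (\<gamma> ! Suc (j + b))"
                  using tail_rev_\<gamma>[of "j + b"] c by (simp add: nx_def)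
                then show False using below[OF xu, of "Suc (j + b)"] * b' c by simp
              qed
              show "distinct (map (tail m) (?u @ ?r))"
              proof (rule distinct_map_appendI[OF u(2) dr])
                fix x y assume "x \<in> set ?u" "y \<in> set ?r"
                moreover from this(2) obtain y' where "y' \<in> set ?mid" "y = rev m y'" by auto
                ultimately show "tail m x \<noteq> tail m y" using sep by blast
              qed
              have "(?u @ ?r) ! i = d" by (rule nthu)
              moreover have rne: "?r \<noteq> []" using mid_ne by simp
              then have "last (?u @ ?r) = last ?r" by (rule last_appendR)
              moreover have "head m (last ?r) = tail m (\<gamma> ! j)" using r(2) rne unfolding last_visited by (simp only: if_False)
              ultimately show "head m (last (?u @ ?r)) = tail m ((?u @ ?r) ! i)"
                using td by (simp only:)
              have "holonomy m \<phi> ?r = - holonomy m \<phi> ?mid"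
                by (rule holonomy_rev[OF \<phi>(1)]) (use mid_sub \<gamma>_darts(2) in blast)
              then have "holonomy m \<phi> (?X @ ?r) = holonomy m \<phi> ?X - holonomy m \<phi> ?mid"
                unfolding holonomy_simps(3)[of m \<phi> ?X ?r] by (simp only: add_uminus_conv_diff)
              moreover have "drop i (?u @ ?r) = ?X @ ?r" using lenP by simp
              ultimately show "holonomy m \<phi> (drop i (?u @ ?r)) \<noteq> 0" using hol by (simp only: not_False_eq_True)
            qed
            then show ?thesis using extI[of "tl ?X @ ?r"] ud by simp
          qed
        qed
      qed
    qed
  qed
qed

lemma lasso_at_w': "lasso_at m' (map move w) (length p)"
  using lasso_at_move_iff[OF right_all root_notin_Left] lasso_w by simp

text \<open>Until it reaches \<open>w ! i\<close>, the sweep meets neither \<open>T\<close> nor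
  \<open>Left\<close>. It is therefore the same sweep in both maps, and
  \<open>extendable_move\<close> rules out every half-edge met on the way.\<close>

lemma rightmost_w': "rightmost m' (map move w)"
  unfolding rightmost_def
proof (intro conjI allI impI)
  show w': "map move w \<in> lassos m'" using lasso_at_w' lassos_iff by blast
  fix i assume "i < length (map move w)"
  then have i: "i < length w" by simp
  let ?P = "take i w"
  have "?P @ w ! i # drop (Suc i) w = w" using i by (simp add: id_take_nth_drop[symmetric])
  then have "path_from m (root_vertex m) ((?P @ [w ! i]) @ drop (Suc i) w)" using path_w by simp
  then have "path_from m (root_vertex m) (?P @ [w ! i])" by (simp only: path_from_append)
  then have ts: "tail m (sweep_start m ?P) = tail m (w ! i)" by (rule tail_sweep_start)
  obtain N where N: "turn m ?P N = w ! i" "\<And>n. n < N \<Longrightarrow> \<not> extendable m (?P @ [turn m ?P n])"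
    by (rule rightmost_sweep[OF rightmost i]) (rule that)
  have tt: "tail m (turn m ?P n) = tail m (w ! i)" for n using tail_turn ts by simp
  \<comment> \<open>A half-edge of \<open>T\<close> met too early is either \<open>w ! i\<close>
    itself, which is extendable, or the reverse of one of \<gamma>, which in the rotation is
    preceded by an element of \<open>Left\<close>.\<close>
  have no_T: "turn m ?P n \<notin> T" if c: "c \<notin> Left" "rot m c = turn m ?P n" and n: "n < N" for c n
  proof
    assume t: "turn m ?P n \<in> T"
    then consider l where "l < k" "turn m ?P n = \<gamma> ! l" | l where "l < k" "turn m ?P n = rev m (\<gamma> ! l)"
      unfolding T_cases by blast
    then show False
    proof cases
      case 1
      have "\<not> i < length p" using w_off[of i] tt[of n] 1 unfolding on_cut_def by metis
      then have "w ! i = \<gamma> ! (i - length p)" "i - length p < k" using nth_w i by auto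
      then have "turn m ?P n = w ! i" using tt[of n] 1 tail_\<gamma>_inj[of l "i - length p"] by simp
      then have "extendable m (?P @ [turn m ?P n])"
        using extendable_take[OF _ i] rightmost by (simp add: rightmost_def)
      then show False using N(2)[OF n] by blast
    next
      case 2
      then show False using before_rev_\<gamma>_Left[of l c] c by simp
    qed
  qed
  have prev: "\<exists>c. c \<notin> Left \<and> rot m c = turn m ?P n \<and> rot m' c = turn m' (map move ?P) n"
    if "n = 0 \<or> (\<exists>n'. n = Suc n' \<and> turn m ?P n' \<notin> Left \<and> turn m' (map move ?P) n' = turn m ?P n')" for n
    using that start_notin_Left[OF i] sweep_start'[OF i] by (auto simp: turn_0 turn_Suc)
  have "turn m ?P n \<notin> T \<and> turn m ?P n \<notin> Left \<and> turn m' (map move ?P) n = turn m ?P n" if "n < N" for n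
    using that
  proof (induction n)
    case 0
    obtain c where c: "c \<notin> Left" "rot m c = turn m ?P 0" "rot m' c = turn m' (map move ?P) 0"
      using prev[of 0] by blast
    have "turn m ?P 0 \<notin> T" by (rule no_T[OF c(1,2) 0])
    then show ?case using c Left_step[of c] rot'_other[of c] by simp
  next
    case (Suc n)
    then obtain c where c: "c \<notin> Left" "rot m c = turn m ?P (Suc n)" "rot m' c = turn m' (map move ?P) (Suc n)"
      using prev[of "Suc n"] by auto
    have "turn m ?P (Suc n) \<notin> T" by (rule no_T[OF c(1,2) Suc.prems])
    then show ?case using c Left_step[of c] rot'_other[of c] by simp
  qed
  note free = this
  have "n = 0 \<or> (\<exists>n'. n = Suc n' \<and> turn m ?P n' \<notin> Left \<and> turn m' (map move ?P) n' = turn m ?P n')" if "n = N" for n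
    using free that by (cases n) auto
  then obtain c where c: "c \<notin> Left" "rot m c = turn m ?P N" "rot m' c = turn m' (map move ?P) N"
    using prev[of N] by blast
  have last: "turn m' (map move ?P) N = move (w ! i)"
  proof (cases "w ! i \<in> set \<gamma>")
    case True
    then obtain l where "l < k" "w ! i = \<gamma> ! l" by (auto simp: set_\<gamma>)
    then show ?thesis using rot'_\<gamma>[of l c] c N(1) move_\<gamma> by simp
  next
    case False
    then have "w ! i \<notin> T" using right_dart_notin_T[OF right_w[OF i]] by blast
    then show ?thesis using rot'_other[of c] c N(1) False by (simp add: move_def)
  qed
  show "map move w ! i = next_dart m' (take i (map move w))"
  proof (rule next_dart_eqI[symmetric])
    show "extendable m' (take i (map move w) @ [map move w ! i])"
      using extendable_take[OF w'] i by simp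
    show "turn m' (take i (map move w)) N = map move w ! i" using last i by (simp add: take_map)
    show "\<not> extendable m' (take i (map move w) @ [turn m' (take i (map move w)) n])" if n: "n < N" for n
    proof
      assume "extendable m' (take i (map move w) @ [turn m' (take i (map move w)) n])"
      then have "extendable m' (map move ?P @ [turn m ?P n])" using free[OF n] by (simp add: take_map)
      then have "extendable m (?P @ [turn m ?P n])"
        using extendable_move[OF i _ _ tt] free[OF n] by blast
      then show False using N(2)[OF n] by blast
    qed
  qed
qed

end

section \<open>Quantities preserved by the rotation, and its inverse\<close>

lemma card_image_eqI:
  assumes "\<And>x y. x \<in> A \<Longrightarrow> y \<in> A \<Longrightarrow> f x = f y \<longleftrightarrow> g x = g y"
  shows "card (f ` A) = card (g ` A)"
proof (rule bij_betw_same_card)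
  have inv: "g (inv_into A f (f x)) = g x" if "x \<in> A" for x
  proof -
    have "inv_into A f (f x) \<in> A" "f (inv_into A f (f x)) = f x"
      using that by (auto intro: inv_into_into f_inv_into_f)
    then show ?thesis using assms that by blast
  qed
  show "bij_betw (\<lambda>v. g (inv_into A f v)) (f ` A) (g ` A)"
    unfolding bij_betw_def inj_on_def image_image
    using inv assms by (auto cong: image_cong_simp)
qed

context rooted_map
begin

lemma Union_edges: "\<Union>(edges m) = darts m"
  by (auto simp: edges_def)

lemma card_edge: "c \<in> edges m \<Longrightarrow> card c = 2"
  using rev_neq by (auto simp: edges_def card_2_iff)

lemma edges_disjoint:
  assumes c: "c1 \<in> edges m" "c2 \<in> edges m" "c1 \<noteq> c2"
  shows "c1 \<inter> c2 = {}"
proof (rule ccontr)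
  have e: "{d, rev m d} = {d', rev m d'}" if "d \<in> darts m" "d' \<in> {d, rev m d}" for d d'
    using that rev_rev[OF that(1)] by auto
  assume "c1 \<inter> c2 \<noteq> {}"
  then obtain x where x: "x \<in> c1" "x \<in> c2" by blast
  obtain d where d: "d \<in> darts m" "c1 = {d, rev m d}" using c(1) by (auto simp: edges_def)
  obtain d' where d': "d' \<in> darts m" "c2 = {d', rev m d'}" using c(2) by (auto simp: edges_def)
  show False using e[OF d(1), of x] e[OF d'(1), of x] x d(2) d'(2) c(3) by simp
qed

lemma finite_edges: "finite (edges m)"
  using finite_darts by (simp add: edges_def)

lemma card_edges: "2 * card (edges m) = card (darts m)"
proof -
  have "2 * card (edges m) = card (\<Union>(edges m))"
    by (rule card_partition) (use finite_edges Union_edges finite_darts card_edge edges_disjoint in auto)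
  then show ?thesis using Union_edges by simp
qed

end

context cut
begin

interpretation m': rooted_map m'
  by unfold_locales (rule is_map_m')

lemma card_edges_m': "card (edges m') = card (edges m)"
  using card_edges m'.card_edges by simp

lemma faces_m': "faces m' = faces m"
  by (simp add: faces_def)

text \<open>Each vertex of either map contains half-edges outside \<open>Left\<close>, and these are
  grouped into vertices in the same way by both maps.\<close>

lemma card_vertices_m': "card (vertices m') = card (vertices m)"
proof -
  have rep: "\<exists>t\<in>darts m - Left. tail m t = tail m d" and rep': "\<exists>t\<in>darts m - Left. tail m' t = tail m' d"
    if d: "d \<in> darts m" for d
  proof -
    have r: "rev m (\<gamma> ! j) \<in> darts m - Left" if "j < k" for j
      using \<gamma>_darts(1)[OF that] rev_\<gamma>_Right(2)[OF that] by simp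
    have "(\<exists>t\<in>darts m - Left. tail m t = tail m d) \<and> (\<exists>t\<in>darts m - Left. tail m' t = tail m' d)"
    proof (cases "d \<in> Left")
      case True
      then obtain i where i: "i < k" "tail m d = tail m (\<gamma> ! i)" "tail m' d = tail m' (\<gamma> ! i)" using Left_tails by blast
      obtain j where j: "j < k" "nx j = i" using nx_surj[OF i(1)] by blast
      obtain i' where i': "i' < k" "sh \<epsilon> i' = i" using sh_surj[OF i(1), of \<epsilon>] by blast
      obtain j' where j': "j' < k" "nx j' = i'" using nx_surj[OF i'(1)] by blast
      have "tail m (rev m (\<gamma> ! j)) = tail m d" using tail_rev_\<gamma>[OF j(1)] j i by simp
      moreover have "tail m' (rev m (\<gamma> ! j')) = tail m' d" using tail'_\<gamma>[OF j'(1)] j' i' i by simp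
      ultimately show ?thesis using r[OF j(1)] r[OF j'(1)] by blast
    qed (use d in blast)
    then show "\<exists>t\<in>darts m - Left. tail m t = tail m d" "\<exists>t\<in>darts m - Left. tail m' t = tail m' d" by auto
  qed
  have "vertices m = tail m ` (darts m - Left)" using rep unfolding vertices_def by (auto; metis DiffI imageI)
  moreover have "vertices m' = tail m' ` (darts m - Left)" using rep' unfolding vertices_def m'_simps by (auto; metis DiffI imageI)
  moreover have "card (tail m' ` (darts m - Left)) = card (tail m ` (darts m - Left))"
    by (rule card_image_eqI) (use tail'_iff in auto)
  ultimately show ?thesis by simp
qed

end

theorem (in rooted_map) psi_properties:
  assumes "lassos m \<noteq> {}"
  shows "is_map (psi \<epsilon> m)" "darts (psi \<epsilon> m) = darts m" "nxt (psi \<epsilon> m) = nxt m" "faces (psi \<epsilon> m) = faces m"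
    "card (edges (psi \<epsilon> m)) = card (edges m)" "card (vertices (psi \<epsilon> m)) = card (vertices m)"
    "psi (opposite \<epsilon>) (psi \<epsilon> m) = m"
proof -
  define w where "w = rightmost_lasso m"
  have rm: "rightmost m w" unfolding w_def by (rule rightmost_exists[OF assms])
  then obtain j where j: "lasso_at m w j" by (auto simp: rightmost_def lassos_iff)
  then have jw: "j < length w" by (simp add: lasso_at_def)
  let ?p = "take j w" and ?\<gamma> = "drop j w"
  have l: "lasso m ?p ?\<gamma>" using j jw by (simp add: lasso_iff min_def)
  have simple: "simple_loop m ?\<gamma>" and nc: "noncontractible m ?\<gamma>" using l by (auto simp: lasso_def)
  interpret rc: rightmost_cut m ?\<gamma> \<epsilon> ?p w
    by unfold_locales
       (use simple noncontractible_disjoint[OF simple nc] rm j jw in \<open>auto simp: min_def\<close>)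
  have loop: "rightmost_loop m = ?\<gamma>" by (rule rightmost_loop_eq[OF rm j])
  have psi: "psi \<epsilon> m = rc.m'" by (simp add: psi_def rotation_def rc.m'_def loop)
  \<comment> \<open>The equality of the rightmost loop with the image loop is one of lists: renaming
    by \<open>rc.move\<close> keeps the starting point, aligned with the right copies.\<close>
  have "rightmost_loop rc.m' = drop (length ?p) (map rc.move w)"
    by (rule rightmost_loop_eq[OF rc.rightmost_w' rc.lasso_at_w'])
  also have "\<dots> = map rc.move ?\<gamma>" using jw by (simp add: drop_map min_def)
  also have "\<dots> = rc.\<gamma>'" by (rule rc.map_move_\<gamma>)
  finally have loop': "rightmost_loop rc.m' = rc.\<gamma>'" .
  interpret c': cut rc.m' rc.\<gamma>' "opposite \<epsilon>" by (rule rc.cut')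
  have "psi (opposite \<epsilon>) rc.m' = c'.m'" by (simp add: psi_def rotation_def c'.m'_def loop')
  then show "psi (opposite \<epsilon>) (psi \<epsilon> m) = m" using rc.c'_m' psi by simp
  show "is_map (psi \<epsilon> m)" "darts (psi \<epsilon> m) = darts m" "nxt (psi \<epsilon> m) = nxt m" "faces (psi \<epsilon> m) = faces m"
    "card (edges (psi \<epsilon> m)) = card (edges m)" "card (vertices (psi \<epsilon> m)) = card (vertices m)"
    unfolding psi by (simp_all add: rc.is_map_m' rc.faces_m' rc.card_edges_m' rc.card_vertices_m')
qed

section \<open>Existence of lassos in positive genus\<close>

context rooted_map
begin

lemma path_to_vertex:
  assumes "d \<in> darts m"
  shows "\<exists>q. path_from m (root_vertex m) q \<and> last (visited m (root_vertex m) q) = tail m d"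
proof -
  let ?R = "{(d, rev m d) |d. d \<in> darts m} \<union> {(d, rot m d) |d. d \<in> darts m}"
  have "(root m, d) \<in> ?R\<^sup>*" using connected root_in assms by (simp add: connected_darts_def)
  then show ?thesis
  proof (induction rule: rtrancl_induct)
    case base
    show ?case by (rule exI[of _ "[]"]) (simp add: root_vertex_def)
  next
    case (step x y)
    then obtain q where q: "path_from m (root_vertex m) q" "last (visited m (root_vertex m) q) = tail m x" by blast
    from step(2) consider "x \<in> darts m" "y = rev m x" | "y = rot m x" by blast
    then show ?case
    proof cases
      case 1
      then show ?thesis using q by (intro exI[of _ "q @ [x]"]) (simp add: path_from_append last_visited head_def)
    next
      case 2
      then show ?thesis using q by auto
    qed
  qed
qed

text \<open>At a repeated vertex the loop splits into an inner loop and the rest. If the inner loop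
  has zero holonomy, the rest inherits the whole holonomy; one of the two shorter loops is therefore
  good.\<close>

lemma simple_loop_of_holonomy:
  fixes \<phi> :: "'a \<Rightarrow> 'g::group_add"
  assumes "is_loop m p" "holonomy m \<phi> p \<noteq> 0"
  shows "\<exists>q. is_loop m q \<and> holonomy m \<phi> q \<noteq> 0 \<and> distinct (map (tail m) q)"
  using assms
proof (induction "length p" arbitrary: p rule: less_induct)
  case less
  have path: "path_from m (tail m (hd p)) p" and closed: "head m (last p) = tail m (hd p)" and ne: "p \<noteq> []"
    using less.prems(1) by (auto simp: is_loop_iff)
  show ?case
  proof (cases "distinct (map (tail m) p)")
    case False
    then obtain i0 j0 where ij0: "i0 < length p" "j0 < length p" "i0 \<noteq> j0" "tail m (p ! i0) = tail m (p ! j0)"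
      by (auto simp: distinct_conv_nth)
    define i j where "i = min i0 j0" and "j = max i0 j0"
    have ij: "i < j" "j < length p" "tail m (p ! i) = tail m (p ! j)"
      using ij0 by (auto simp: i_def j_def min_def max_def)
    let ?A = "take i p" and ?B = "drop i (take j p)" and ?C = "drop j p"
    have tj: "take j p = ?A @ ?B" using append_take_drop_id[of i "take j p"] ij by (simp add: min_absorb1)
    have p: "(?A @ ?B) @ ?C = p" by (subst tj[symmetric]) (rule append_take_drop_id)
    have "path_from m (tail m (hd p)) ((?A @ ?B) @ ?C)" using path by (simp only: p)
    then have split: "path_from m (tail m (hd p)) ?A" "path_from m (last (visited m (tail m (hd p)) ?A)) ?B"
      "path_from m (last (visited m (tail m (hd p)) (?A @ ?B))) ?C"
      by (simp_all only: path_from_append)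
    have lens: "length ?A = i" "length ?B = j - i" "length ?C = length p - j" using ij by auto
    have ne': "?B \<noteq> []" "?C \<noteq> []" using ij by auto
    have hds: "hd ?B = p ! i" "hd ?C = p ! j" using ij by (auto simp: hd_drop_conv_nth)
    note pA = split(1) and pB = split(2)
    have "last (visited m (tail m (hd p)) (?A @ ?B)) = head m (last ?B)" using ne'(1) unfolding last_visited by simp
    then have pC: "path_from m (head m (last ?B)) ?C" using split(3) by simp
    have vA: "last (visited m (tail m (hd p)) ?A) = tail m (p ! i)"
      using pB ne'(1) hds(1) by (cases ?B) auto
    have vB: "head m (last ?B) = tail m (p ! j)"
      using pC ne' hds(2) by (cases ?C) auto
    have B: "is_loop m ?B" using pB vB vA ij(3) ne' hds by (simp add: is_loop_iff)
    have "path_from m (tail m (hd p)) (?A @ ?C)"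
      using pA pC vA vB ij(3) ne' by (simp add: path_from_append last_visited)
    moreover have "tail m (hd (?A @ ?C)) = tail m (hd p)"
    proof (cases "i = 0")
      case True
      then show ?thesis using hds(2) ij ne by (simp add: hd_conv_nth)
    next
      case False
      then have "?A \<noteq> []" using ne by simp
      then show ?thesis by (simp add: hd_append)
    qed
    moreover have "last (?A @ ?C) = last p" using ne' ij by (simp add: last_drop)
    ultimately have AC: "is_loop m (?A @ ?C)" using closed ne' by (simp add: is_loop_iff)
    have hol: "holonomy m \<phi> p = holonomy m \<phi> ?A + holonomy m \<phi> ?B + holonomy m \<phi> ?C"
    proof -
      have "holonomy m \<phi> ((?A @ ?B) @ ?C) = holonomy m \<phi> ?A + holonomy m \<phi> ?B + holonomy m \<phi> ?C"
        by (simp only: holonomy_simps(3))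
      then show ?thesis unfolding p .
    qed
    show ?thesis
    proof (cases "holonomy m \<phi> ?B = 0")
      case True
      then have "holonomy m \<phi> (?A @ ?C) \<noteq> 0" using hol less.prems(2) by simp
      moreover have "length (?A @ ?C) < length p" using ij by simp
      ultimately show ?thesis using less.hyps AC by blast
    next
      case False
      moreover have "length ?B < length p" using ij by simp
      ultimately show ?thesis using less.hyps B by blast
    qed
  qed (use less.prems in blast)
qed

text \<open>A shortest path from the root vertex to the loop is simple and meets the loop only at
  its end; there the loop is made to start.\<close>

lemma lasso_of_holonomy:
  fixes \<phi> :: "'a \<Rightarrow> 'g::group_add"
  assumes adm: "admissible m \<phi>" and "is_loop m p0" "holonomy m \<phi> p0 \<noteq> 0"
  shows "lassos m \<noteq> {}"
proof -
  obtain p where p: "is_loop m p" "holonomy m \<phi> p \<noteq> 0" "distinct (map (tail m) p)"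
    using simple_loop_of_holonomy[OF assms(2,3)] by blast
  have path: "path_from m (tail m (hd p)) p" and closed: "head m (last p) = tail m (hd p)" and ne: "p \<noteq> []"
    using p(1) by (auto simp: is_loop_iff)
  define Q where "Q q \<longleftrightarrow> path_from m (root_vertex m) q \<and> last (visited m (root_vertex m) q) \<in> tail m ` set p" for q
  have "hd p \<in> darts m" using path ne by (cases p) auto
  then have "\<exists>q. Q q" using path_to_vertex[of "hd p"] ne unfolding Q_def by fastforce
  then obtain q where q: "Q q" and min: "\<And>q'. Q q' \<Longrightarrow> length q \<le> length q'"
    using ex_has_least_nat[of Q _ length] by blast
  have pq: "path_from m (root_vertex m) q" using q by (simp add: Q_def)
  have split: "last (visited m (root_vertex m) (take i q)) = tail m (q ! i)" "path_from m (root_vertex m) (take i q)"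
    if "i < length q" for i
  proof -
    have "path_from m (root_vertex m) (take i q @ drop i q)" using pq by simp
    then have 1: "path_from m (root_vertex m) (take i q)" "path_from m (last (visited m (root_vertex m) (take i q))) (drop i q)"
      by (simp_all only: path_from_append)
    then show "path_from m (root_vertex m) (take i q)" by blast
    show "last (visited m (root_vertex m) (take i q)) = tail m (q ! i)"
      using 1(2) Cons_nth_drop_Suc[OF that] by (metis path_from.simps(2))
  qed
  have off: "tail m (q ! i) \<notin> tail m ` set p" if "i < length q" for i
  proof
    assume "tail m (q ! i) \<in> tail m ` set p"
    then have "Q (take i q)" using split[OF that] by (simp add: Q_def)
    then show False using min[of "take i q"] that by simp
  qed
  have dist: "distinct (map (tail m) q)"
  proof (rule ccontr)
    assume "\<not> ?thesis"
    then obtain i0 j0 where ij0: "i0 < length q" "j0 < length q" "i0 \<noteq> j0" "tail m (q ! i0) = tail m (q ! j0)"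
      by (auto simp: distinct_conv_nth)
    define i j where "i = min i0 j0" and "j = max i0 j0"
    have ij: "i < j" "j < length q" "tail m (q ! i) = tail m (q ! j)"
      using ij0 by (auto simp: i_def j_def min_def max_def)
    have "path_from m (tail m (q ! j)) (drop j q)" by (rule sublist_path[OF pq ij(2)])
    then have "path_from m (root_vertex m) (take i q @ drop j q)"
      using split[of i] ij by (simp add: path_from_append)
    moreover have "last (visited m (root_vertex m) (take i q @ drop j q)) = last (visited m (root_vertex m) q)"
    proof -
      have "q \<noteq> []" using ij by auto
      then show ?thesis using ij by (simp add: last_visited last_drop)
    qed
    ultimately have "Q (take i q @ drop j q)" using q by (simp add: Q_def)
    then show False using min[of "take i q @ drop j q"] ij by simp
  qed
  obtain c where c: "c < length p" "last (visited m (root_vertex m) q) = tail m (p ! c)"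
    using q by (auto simp: Q_def in_set_conv_nth)
  let ?r = "drop c p @ take c p"
  have "path_from m (tail m (hd p)) (take c p)"
    using path path_from_append[of m _ "take c p" "drop c p"] by simp
  then have pr: "path_from m (tail m (p ! c)) ?r"
    using sublist_path[OF path c(1)] c closed by (intro path_from_appendI) (simp_all add: last_drop)
  have endc: "last (visited m (tail m (hd p)) (take c p)) = tail m (p ! c)"
  proof -
    have "path_from m (last (visited m (tail m (hd p)) (take c p))) (drop c p)"
      using path path_from_append[of m _ "take c p" "drop c p"] by simp
    then show ?thesis using Cons_nth_drop_Suc[OF c(1)] by (metis path_from.simps(2))
  qed
  have lr: "head m (last ?r) = tail m (p ! c)"
  proof (cases "c = 0")
    case True
    then show ?thesis using closed ne by (simp add: hd_conv_nth)
  next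
    case False
    then have "take c p \<noteq> []" using ne by simp
    then show ?thesis using endc unfolding last_visited by simp
  qed
  have rne: "?r \<noteq> []" using c(1) by simp
  have "lasso_at m (q @ ?r) (length q)"
  proof (rule lasso_atI[OF _ _ _ _ adm])
    show "length q < length (q @ ?r)" using c(1) by auto
    show "path_from m (root_vertex m) (q @ ?r)" using pq pr c(2) by (simp add: path_from_append)
    have "distinct (map (tail m) (take c p @ drop c p))" using p(3) by simp
    then have dr: "distinct (map (tail m) ?r)" unfolding map_append distinct_append by blast
    show "distinct (map (tail m) (q @ ?r))"
    proof (rule distinct_map_appendI[OF dist dr])
      fix x y assume xy: "x \<in> set q" "y \<in> set ?r"
      then have "y \<in> set p" by (auto dest: in_set_takeD in_set_dropD)
      moreover obtain i where "i < length q" "x = q ! i" using xy(1) by (metis in_set_conv_nth)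
      ultimately show "tail m x \<noteq> tail m y" using off[of i] by auto
    qed
    have "last (q @ ?r) = last ?r" using rne by (rule last_appendR)
    moreover have "(q @ ?r) ! length q = p ! c"
      using nth_append_length_plus[of q ?r 0] c(1) by (simp only: add_0_right) (simp add: nth_append)
    ultimately show "head m (last (q @ ?r)) = tail m ((q @ ?r) ! length q)" using lr by simp
    have "holonomy m \<phi> (take c p) + holonomy m \<phi> (drop c p) \<noteq> 0"
      using p(2) holonomy_simps(3)[of m \<phi> "take c p" "drop c p"] by simp
    then have "holonomy m \<phi> (drop c p) + holonomy m \<phi> (take c p) \<noteq> 0" using add_eq_0_commute by metis
    then show "holonomy m \<phi> (drop (length q) (q @ ?r)) \<noteq> 0" by simp
  qed
  then show ?thesis using lassos_iff by blast
qed

text \<open>When all loops have zero holonomy, the holonomy of a path from the root vertex depends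
  on the end of the path only, and this is \<open>f\<close>.\<close>

lemma coboundary_of_trivial_holonomy:
  fixes \<phi> :: "'a \<Rightarrow> 'g::group_add"
  assumes zero: "\<And>p. is_loop m p \<Longrightarrow> holonomy m \<phi> p = 0" and adm: "admissible m \<phi>"
  obtains f where "f (root_vertex m) = 0" "\<And>d. d \<in> darts m \<Longrightarrow> f (tail m d) + (- \<phi> d + \<phi> (nxt m d)) = f (head m d)"
proof -
  let ?rv = "root_vertex m"
  have "\<exists>q. v \<in> vertices m \<longrightarrow> path_from m ?rv q \<and> last (visited m ?rv q) = v" for v
    using path_to_vertex unfolding vertices_def by blast
  then obtain K where K: "\<And>v. v \<in> vertices m \<Longrightarrow> path_from m ?rv (K v) \<and> last (visited m ?rv (K v)) = v"
    by metis
  have loop: "holonomy m \<phi> p = 0" if "path_from m ?rv p" "last (visited m ?rv p) = ?rv" for p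
  proof (cases "p = []")
    case False
    then have "tail m (hd p) = ?rv" using that(1) by (cases p) auto
    then have "is_loop m p" using that False unfolding is_loop_iff last_visited by simp
    then show ?thesis by (rule zero)
  qed simp
  have rv: "?rv \<in> vertices m" using root_in by (simp add: vertices_def root_vertex_def)
  show ?thesis
  proof (rule that[of "\<lambda>v. holonomy m \<phi> (K v)"])
    show "holonomy m \<phi> (K ?rv) = 0" using loop K[OF rv] by blast
    fix d assume d: "d \<in> darts m"
    have vt: "tail m d \<in> vertices m" "head m d \<in> vertices m" using d by (auto simp: vertices_def head_def)
    let ?r = "map (rev m) (List.rev (K (head m d)))"
    have Kh: "path_from m ?rv (K (head m d))" "last (visited m ?rv (K (head m d))) = head m d"
      using K[OF vt(2)] by auto
    have r: "path_from m (head m d) ?r" "last (visited m (head m d) ?r) = ?rv"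
      using path_from_rev[OF Kh(1)] unfolding Kh(2) by auto
    have h: "last (visited m ?rv (K (tail m d) @ [d])) = head m d" by (simp add: last_visited)
    have pd: "path_from m ?rv (K (tail m d) @ [d])" using K[OF vt(1)] d by (simp add: path_from_append)
    have pl: "path_from m ?rv ((K (tail m d) @ [d]) @ ?r)"
      using pd r(1) h unfolding path_from_append[of m ?rv "K (tail m d) @ [d]"] by simp
    have "last (visited m ?rv ((K (tail m d) @ [d]) @ ?r)) = ?rv"
    proof (cases "?r = []")
      case True
      then show ?thesis using h r(2) by (simp add: last_visited)
    next
      case False
      then have "last ((K (tail m d) @ [d]) @ ?r) = last ?r" by (rule last_appendR)
      then show ?thesis using r(2) False unfolding last_visited by simp
    qed
    then have "holonomy m \<phi> ((K (tail m d) @ [d]) @ ?r) = 0" by (rule loop[OF pl])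
    moreover have "holonomy m \<phi> ?r = - holonomy m \<phi> (K (head m d))"
      by (rule holonomy_rev[OF adm path_from_darts[OF Kh(1)]])
    ultimately have "holonomy m \<phi> (K (tail m d) @ [d]) + - holonomy m \<phi> (K (head m d)) = 0"
      by (simp only: holonomy_simps(3))
    then have "holonomy m \<phi> (K (tail m d) @ [d]) = holonomy m \<phi> (K (head m d))"
      unfolding add_uminus_conv_diff right_minus_eq .
    then show "holonomy m \<phi> (K (tail m d)) + (- \<phi> d + \<phi> (nxt m d)) = holonomy m \<phi> (K (head m d))" by simp
  qed
qed

lemma bit_add_self: "x + x = (0 :: bit)"
  by (cases "x = 0") auto

lemma sum_pair: "a \<noteq> b \<Longrightarrow> sum f {a, b} = f a + f b"
  by simp

lemma bit_minus: "- x = (x :: bit)"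
  using bit_add_self[of x] by (metis minus_unique)

text \<open>
  Counting labelings with values in the two-element group: if all holonomies vanish, then a labeling
  is a function of the faces plus a function of the vertices, while there are at least
  \<open>2 ^ (card (edges m) + 1)\<close> labelings.
\<close>

lemma euler_ge_2:
  assumes zero: "\<And>(\<phi> :: 'a \<Rightarrow> bit) p. admissible m \<phi> \<Longrightarrow> is_loop m p \<Longrightarrow> holonomy m \<phi> p = 0"
  shows "card (edges m) + 2 \<le> card (faces m) + card (vertices m)"
proof -
  let ?rv = "root_vertex m" and ?D = "darts m"
  define \<Phi> where "\<Phi> = {\<phi> \<in> ?D \<rightarrow>\<^sub>E (UNIV :: bit set). admissible m \<phi>}"
  have fin: "finite (faces m)" "finite (vertices m)" using finite_darts by (simp_all add: faces_def vertices_def)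
  have rv: "?rv \<in> vertices m" using root_in by (simp add: vertices_def root_vertex_def)
  have UNIV2: "(UNIV :: bit set) = {0, 1}" by (auto simp del: bit_not_one_iff)
  have c2: "card (UNIV :: bit set) = 2" "finite (UNIV :: bit set)" unfolding UNIV2 by auto
  have cardP: "card (A \<rightarrow>\<^sub>E (UNIV :: bit set)) = 2 ^ card A" "finite (A \<rightarrow>\<^sub>E (UNIV :: bit set))"
    if "finite A" for A :: "'c set" using that c2 by (simp_all add: card_PiE finite_PiE)
  \<comment> \<open>The function of the vertices is normalized to vanish at the root vertex, which
    lowers the exponent of the upper bound by one.\<close>
  define V' where "V' = vertices m - {?rv}"
  let ?G = "\<lambda>(C, f). \<lambda>d\<in>?D. C (orbit (nxt m) d) + (if tail m d = ?rv then 0 else f (tail m d)) :: bit"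
  have perm: "permutation (nxt m)" using nxt_permutes finite_darts permutation_permutes by blast
  have "\<Phi> \<subseteq> ?G ` ((faces m \<rightarrow>\<^sub>E UNIV) \<times> (V' \<rightarrow>\<^sub>E UNIV))"
  proof
    fix \<phi> assume \<phi>: "\<phi> \<in> \<Phi>"
    then have adm: "admissible m \<phi>" and ext: "\<phi> \<in> ?D \<rightarrow>\<^sub>E UNIV" by (auto simp: \<Phi>_def)
    obtain f where f: "f ?rv = 0" "\<And>d. d \<in> ?D \<Longrightarrow> f (tail m d) + (- \<phi> d + \<phi> (nxt m d)) = f (head m d)"
      using coboundary_of_trivial_holonomy[OF zero[OF adm] adm] by blast
    define c where "c d = \<phi> d - f (tail m d)" for d
    have c_nxt: "c (nxt m d) = c d" if d: "d \<in> ?D" for d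
    proof -
      have "f (tail m (nxt m d)) = f (tail m d) + (- \<phi> d + \<phi> (nxt m d))" using f(2)[OF d] tail_nxt[OF d] by simp
      then show ?thesis by (simp add: c_def algebra_simps del: add_bit_eq_xor)
    qed
    have c_orbit: "c e = c d" if "d \<in> ?D" "e \<in> orbit (nxt m) d" for d e
    proof -
      have "e \<in> ?D \<and> c e = c d" using that(2)
        by induction (use that(1) c_nxt in auto)
      then show ?thesis ..
    qed
    define C where "C = (\<lambda>F\<in>faces m. c (SOME d. d \<in> F))"
    have C: "C (orbit (nxt m) d) = c d" if d: "d \<in> ?D" for d
    proof -
      have "(SOME e. e \<in> orbit (nxt m) d) \<in> orbit (nxt m) d"
        using permutation_self_in_orbit[OF perm] by (rule someI)
      then show ?thesis using c_orbit[OF d] d by (simp add: C_def faces_def)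
    qed
    have "\<phi> = ?G (C, restrict f V')"
    proof (rule PiE_ext[OF ext])
      show "?G (C, restrict f V') \<in> ?D \<rightarrow>\<^sub>E UNIV" by auto
      fix d assume d: "d \<in> ?D"
      have "(if tail m d = ?rv then 0 else restrict f V' (tail m d)) = f (tail m d)"
        using f(1) d by (simp add: V'_def vertices_def)
      then show "\<phi> d = ?G (C, restrict f V') d" using d C[OF d] by (simp add: c_def del: add_bit_eq_xor)
    qed
    moreover have "(C, restrict f V') \<in> (faces m \<rightarrow>\<^sub>E UNIV) \<times> (V' \<rightarrow>\<^sub>E UNIV)" by (auto simp: C_def)
    ultimately show "\<phi> \<in> ?G ` ((faces m \<rightarrow>\<^sub>E UNIV) \<times> (V' \<rightarrow>\<^sub>E UNIV))" by blast
  qed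
  moreover have finV': "finite V'" using fin by (simp add: V'_def)
  ultimately have "card \<Phi> \<le> card ((faces m \<rightarrow>\<^sub>E (UNIV :: bit set)) \<times> (V' \<rightarrow>\<^sub>E (UNIV :: bit set)))"
    using cardP(2)[OF fin(1)] cardP(2)[OF finV'] by (intro surj_card_le) auto
  also have "\<dots> = 2 ^ card (faces m) * 2 ^ card V'"
    by (simp add: card_cartesian_product cardP(1)[OF fin(1)] cardP(1)[OF finV'])
  finally have upper: "card \<Phi> \<le> 2 ^ (card (faces m) + card V')" by (simp add: power_add)
  \<comment> \<open>Summed over all edges, the conditions of admissibility involve each label twice
    and cancel. So the condition at the single edge \<open>e0\<close> follows from the others, which
    gains one more factor 2 in the lower bound.\<close>
  define e0 where "e0 = {root m, rev m (root m)}"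
  have e0: "e0 \<in> edges m" using root_in by (auto simp: e0_def edges_def)
  define E' where "E' = edges m - {e0}"
  have finE': "finite E'" using finite_edges by (simp add: E'_def)
  define S where "S \<phi> = (\<lambda>e\<in>E'. \<Sum>d\<in>e. \<phi> d + \<phi> (nxt m d))" for \<phi> :: "'a \<Rightarrow> bit"
  let ?A = "?D \<rightarrow>\<^sub>E (UNIV :: bit set)"
  have finA: "finite ?A" by (rule cardP(2)[OF finite_darts])
  have fin\<Phi>: "finite \<Phi>" using finA by (simp add: \<Phi>_def)
  \<comment> \<open>Subtracting one element embeds a fibre of \<open>S\<close> into the admissible
    labelings, which are the solutions of the homogeneous conditions.\<close>
  have fiber: "card {\<phi> \<in> ?A. S \<phi> = y} \<le> card \<Phi>" if y: "y \<in> S ` ?A" for y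
  proof -
    obtain \<phi>0 where \<phi>0: "\<phi>0 \<in> ?A" "y = S \<phi>0" using y by blast
    let ?h = "\<lambda>\<phi>. \<lambda>d\<in>?D. \<phi> d - \<phi>0 d"
    have "inj_on ?h ?A"
    proof (rule inj_onI)
      fix \<phi>1 \<phi>2 assume *: "\<phi>1 \<in> ?A" "\<phi>2 \<in> ?A" "?h \<phi>1 = ?h \<phi>2"
      show "\<phi>1 = \<phi>2"
      proof (rule PiE_ext[OF *(1,2)])
        fix d assume d: "d \<in> ?D"
        have "\<phi>1 d - \<phi>0 d = \<phi>2 d - \<phi>0 d" using fun_cong[OF *(3), of d] by (simp only: restrict_apply' d)
        then have "\<phi>1 d - \<phi>0 d + \<phi>0 d = \<phi>2 d - \<phi>0 d + \<phi>0 d" by (simp only:)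
        then show "\<phi>1 d = \<phi>2 d" by (simp only: diff_add_cancel)
      qed
    qed
    then have inj: "inj_on ?h {\<phi> \<in> ?A. S \<phi> = y}" by (rule inj_on_subset) auto
    have "?h \<phi> \<in> \<Phi>" if \<phi>: "\<phi> \<in> ?A" "S \<phi> = y" for \<phi>
    proof -
      let ?\<psi> = "?h \<phi>"
      let ?s = "\<lambda>d. ?\<psi> d + ?\<psi> (nxt m d)"
      have sE': "sum ?s e = 0" if e: "e \<in> E'" for e
      proof -
        have "e \<subseteq> ?D" using e Union_edges by (auto simp: E'_def)
        then have "sum ?s e = (\<Sum>d\<in>e. (\<phi> d + \<phi> (nxt m d)) - (\<phi>0 d + \<phi>0 (nxt m d)))"
          by (intro sum.cong) (auto simp: algebra_simps simp del: add_bit_eq_xor)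
        also have "\<dots> = S \<phi> e - S \<phi>0 e" by (simp only: S_def restrict_apply'[OF e] sum_subtractf)
        finally show ?thesis using \<phi>(2) \<phi>0(2) by simp
      qed
      have "sum ?s ?D = sum ?\<psi> ?D + sum (?\<psi> \<circ> nxt m) ?D" by (simp only: sum.distrib comp_def)
      also have "sum (?\<psi> \<circ> nxt m) ?D = sum ?\<psi> ?D" by (rule sum.permute[OF nxt_permutes, symmetric])
      finally have "sum ?s ?D = 0" by (simp only: bit_add_self)
      moreover have "sum ?s (\<Union>(edges m)) = sum (sum ?s) (edges m)"
      proof -
        have "\<forall>e\<in>edges m. finite e" by (auto simp: edges_def)
        moreover have "\<forall>e\<in>edges m. \<forall>e'\<in>edges m. e \<noteq> e' \<longrightarrow> e \<inter> e' = {}" using edges_disjoint by blast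
        ultimately have "sum ?s (\<Union>(edges m)) = (sum \<circ> sum) ?s (edges m)" by (rule sum.Union_disjoint)
        then show ?thesis by (simp only: comp_def)
      qed
      ultimately have "sum (sum ?s) (edges m) = 0" by (simp only: Union_edges)
      moreover have "sum (sum ?s) (edges m) = sum ?s e0 + sum (sum ?s) E'"
        unfolding E'_def by (rule sum.remove[OF finite_edges e0])
      moreover have "sum (sum ?s) E' = 0" using sE' by (intro sum.neutral) blast
      ultimately have "sum ?s e0 = 0" by (simp only: add_0_right)
      then have all: "sum ?s e = 0" if "e \<in> edges m" for e 
      proof (cases "e = e0")
        case True
        then show ?thesis using \<open>sum ?s e0 = 0\<close> by (simp only:)
      next
        case False
        then show ?thesis by (intro sE') (use that in \<open>simp add: E'_def\<close>)
      qed
      have "admissible m ?\<psi>"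
        unfolding admissible_def
      proof
        fix d assume d: "d \<in> ?D"
        have "sum ?s {d, rev m d} = 0" by (rule all) (use d in \<open>auto simp: edges_def\<close>)
        moreover have "sum ?s {d, rev m d} = ?s d + ?s (rev m d)" by (rule sum_pair) (rule rev_neq[OF d, symmetric])
        ultimately have "?s d + ?s (rev m d) = 0" by (simp only:)
        then have "?s (rev m d) = - ?s d" by (rule minus_unique[symmetric])
        then show "- ?\<psi> (rev m d) + ?\<psi> (nxt m (rev m d)) = - (- ?\<psi> d + ?\<psi> (nxt m d))" by (simp only: bit_minus)
      qed
      then show ?thesis by (simp add: \<Phi>_def)
    qed
    then have "?h ` {\<phi> \<in> ?A. S \<phi> = y} \<subseteq> \<Phi>" by blast
    then show ?thesis using card_inj_on_le[OF inj _ fin\<Phi>] by blast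
  qed
  have "card ?A = (\<Sum>y\<in>S ` ?A. card {\<phi> \<in> ?A. S \<phi> = y})"
    using sum.image_gen[OF finA, of "\<lambda>_. 1 :: nat" S] by simp
  also have "\<dots> \<le> (\<Sum>y\<in>S ` ?A. card \<Phi>)" by (rule sum_mono) (rule fiber)
  also have "\<dots> = card (S ` ?A) * card \<Phi>" by simp
  also have "\<dots> \<le> card (E' \<rightarrow>\<^sub>E (UNIV :: bit set)) * card \<Phi>"
    by (intro mult_right_mono card_mono cardP(2)[OF finE']) (auto simp: S_def)
  also have "\<dots> \<le> 2 ^ card E' * 2 ^ (card (faces m) + card V')"
    unfolding cardP(1)[OF finE'] using upper by (intro mult_left_mono) auto
  finally have "(2::nat) ^ card ?D \<le> 2 ^ (card E' + (card (faces m) + card V'))"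
    unfolding cardP(1)[OF finite_darts] power_add .
  then have "card ?D \<le> card E' + (card (faces m) + card V')" by simp
  moreover have "card E' + 1 = card (edges m)" using card_Suc_Diff1[OF finite_edges e0] by (simp add: E'_def)
  moreover have "card V' + 1 = card (vertices m)" using card_Suc_Diff1[OF fin(2) rv] by (simp add: V'_def)
  ultimately show ?thesis using card_edges by simp
qed

lemma lassos_nonempty:
  assumes "has_genus m g" "g \<ge> 1"
  shows "lassos m \<noteq> {}"
proof
  assume none: "lassos m = {}"
  have "card (edges m) + 2 \<le> card (faces m) + card (vertices m)"
  proof (rule euler_ge_2)
    show "holonomy m \<phi> p = 0" if "admissible m \<phi>" "is_loop m p" for \<phi> :: "'a \<Rightarrow> bit" and p
      using lasso_of_holonomy[OF that] none by blast
  qed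
  then show False using assms by (simp add: has_genus_def)
qed

end

section \<open>Invariance under isomorphism\<close>

lemma orbit_image:
  assumes "x \<in> A" "\<And>y. y \<in> A \<Longrightarrow> f y \<in> A" "\<And>y. y \<in> A \<Longrightarrow> h (f y) = f' (h y)"
  shows "orbit f' (h x) = h ` orbit f x"
proof -
  have pow: "(f ^^ n) x \<in> A \<and> h ((f ^^ n) x) = (f' ^^ n) (h x)" for n
    by (induction n) (use assms in auto)
  then show ?thesis by (auto simp: orbit_altdef image_iff) metis
qed

lemma map_of_map_inj:
  assumes "inj_on h (insert d (fst ` set xs))"
  shows "map_of (map (map_prod h h) xs) (h d) = map_option h (map_of xs d)"
  using assms by (induction xs) (auto simp: inj_on_def)

lemma shift_map: "shift \<epsilon> (map h p) = map h (shift \<epsilon> p)"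
  by (cases \<epsilon>) (simp_all add: rotate_map)

lemma set_shift: "set (shift \<epsilon> p) = set p"
  by (cases \<epsilon>) simp_all

lemma iso_via_id: "iso_via id m m"
  by (simp add: iso_via_def)

lemma iso_via_comp:
  assumes "iso_via h m m'" "iso_via h' m' m''"
  shows "iso_via (h' \<circ> h) m m''"
proof -
  have "h d \<in> darts m'" if "d \<in> darts m" for d using assms(1) that by (auto simp: iso_via_def bij_betw_def)
  then show ?thesis using assms by (auto simp: iso_via_def intro: bij_betw_trans)
qed

locale map_iso = m: rooted_map m + m': rooted_map m' for m :: "'a rmap" and m' :: "'b rmap" +
  fixes h :: "'a \<Rightarrow> 'b"
  assumes iso: "iso_via h m m'"
begin

lemma bij: "bij_betw h (darts m) (darts m')"
  and h_rev: "d \<in> darts m \<Longrightarrow> rev m' (h d) = h (rev m d)"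
  and h_nxt: "d \<in> darts m \<Longrightarrow> nxt m' (h d) = h (nxt m d)"
  and h_root: "root m' = h (root m)"
  using iso by (auto simp: iso_via_def)

lemma inj: "inj_on h (darts m)" and image: "h ` darts m = darts m'"
  using bij by (auto simp: bij_betw_def)

lemma h_in: "d \<in> darts m \<Longrightarrow> h d \<in> darts m'"
  using image by blast

abbreviation k where "k \<equiv> inv_into (darts m) h"

lemma k_h: "d \<in> darts m \<Longrightarrow> k (h d) = d"
  by (rule inv_into_f_f[OF inj])

lemma inverse: "map_iso m' m k"
proof
  have "k (rev m' d) = rev m (k d) \<and> k (nxt m' d) = nxt m (k d)" if "d \<in> darts m'" for d
  proof -
    have "k d \<in> darts m" "h (k d) = d" using that image by (simp_all add: inv_into_into f_inv_into_f)
    then show ?thesis using h_rev[of "k d"] h_nxt[of "k d"] by (simp add: k_h)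
  qed
  then show "iso_via k m' m"
    unfolding iso_via_def using bij_betw_inv_into[OF bij] k_h[OF m.root_in] h_root by simp
qed

lemma map_k_h: "set p \<subseteq> darts m \<Longrightarrow> map k (map h p) = p"
  by (simp add: k_h map_idI subsetD)

lemma map_h_in: "set p \<subseteq> darts m \<Longrightarrow> set (map h p) \<subseteq> darts m'"
  using h_in by auto

lemma h_rot: "d \<in> darts m \<Longrightarrow> rot m' (h d) = h (rot m d)"
proof -
  assume d: "d \<in> darts m"
  then have "inv (nxt m') (h d) = h (inv (nxt m) d)"
    using h_nxt[of "inv (nxt m) d"] m'.inv_nxt_nxt[of "h (inv (nxt m) d)"] by simp
  then show ?thesis using d by (simp add: rot_def h_rev)
qed

lemma tail_h: "d \<in> darts m \<Longrightarrow> tail m' (h d) = h ` tail m d"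
  unfolding tail_def by (rule orbit_image[of _ "darts m"]) (simp_all add: h_rot)

lemma head_h: "d \<in> darts m \<Longrightarrow> head m' (h d) = h ` head m d"
  unfolding head_def by (simp add: h_rev tail_h)

lemma face_subset: "f \<in> faces m \<Longrightarrow> f \<subseteq> darts m"
  unfolding faces_def using permutes_orbit_subset[OF m.nxt_permutes] by auto

lemma card_face: "f \<in> faces m \<Longrightarrow> card (h ` f) = card f"
  using face_subset inj by (intro card_image) (rule inj_on_subset)

lemma card_darts: "card (darts m') = card (darts m)"
  using bij_betw_same_card[OF bij] ..

lemma image_eq_iff: "v \<subseteq> darts m \<Longrightarrow> v' \<subseteq> darts m \<Longrightarrow> h ` v = h ` v' \<longleftrightarrow> v = v'"
  by (rule inj_on_image_eq_iff[OF inj])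

lemma root_vertex_h: "root_vertex m' = h ` root_vertex m"
  unfolding root_vertex_def h_root by (rule tail_h[OF m.root_in])

lemma head_subset: "d \<in> darts m \<Longrightarrow> head m d \<subseteq> darts m"
  unfolding head_def by (simp add: m.tail_subset)

lemma path_from_h:
  "v \<subseteq> darts m \<Longrightarrow> set p \<subseteq> darts m \<Longrightarrow> path_from m' (h ` v) (map h p) \<longleftrightarrow> path_from m v p"
proof (induction p arbitrary: v)
  case (Cons d p)
  then have d: "d \<in> darts m" and IH: "path_from m' (h ` head m d) (map h p) \<longleftrightarrow> path_from m (head m d) p"
    using head_subset by auto
  have "h ` tail m d = h ` v \<longleftrightarrow> tail m d = v" by (rule image_eq_iff[OF m.tail_subset[OF d] Cons.prems(1)])
  then show ?case using d IH h_in by (simp add: tail_h head_h)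
qed simp

lemma distinct_tails_h:
  assumes "set p \<subseteq> darts m"
  shows "distinct (map (tail m') (map h p)) \<longleftrightarrow> distinct (map (tail m) p)"
proof -
  have "map (tail m') (map h p) = map ((`) h) (map (tail m) p)" using assms by (auto simp: tail_h)
  moreover have "inj_on ((`) h) (set (map (tail m) p))"
  proof (rule inj_onI)
    fix v v' assume "v \<in> set (map (tail m) p)" "v' \<in> set (map (tail m) p)" "h ` v = h ` v'"
    then obtain d d' where "d \<in> set p" "d' \<in> set p" and eq: "v = tail m d" "v' = tail m d'" "h ` tail m d = h ` tail m d'"
      by auto
    then have "tail m d \<subseteq> darts m" "tail m d' \<subseteq> darts m" using assms m.tail_subset by blast+
    then show "v = v'" using eq(3) unfolding eq(1,2) by (simp only: image_eq_iff)
  qed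
  ultimately show ?thesis by (simp add: distinct_map del: map_map)
qed

lemma holonomy_h:
  "set p \<subseteq> darts m \<Longrightarrow> holonomy m (\<phi> \<circ> h) p = holonomy m' \<phi> (map h p)"
  by (induction p) (simp_all add: h_nxt)

lemma admissible_h:
  assumes "admissible m' \<phi>"
  shows "admissible m (\<phi> \<circ> h)"
  unfolding admissible_def
proof
  fix d assume d: "d \<in> darts m"
  have "- \<phi> (rev m' (h d)) + \<phi> (nxt m' (rev m' (h d))) = - (- \<phi> (h d) + \<phi> (nxt m' (h d)))"
    using assms h_in[OF d] by (simp add: admissible_def)
  then show "- (\<phi> \<circ> h) (rev m d) + (\<phi> \<circ> h) (nxt m (rev m d)) = - (- (\<phi> \<circ> h) d + (\<phi> \<circ> h) (nxt m d))"
    using d by (simp add: h_rev h_nxt)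
qed

text \<open>The two surfaces are never compared: a labeling with nonzero holonomy is pulled back
  along \<open>h\<close>. Its values lie in the group attached to the type \<open>'b\<close>, which
  \<open>lasso_atI\<close> accepts.\<close>

lemma lasso_at_pull:
  assumes w: "set w \<subseteq> darts m" and lasso: "lasso_at m' (map h w) j"
  shows "lasso_at m w j"
proof -
  have j: "j < length w" and path: "path_from m' (root_vertex m') (map h w)"
    and dist: "distinct (map (tail m') (map h w))"
    and closed: "head m' (last (map h w)) = tail m' (map h w ! j)"
    and nc: "noncontractible m' (drop j (map h w))"
    using lasso by (simp_all add: lasso_at_def)
  have "is_loop m' (drop j (map h w))"
    using m'.sublist_path[OF path, of j] j closed by (simp add: is_loop_iff hd_drop_conv_nth last_drop)
  then obtain \<phi> :: "'b \<Rightarrow> 'b holonomy_group" where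
    \<phi>: "admissible m' \<phi>" "holonomy m' \<phi> (drop j (map h w)) \<noteq> 0"
    using m'.noncontractible_iff nc by blast
  have "w \<noteq> []" using j by auto
  then have last: "last w \<in> darts m" and nth: "w ! j \<in> darts m" using w j last_in_set nth_mem by blast+
  show ?thesis
  proof (rule m.lasso_atI[OF j _ _ _ admissible_h[OF \<phi>(1)]])
    show "path_from m (root_vertex m) w"
      using path path_from_h[OF m.tail_subset[OF m.root_in] w] by (simp add: root_vertex_h) (simp add: root_vertex_def)
    show "distinct (map (tail m) w)" using dist distinct_tails_h[OF w] by simp
    have "h ` head m (last w) = h ` tail m (w ! j)"
      using closed j last nth by (cases "w = []") (simp_all add: last_map head_h tail_h)
    then show "head m (last w) = tail m (w ! j)"
      using image_eq_iff[OF head_subset[OF last] m.tail_subset[OF nth]] by simp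
    have "set (drop j w) \<subseteq> darts m" using w set_drop_subset[of j w] by (rule order_trans[rotated])
    then show "holonomy m (\<phi> \<circ> h) (drop j w) \<noteq> 0" using \<phi>(2) by (simp add: holonomy_h drop_map)
  qed
qed

lemma lasso_darts: "w \<in> lassos m \<Longrightarrow> set w \<subseteq> darts m"
  by (auto simp: lassos_iff lasso_at_def dest: path_from_darts)

lemma lasso_at_push:
  assumes "lasso_at m w j"
  shows "lasso_at m' (map h w) j"
proof -
  interpret inv: map_iso m' m k by (rule inverse)
  have w: "set w \<subseteq> darts m" using assms by (auto simp: lasso_at_def dest: path_from_darts)
  show ?thesis by (rule inv.lasso_at_pull[OF map_h_in[OF w]]) (use assms map_k_h[OF w] in simp)
qed

lemma extendable_push:
  assumes "extendable m p"
  shows "extendable m' (map h p)"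
proof -
  obtain q where "p @ q \<in> lassos m" using assms by (auto simp: extendable_def)
  then have "map h (p @ q) \<in> lassos m'" using lasso_at_push by (auto simp: lassos_iff simp del: map_append)
  then show ?thesis by (auto simp: extendable_def)
qed

lemma extendable_h:
  assumes "set p \<subseteq> darts m"
  shows "extendable m' (map h p) \<longleftrightarrow> extendable m p"
proof
  interpret inv: map_iso m' m k by (rule inverse)
  assume "extendable m' (map h p)"
  from inv.extendable_push[OF this] show "extendable m p" by (simp only: map_k_h[OF assms])
qed (rule extendable_push)

lemma turn_h:
  assumes "set p \<subseteq> darts m"
  shows "turn m' (map h p) n = h (turn m p n) \<and> turn m p n \<in> darts m"
proof -
  have "last p \<in> darts m" if "p \<noteq> []" using assms last_in_set[OF that] by blast
  then have "sweep_start m' (map h p) = h (sweep_start m p) \<and> sweep_start m p \<in> darts m"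
    using m.root_in by (auto simp: sweep_start_def h_root last_map h_rev)
  then show ?thesis by (induction n) (simp_all add: turn_0 turn_Suc h_rot)
qed

lemma next_dart_h:
  assumes "set p \<subseteq> darts m"
  shows "next_dart m' (map h p) = h (next_dart m p)"
proof -
  have "extendable m' (map h p @ [turn m' (map h p) n]) \<longleftrightarrow> extendable m (p @ [turn m p n])" for n
    using extendable_h[of "p @ [turn m p n]"] turn_h[OF assms, of n] assms by simp
  then show ?thesis unfolding next_dart_def' using turn_h[OF assms] by simp
qed

lemma rightmost_h:
  assumes "rightmost m w"
  shows "rightmost m' (map h w)"
proof -
  have w: "w \<in> lassos m" "set w \<subseteq> darts m" using assms lasso_darts by (auto simp: rightmost_def)
  have "map h w \<in> lassos m'" using w(1) lasso_at_push by (auto simp: lassos_iff)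
  moreover have "map h w ! i = next_dart m' (take i (map h w))" if "i < length w" for i
  proof -
    have "set (take i w) \<subseteq> darts m" using w(2) set_take_subset[of i w] by (rule order_trans[rotated])
    then have "next_dart m' (take i (map h w)) = h (next_dart m (take i w))" by (simp add: take_map next_dart_h)
    then show ?thesis using assms that by (simp add: rightmost_def)
  qed
  ultimately show ?thesis by (simp add: rightmost_def)
qed

lemma lassos_nonempty_h: "lassos m \<noteq> {} \<Longrightarrow> lassos m' \<noteq> {}"
  using lasso_at_push unfolding ex_in_conv[symmetric] lassos_iff by blast

lemma reglue_h:
  assumes p: "set p \<subseteq> darts m" and d: "d \<in> darts m"
  shows "reglue m' (map h p) \<epsilon> (h d) = h (reglue m p \<epsilon> d)"
proof -
  let ?r = "map (rev m) p" and ?l = "shift \<epsilon> p"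
  let ?xs = "zip ?r ?l @ zip ?l ?r"
  have r: "map (rev m') (map h p) = map h ?r" using p by (auto simp: h_rev)
  have "fst ` set ?xs \<subseteq> set ?r \<union> set ?l" by (auto dest: set_zip_leftD)
  then have "insert d (fst ` set ?xs) \<subseteq> darts m" using p d by (auto simp: set_shift subset_iff)
  then have "inj_on h (insert d (fst ` set ?xs))" by (rule inj_on_subset[OF inj])
  then have "map_of (map (map_prod h h) ?xs) (h d) = map_option h (map_of ?xs d)" by (rule map_of_map_inj)
  moreover have "map (map_prod h h) ?xs
      = zip (map (rev m') (map h p)) (shift \<epsilon> (map h p)) @ zip (shift \<epsilon> (map h p)) (map (rev m') (map h p))"
    unfolding r shift_map by (simp only: map_append zip_map_map map_prod_def)
  ultimately have eq: "map_of (zip (map (rev m') (map h p)) (shift \<epsilon> (map h p)) @ zip (shift \<epsilon> (map h p)) (map (rev m') (map h p))) (h d)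
      = map_option h (map_of ?xs d)" by (simp only:)
  show ?thesis unfolding reglue_def Let_def eq
    by (cases "map_of ?xs d") (simp_all only: option.map option.case h_rev[OF d])
qed

lemma psi_h:
  assumes "lassos m \<noteq> {}"
  shows "iso_via h (psi \<epsilon> m) (psi \<epsilon> m')"
proof -
  have rm: "rightmost m (rightmost_lasso m)" (is "rightmost m ?w") by (rule m.rightmost_exists[OF assms])
  then have w: "?w \<in> lassos m" by (simp add: rightmost_def)
  then obtain j where j: "lasso_at m ?w j" by (auto simp: lassos_iff)
  have loop: "rightmost_loop m = drop j ?w" by (rule rightmost_loop_eq[OF rm j])
  have loop': "rightmost_loop m' = map h (rightmost_loop m)"
    unfolding rightmost_loop_eq[OF rightmost_h[OF rm] lasso_at_push[OF j]] loop by (rule drop_map)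
  have "set (rightmost_loop m) \<subseteq> darts m"
    unfolding loop using lasso_darts[OF w] set_drop_subset[of j ?w] by (rule order_trans[rotated])
  then show ?thesis
    using bij h_root by (simp add: iso_via_def psi_def rotation_def loop' reglue_h h_nxt)
qed

end

section \<open>Passing to isomorphism classes\<close>

lemma iso_rel_iff: "(m, m') \<in> iso_rel \<longleftrightarrow> (\<exists>h. map_iso m m' h)"
  by (auto simp: iso_rel_def map_iso_def map_iso_axioms_def rooted_map_def)

lemma map_isoI: "is_map m \<Longrightarrow> is_map m' \<Longrightarrow> iso_via h m m' \<Longrightarrow> map_iso m m' h"
  by (simp add: map_iso_def map_iso_axioms_def rooted_map_def)

lemma equiv_iso_rel: "equiv {m. is_map m} iso_rel"
proof (rule equivI)
  show "refl_on {m. is_map m} iso_rel" using iso_via_id by (auto simp: refl_on_def iso_rel_def)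
  show "sym iso_rel" unfolding sym_def iso_rel_iff using map_iso.inverse by blast
  show "trans iso_rel" unfolding trans_def iso_rel_def using iso_via_comp by blast
  show "iso_rel \<subseteq> {m. is_map m} \<times> {m. is_map m}" by (auto simp: iso_rel_def)
qed

lemma labeled_iso_rel_iff:
  "((m, fs), (m', fs')) \<in> labeled_iso_rel \<longleftrightarrow>
     is_labeling m fs \<and> is_labeling m' fs' \<and> (\<exists>h. map_iso m m' h \<and> map ((`) h) fs = fs')"
  by (auto simp: labeled_iso_rel_def map_iso_def map_iso_axioms_def rooted_map_def)

lemma labeled_iso_rel_sym:
  assumes "(x, y) \<in> labeled_iso_rel"
  shows "(y, x) \<in> labeled_iso_rel"
proof -
  obtain m fs m' fs' where eq: "x = (m, fs)" "y = (m', fs')" by (cases x, cases y)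
  with assms obtain h where h: "is_labeling m fs" "is_labeling m' fs'" "map_iso m m' h" "map ((`) h) fs = fs'"
    by (auto simp: labeled_iso_rel_iff)
  interpret map_iso m m' h by (rule h(3))
  have "map ((`) k) (map ((`) h) fs) = fs"
    unfolding map_map
  proof (rule map_idI)
    fix f assume "f \<in> set fs"
    then have "f \<subseteq> darts m" using h(1) face_subset by (auto simp: is_labeling_def)
    then show "((`) k \<circ> (`) h) f = f" by (simp add: inv_into_image_cancel[OF inj])
  qed
  then have "map ((`) k) fs' = fs" by (simp only: h(4))
  then show ?thesis unfolding eq labeled_iso_rel_iff using h(1,2) inverse by (intro conjI exI[of _ k])
qed

lemma labeled_iso_rel_trans:
  assumes "(x, y) \<in> labeled_iso_rel" "(y, z) \<in> labeled_iso_rel"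
  shows "(x, z) \<in> labeled_iso_rel"
proof -
  obtain m fs m' fs' m'' fs'' where eq: "x = (m, fs)" "y = (m', fs')" "z = (m'', fs'')" by (cases x, cases y, cases z)
  obtain h where h: "iso_via h m m'" "map ((`) h) fs = fs'" and 1: "is_map m" "is_labeling m fs"
    using assms(1) unfolding eq labeled_iso_rel_def by auto
  obtain h' where h': "iso_via h' m' m''" "map ((`) h') fs' = fs''" and 2: "is_map m''" "is_labeling m'' fs''"
    using assms(2) unfolding eq labeled_iso_rel_def by auto
  have "map ((`) (h' \<circ> h)) fs = fs''" unfolding h(2)[symmetric] h'(2)[symmetric] by (simp add: image_comp comp_def)
  then show ?thesis using 1 2 iso_via_comp[OF h(1) h'(1)] unfolding eq labeled_iso_rel_def by blast
qed

lemma equiv_labeled_iso_rel: "equiv {(m :: 'a rmap, fs). is_map m \<and> is_labeling m fs} labeled_iso_rel"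
proof (rule equivI)
  show "refl_on {(m, fs). is_map m \<and> is_labeling m fs} labeled_iso_rel"
    by (auto simp: refl_on_def labeled_iso_rel_def intro!: exI[of _ id] iso_via_id)
  show "sym labeled_iso_rel" by (rule symI) (rule labeled_iso_rel_sym)
  show "trans labeled_iso_rel" by (rule transI) (rule labeled_iso_rel_trans)
  show "labeled_iso_rel \<subseteq> {(m, fs). is_map m \<and> is_labeling m fs} \<times> {(m, fs). is_map m \<and> is_labeling m fs}"
    by (auto simp: labeled_iso_rel_def)
qed

lemma iso_rel_psi:
  assumes "(m, m') \<in> iso_rel" "lassos m \<noteq> {}"
  shows "(psi \<epsilon> m, psi \<epsilon> m') \<in> iso_rel"
proof -
  obtain h where h: "map_iso m m' h" using assms(1) by (auto simp: iso_rel_iff)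
  interpret map_iso m m' h by (rule h)
  have "map_iso (psi \<epsilon> m) (psi \<epsilon> m') h"
    by (rule map_isoI[OF m.psi_properties(1)[OF assms(2)] m'.psi_properties(1)[OF lassos_nonempty_h[OF assms(2)]]
        psi_h[OF assms(2)]])
  then show ?thesis unfolding iso_rel_iff by blast
qed

lemma labeled_iso_rel_psi:
  assumes "(x, y) \<in> labeled_iso_rel" "lassos (fst x) \<noteq> {}"
  shows "(labeled_psi \<epsilon> x, labeled_psi \<epsilon> y) \<in> labeled_iso_rel"
proof -
  obtain m fs m' fs' where eq: "x = (m, fs)" "y = (m', fs')" by (cases x, cases y)
  obtain h where h: "is_labeling m fs" "is_labeling m' fs'" "map_iso m m' h" "map ((`) h) fs = fs'"
    using assms(1) unfolding eq labeled_iso_rel_iff by blast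
  interpret map_iso m m' h by (rule h(3))
  have ne: "lassos m \<noteq> {}" using assms(2) by (simp add: eq)
  note ne' = lassos_nonempty_h[OF ne]
  have "map_iso (psi \<epsilon> m) (psi \<epsilon> m') h"
    by (rule map_isoI[OF m.psi_properties(1)[OF ne] m'.psi_properties(1)[OF ne'] psi_h[OF ne]])
  moreover have "is_labeling (psi \<epsilon> m) fs" "is_labeling (psi \<epsilon> m') fs'"
    using h(1,2) by (simp_all add: is_labeling_def m.psi_properties(4)[OF ne] m'.psi_properties(4)[OF ne'])
  ultimately show ?thesis unfolding eq labeled_psi_def prod.case labeled_iso_rel_iff using h(4) by blast
qed

lemma type_of_labeled_iso_rel:
  assumes "(x, y) \<in> labeled_iso_rel"
  shows "type_of y = type_of x"
proof -
  obtain m fs m' fs' where eq: "x = (m, fs)" "y = (m', fs')" by (cases x, cases y)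
  obtain h where h: "is_labeling m fs" "map_iso m m' h" "map ((`) h) fs = fs'"
    using assms unfolding eq labeled_iso_rel_iff by blast
  interpret map_iso m m' h by (rule h(2))
  show ?thesis using h(1) card_face unfolding eq h(3)[symmetric] by (auto simp: type_of_def face_degree_def is_labeling_def)
qed

text \<open>Compatibility of \<open>f\<close> with \<open>R\<close> is asked on the class of
  \<open>x\<close> only, because \<open>psi\<close> is known to respect isomorphism only for maps
  that have a lasso.\<close>

lemma UN_equiv_class_image:
  assumes "equiv A R" "x \<in> A" "\<And>y. (x, y) \<in> R \<Longrightarrow> (f x, f y) \<in> R"
  shows "(\<Union>y\<in>R `` {x}. R `` {f y}) = R `` {f x}"
proof -
  have "R `` {f y} = R `` {f x}" if "y \<in> R `` {x}" for y
    using equiv_class_eq[OF assms(1) assms(3)] that by auto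
  moreover have "x \<in> R `` {x}" by (rule equiv_class_self[OF assms(1,2)])
  ultimately show ?thesis by blast
qed

lemma even_maps_lassos:
  assumes "g \<ge> 1" "m \<in> even_maps g"
  shows "rooted_map m" "lassos m \<noteq> {}"
  using assms rooted_map.lassos_nonempty[of m g] by (auto simp: even_maps_def rooted_map_def)

lemma psi_even_maps:
  assumes "g \<ge> 1" "m \<in> even_maps g"
  shows "psi \<epsilon> m \<in> even_maps g"
proof -
  interpret rooted_map m by (rule even_maps_lassos[OF assms])
  note psi = psi_properties[OF even_maps_lassos(2)[OF assms], of \<epsilon>]
  show ?thesis using assms(2) psi by (simp add: even_maps_def has_genus_def)
qed

lemma Psi_class:
  assumes "g \<ge> 1" "m \<in> even_maps g"
  shows "Psi \<epsilon> (iso_rel `` {m}) = iso_rel `` {psi \<epsilon> m}"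
  unfolding Psi_def
proof (rule UN_equiv_class_image[OF equiv_iso_rel])
  show "m \<in> {m. is_map m}" using assms(2) by (simp add: even_maps_def)
qed (rule iso_rel_psi[OF _ even_maps_lassos(2)[OF assms]])

lemma Labeled_Psi_class:
  assumes "g \<ge> 1" "m \<in> even_maps g" "is_labeling m fs"
  shows "Labeled_Psi \<epsilon> (labeled_iso_rel `` {(m, fs)}) = labeled_iso_rel `` {(psi \<epsilon> m, fs)}"
proof -
  have "(\<Union>y\<in>labeled_iso_rel `` {(m, fs)}. labeled_iso_rel `` {labeled_psi \<epsilon> y})
      = labeled_iso_rel `` {labeled_psi \<epsilon> (m, fs)}"
  proof (rule UN_equiv_class_image[OF equiv_labeled_iso_rel])
    show "(m, fs) \<in> {(m, fs). is_map m \<and> is_labeling m fs}" using assms(2,3) by (simp add: even_maps_def)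
  qed (rule labeled_iso_rel_psi, use even_maps_lassos(2)[OF assms(1,2)] in simp_all)
  then show ?thesis by (simp add: Labeled_Psi_def labeled_psi_def)
qed

lemma Maps_cases:
  assumes "C \<in> Maps g"
  obtains m where "m \<in> even_maps g" "C = iso_rel `` {m}"
  using assms unfolding Maps_def by (rule quotientE)

lemma Psi_Maps: "g \<ge> 1 \<Longrightarrow> C \<in> Maps g \<Longrightarrow> Psi \<epsilon> C \<in> Maps g"
  using psi_even_maps by (elim Maps_cases) (simp add: Psi_class Maps_def quotientI)

lemma Psi_opposite:
  assumes "g \<ge> 1" "C \<in> Maps g"
  shows "Psi (opposite \<epsilon>) (Psi \<epsilon> C) = C"
proof -
  obtain m where m: "m \<in> even_maps g" "C = iso_rel `` {m}" using assms(2) by (rule Maps_cases)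
  interpret rooted_map m by (rule even_maps_lassos[OF assms(1) m(1)])
  show ?thesis
    by (simp add: m(2) Psi_class[OF assms(1)] m(1) psi_even_maps[OF assms(1) m(1)]
        psi_properties(7)[OF even_maps_lassos(2)[OF assms(1) m(1)]])
qed

lemma card_edges_iso_rel:
  assumes "(m, m') \<in> iso_rel"
  shows "card (edges m') = card (edges m)"
proof -
  obtain h where h: "map_iso m m' h" using assms by (auto simp: iso_rel_iff)
  interpret map_iso m m' h by (rule h)
  show ?thesis using m.card_edges m'.card_edges card_darts by simp
qed

lemma Psi_card_edges:
  assumes "g \<ge> 1" "C \<in> Maps g" "m \<in> C" "m' \<in> Psi \<epsilon> C"
  shows "card (edges m') = card (edges m)"
proof -
  obtain n where n: "n \<in> even_maps g" "C = iso_rel `` {n}" using assms(2) by (rule Maps_cases)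
  interpret rooted_map n by (rule even_maps_lassos[OF assms(1) n(1)])
  have "(n, m) \<in> iso_rel" "(psi \<epsilon> n, m') \<in> iso_rel"
    using assms(3,4) by (auto simp: n(2) Psi_class[OF assms(1) n(1)])
  then show ?thesis
    using psi_properties(5)[OF even_maps_lassos(2)[OF assms(1) n(1)], of \<epsilon>] by (simp add: card_edges_iso_rel)
qed

lemma Labeled_Psi_type:
  assumes "g \<ge> 1" "L \<in> Labeled_Maps g"
  shows "Labeled_Psi \<epsilon> L \<in> Labeled_Maps g"
    and "x \<in> L \<Longrightarrow> y \<in> Labeled_Psi \<epsilon> L \<Longrightarrow> type_of y = type_of x"
proof -
  obtain m fs where m: "m \<in> even_maps g" "is_labeling m fs" and L: "L = labeled_iso_rel `` {(m, fs)}"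
    using assms(2) unfolding Labeled_Maps_def by (elim quotientE) auto
  interpret rooted_map m by (rule even_maps_lassos[OF assms(1) m(1)])
  have LP: "Labeled_Psi \<epsilon> L = labeled_iso_rel `` {(psi \<epsilon> m, fs)}"
    unfolding L by (rule Labeled_Psi_class[OF assms(1) m])
  have "is_labeling (psi \<epsilon> m) fs"
    using m(2) psi_properties(4)[OF even_maps_lassos(2)[OF assms(1) m(1)]] by (simp add: is_labeling_def)
  then show "Labeled_Psi \<epsilon> L \<in> Labeled_Maps g"
    unfolding LP Labeled_Maps_def using psi_even_maps[OF assms(1) m(1)] by (intro quotientI) simp
  assume "x \<in> L" "y \<in> Labeled_Psi \<epsilon> L"
  then have "type_of x = type_of (m, fs)" "type_of y = type_of (psi \<epsilon> m, fs)"
    unfolding LP unfolding L by (auto intro: type_of_labeled_iso_rel)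
  then show "type_of y = type_of x" by (simp add: type_of_def)
qed

theorem theorem3:
  fixes g :: nat
  assumes "g \<ge> 1"
  shows "(\<forall>\<epsilon>. bij_betw (Psi \<epsilon>) (Maps g) (Maps g)) \<and>
    (\<forall>C\<in>Maps g. Psi Minus (Psi Plus C) = C \<and> Psi Plus (Psi Minus C) = C) \<and>
    (\<forall>\<epsilon>. \<forall>C\<in>Maps g. \<forall>m\<in>C. \<forall>m'\<in>Psi \<epsilon> C. card (edges m') = card (edges m)) \<and>
    (\<forall>\<epsilon>. \<forall>L\<in>Labeled_Maps g. Labeled_Psi \<epsilon> L \<in> Labeled_Maps g \<and>
       (\<forall>x\<in>L. \<forall>y\<in>Labeled_Psi \<epsilon> L. type_of y = type_of x))"
  proof (intro conjI allI ballI)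
  have opp: "opposite (opposite \<epsilon>) = \<epsilon>" for \<epsilon> by (cases \<epsilon>) simp_all
  show "bij_betw (Psi \<epsilon>) (Maps g) (Maps g)" for \<epsilon>
  proof (rule bij_betw_byWitness[of _ "Psi (opposite \<epsilon>)"])
    show "\<forall>C\<in>Maps g. Psi (opposite \<epsilon>) (Psi \<epsilon> C) = C" by (intro ballI Psi_opposite[OF assms])
    show "\<forall>C\<in>Maps g. Psi \<epsilon> (Psi (opposite \<epsilon>) C) = C"
      using Psi_opposite[OF assms, of _ "opposite \<epsilon>"] by (simp add: opp)
    show "Psi \<epsilon> ` Maps g \<subseteq> Maps g" "Psi (opposite \<epsilon>) ` Maps g \<subseteq> Maps g"
      by (intro image_subsetI Psi_Maps[OF assms], assumption)+
  qed
  show "Psi Minus (Psi Plus C) = C" if "C \<in> Maps g" for C using Psi_opposite[OF assms that, of Plus] by simp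
  show "Psi Plus (Psi Minus C) = C" if "C \<in> Maps g" for C using Psi_opposite[OF assms that, of Minus] by simp
  show "card (edges m') = card (edges m)" if "C \<in> Maps g" "m \<in> C" "m' \<in> Psi \<epsilon> C" for \<epsilon> C m m'
    by (rule Psi_card_edges[OF assms that])
  show "Labeled_Psi \<epsilon> L \<in> Labeled_Maps g" if "L \<in> Labeled_Maps g" for \<epsilon> L
    by (rule Labeled_Psi_type(1)[OF assms that])
  show "type_of y = type_of x" if "L \<in> Labeled_Maps g" "x \<in> L" "y \<in> Labeled_Psi \<epsilon> L" for \<epsilon> L x y
    by (rule Labeled_Psi_type(2)[OF assms that])
qed


end
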